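(* Suppose $V_0\subseteq V_1$ are models of set theory, $\kappa$ is an infinite ordinal, $X,\mathscr{L}\in V_0$ with $X$ infinite and $\mathscr{L}$ a relational language, and let $\mu\in V_0$ be an invariant measure on $[\mathrm{Str}^\kappa_{\mathscr{L}}(X)]^{V_0}$. Then $\mu$ is ergodic in $V_0$ if and only if $\mu^{V_1}$ is ergodic in $V_1$.
   Context: A model of set theory is a transitive model of ZFC (contained in a fixed background model); $\kappa\in V_0$ need not be a cardinal in any given model. Structures and measures: $\mathrm{Str}_{\mathscr{L}}(X)$ is the set of $\mathscr{L}$-structures with underlying set $X$. An $\mathscr{L}$-literal is an atomic formula or a (possibly iterated) negation of one. $\sigma_\kappa(\mathrm{Str}_{\mathscr{L}}(X))$ is the smallest family of subsets of $\mathrm{Str}_{\mathscr{L}}(X)$ closed under complements and under unions of size $\le\kappa$ and containing all sets $\{\mathcal{M}:\mathcal{M}\models\varphi(\bar a)\}$ for $\varphi$ a literal and $\bar a$ a tuple from $X$. $\mathrm{Str}^\kappa_{\mathscr{L}}(X)$ is $\mathrm{Str}_{\mathscr{L}}(X)$ with this family of measurable sets. A probability $\kappa$-measure on it is a probability measure $\mu$ with $\mu(\bigcup_{i\in\kappa}A_i)=\sum_{i\in\kappa}\mu(A_i)$ for pairwise disjoint measurable $A_i$. $\mathrm{Sym}(X)$ acts by $g\mathcal{M}\models R(g(a_0),\dots)$ iff $\mathcal{M}\models R(a_0,\dots)$; $\mu$ is invariant if $\mu(g[A])=\mu(A)$ for all $g\in\mathrm{Sym}(X)$ and measurable $A$.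 "Invariant measure" means invariant probability $\kappa$-measure. A measurable set $A$ is $\mu$-almost invariant if $\mu(g[A]\,\triangle\,A)=0$ for all $g\in\mathrm{Sym}(X)$. An invariant measure $\mu$ is ergodic if every $\mu$-almost invariant measurable set $A$ has $\mu(A)\in\{0,1\}$. Relativization: $\mu^{V_1}$ denotes the relativization of $\mu$ to $V_1$, i.e. the unique probability $\kappa$-measure in $V_1$ on $[\mathrm{Str}^\kappa_{\mathscr{L}}(X)]^{V_1}$ such that for every finite conjunction $\varphi$ of $\mathscr{L}$-literals and tuple $\bar a$ from $X$, the set $\{\mathcal{M}:\mathcal{M}\models\varphi(\bar a)\}$ computed in $V_1$ has the same $\mu^{V_1}$-measure as the $\mu$-measure of that set computed in $V_0$. *)

theory Defs
  imports "HOL-Analysis.Infinite_Sum" "HOL-Library.Disjoint_Sets"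
begin

text \<open>
  Models of set theory live inside a background universe, given by a type whose elements are the
  sets; \<open>elts x\<close> is the collection of members of \<open>x\<close>.  First-order formulas are deeply embedded
  because the separation and replacement schemes of a transitive model may only range over
  first-order definable properties (with arbitrary HOL predicates a transitive model would contain
  every subset of each of its members, and \<open>V0 \<subseteq> V1\<close> would lose its content).
\<close>

datatype set_formula =
    FMem nat nat
  | FEq nat nat
  | FNeg set_formula
  | FConj set_formula set_formula
  | FAll nat set_formula

primrec fsat :: "('u \<Rightarrow> 'u set) \<Rightarrow> 'u set \<Rightarrow> (nat \<Rightarrow> 'u) \<Rightarrow> set_formula \<Rightarrow> bool" where
  "fsat el V e (FMem i j) \<longleftrightarrow> e i \<in> el (e j)"
| "fsat el V e (FEq i j) \<longleftrightarrow> e i = e j"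
| "fsat el V e (FNeg p) \<longleftrightarrow> \<not> fsat el V e p"
| "fsat el V e (FConj p q) \<longleftrightarrow> fsat el V e p \<and> fsat el V e q"
| "fsat el V e (FAll i p) \<longleftrightarrow> (\<forall>x\<in>V. fsat el V (e(i := x)) p)"

definition ZFC :: "('u \<Rightarrow> 'u set) \<Rightarrow> 'u set \<Rightarrow> bool" where
  "ZFC el V \<longleftrightarrow>
    \<comment> \<open>extensionality\<close>
    (\<forall>x\<in>V. \<forall>y\<in>V. (\<forall>z\<in>V. z \<in> el x \<longleftrightarrow> z \<in> el y) \<longrightarrow> x = y) \<and>
    \<comment> \<open>foundation\<close>
    (\<forall>x\<in>V. (\<exists>y\<in>V. y \<in> el x) \<longrightarrow> (\<exists>y\<in>V. y \<in> el x \<and> \<not> (\<exists>z\<in>V. z \<in> el x \<and> z \<in> el y))) \<and>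
    \<comment> \<open>pairing\<close>
    (\<forall>x\<in>V. \<forall>y\<in>V. \<exists>z\<in>V. \<forall>w\<in>V. w \<in> el z \<longleftrightarrow> w = x \<or> w = y) \<and>
    \<comment> \<open>union\<close>
    (\<forall>x\<in>V. \<exists>u\<in>V. \<forall>w\<in>V. w \<in> el u \<longleftrightarrow> (\<exists>y\<in>V. y \<in> el x \<and> w \<in> el y)) \<and>
    \<comment> \<open>power set\<close>
    (\<forall>x\<in>V. \<exists>p\<in>V. \<forall>y\<in>V. y \<in> el p \<longleftrightarrow> (\<forall>z\<in>V. z \<in> el y \<longrightarrow> z \<in> el x)) \<and>
    \<comment> \<open>infinity\<close>
    (\<exists>w\<in>V. (\<exists>s\<in>V. s \<in> el w \<and> (\<forall>z\<in>V. z \<notin> el s)) \<and>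
       (\<forall>x\<in>V. x \<in> el w \<longrightarrow> (\<exists>s\<in>V. s \<in> el w \<and> (\<forall>z\<in>V. z \<in> el s \<longleftrightarrow> z \<in> el x \<or> z = x)))) \<and>
    \<comment> \<open>separation\<close>
    (\<forall>p e. (\<forall>i. e i \<in> V) \<longrightarrow>
       (\<forall>a\<in>V. \<exists>b\<in>V. \<forall>x\<in>V. x \<in> el b \<longleftrightarrow> x \<in> el a \<and> fsat el V (e(0 := x)) p)) \<and>
    \<comment> \<open>replacement\<close>
    (\<forall>p e. (\<forall>i. e i \<in> V) \<longrightarrow>
       (\<forall>a\<in>V. (\<forall>x\<in>V. x \<in> el a \<longrightarrow> (\<exists>!y. y \<in> V \<and> fsat el V (e(0 := x, 1 := y)) p)) \<longrightarrow>
          (\<exists>b\<in>V. \<forall>y\<in>V. y \<in> el b \<longleftrightarrow> (\<exists>x\<in>V. x \<in> el a \<and> fsat el V (e(0 := x, 1 := y)) p)))) \<and>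
    \<comment> \<open>choice\<close>
    (\<forall>x\<in>V. (\<forall>y\<in>V. y \<in> el x \<longrightarrow> (\<exists>z\<in>V. z \<in> el y)) \<longrightarrow>
       (\<forall>y\<in>V. \<forall>y'\<in>V. y \<in> el x \<longrightarrow> y' \<in> el x \<longrightarrow> y \<noteq> y' \<longrightarrow> \<not> (\<exists>z\<in>V. z \<in> el y \<and> z \<in> el y')) \<longrightarrow>
       (\<exists>c\<in>V. \<forall>y\<in>V. y \<in> el x \<longrightarrow> (\<exists>!z. z \<in> V \<and> z \<in> el y \<and> z \<in> el c)))"

text \<open>
  The background model.  As usual for transitive models, membership is the membership of the
  ambient universe, hence really well-founded; in particular natural numbers and finite sequences
  of a transitive model are the standard ones, which is what allows the use of HOL's \<open>nat\<close>, lists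
  and \<open>real\<close> below.
\<close>

class set_universe =
  fixes elts :: "'a \<Rightarrow> 'a set"
  assumes inj_elts: "inj elts"
    and wf_elts: "wf {(x, y). x \<in> elts y}"
    and ZFC_universe: "ZFC elts UNIV"

definition model_of_set_theory :: "'u::set_universe set \<Rightarrow> bool" where
  "model_of_set_theory V \<longleftrightarrow> (\<forall>x\<in>V. elts x \<subseteq> V) \<and> ZFC elts V"

text \<open>\<open>as_set A\<close> is meaningful only if \<open>A\<close> is the collection of members of some set.\<close>

definition as_set :: "'u::set_universe set \<Rightarrow> 'u" where
  "as_set A = (THE x. elts x = A)"

definition pair :: "'u::set_universe \<Rightarrow> 'u \<Rightarrow> 'u" where
  "pair x y = as_set {as_set {x}, as_set {x, y}}"

primrec numeral_set :: "nat \<Rightarrow> 'u::set_universe" where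
  "numeral_set 0 = as_set {}"
| "numeral_set (Suc n) = as_set (insert (numeral_set n) (elts (numeral_set n)))"

definition omega :: "'u::set_universe" where
  "omega = as_set (range numeral_set)"

definition ordinal :: "'u::set_universe \<Rightarrow> bool" where
  "ordinal k \<longleftrightarrow> (\<forall>x\<in>elts k. elts x \<subseteq> elts k) \<and> (\<forall>x\<in>elts k. \<forall>y\<in>elts x. elts y \<subseteq> elts x)"

definition function_on :: "'u::set_universe \<Rightarrow> 'u set \<Rightarrow> bool" where
  "function_on f A \<longleftrightarrow> (\<forall>p\<in>elts f. \<exists>x\<in>A. \<exists>y. p = pair x y) \<and>
     (\<forall>x\<in>A. \<exists>!y. pair x y \<in> elts f)"

definition app :: "'u::set_universe \<Rightarrow> 'u \<Rightarrow> 'u" where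
  "app f x = (THE y. pair x y \<in> elts f)"

definition tuple :: "'u::set_universe list \<Rightarrow> 'u" where
  "tuple xs = as_set {pair (numeral_set i) (xs ! i) |i. i < length xs}"

text \<open>The cardinality comparison \<open>|F| \<le> |k|\<close> as computed in \<open>V\<close>.\<close>

definition size_le :: "'u::set_universe set \<Rightarrow> 'u \<Rightarrow> 'u \<Rightarrow> bool" where
  "size_le V F k \<longleftrightarrow>
     (\<exists>f\<in>V. function_on f (elts F) \<and> app f ` elts F \<subseteq> elts k \<and> inj_on (app f) (elts F))"

definition Sym :: "'u::set_universe set \<Rightarrow> 'u \<Rightarrow> 'u set" where
  "Sym V X = {g \<in> V. function_on g (elts X) \<and> bij_betw (app g) (elts X) (elts X)}"

text \<open>
  A real number as a set: the Dedekind cut of the rationals below it, the rational \<open>(a - b) / c\<close>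
  being represented by all triples \<open>(a, (b, c))\<close> of natural numbers with \<open>c > 0\<close>.
\<close>

definition codes_real :: "'u::set_universe \<Rightarrow> real \<Rightarrow> bool" where
  "codes_real y r \<longleftrightarrow> elts y =
     {pair (numeral_set a) (pair (numeral_set b) (numeral_set c)) |a b c.
        c > 0 \<and> (real a - real b) / real c < r}"

text \<open>A relational language is a function from relation symbols to their arities.\<close>

definition relational_language :: "'u::set_universe \<Rightarrow> bool" where
  "relational_language L \<longleftrightarrow> (\<forall>p\<in>elts L. \<exists>R n. p = pair R (numeral_set n)) \<and>
     (\<forall>R m n. pair R m \<in> elts L \<longrightarrow> pair R n \<in> elts L \<longrightarrow> m = n)"

definition has_arity :: "'u::set_universe \<Rightarrow> 'u \<Rightarrow> nat \<Rightarrow> bool" where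
  "has_arity L R n \<longleftrightarrow> pair R (numeral_set n) \<in> elts L"

text \<open>A structure with underlying set \<open>X\<close> is given by its interpretation function.\<close>

definition is_structure :: "'u::set_universe \<Rightarrow> 'u \<Rightarrow> 'u \<Rightarrow> bool" where
  "is_structure L X M \<longleftrightarrow>
     (\<forall>p\<in>elts M. \<exists>R n r. has_arity L R n \<and> p = pair R r) \<and>
     (\<forall>R n. has_arity L R n \<longrightarrow> (\<exists>!r. pair R r \<in> elts M) \<and>
        elts (app M R) \<subseteq> {tuple xs |xs. length xs = n \<and> set xs \<subseteq> elts X})"

definition Str :: "'u::set_universe set \<Rightarrow> 'u \<Rightarrow> 'u \<Rightarrow> 'u set" where
  "Str V L X = {M \<in> V. is_structure L X M}"

text \<open>Variables of literals are natural numbers; \<open>i\<close> is interpreted by the \<open>i\<close>-th entry of a tuple.\<close>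

datatype 'u literal =
    Rel 'u "nat list"
  | Eql nat nat
  | Neg "'u literal"

primrec is_literal :: "'u::set_universe \<Rightarrow> nat \<Rightarrow> 'u literal \<Rightarrow> bool" where
  "is_literal L k (Rel R vs) \<longleftrightarrow> has_arity L R (length vs) \<and> set vs \<subseteq> {..<k}"
| "is_literal L k (Eql i j) \<longleftrightarrow> i < k \<and> j < k"
| "is_literal L k (Neg p) \<longleftrightarrow> is_literal L k p"

primrec lit_sat :: "'u::set_universe \<Rightarrow> 'u list \<Rightarrow> 'u literal \<Rightarrow> bool" where
  "lit_sat M xs (Rel R vs) \<longleftrightarrow> tuple (map (nth xs) vs) \<in> elts (app M R)"
| "lit_sat M xs (Eql i j) \<longleftrightarrow> xs ! i = xs ! j"
| "lit_sat M xs (Neg p) \<longleftrightarrow> \<not> lit_sat M xs p"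

text \<open>
  The set defined by the conjunction of the literals \<open>ps\<close> at the tuple \<open>xs\<close>, computed in \<open>V\<close>.
  Sets of structures that belong to a model are handled as HOL sets, i.e. as values of \<open>elts\<close>.
\<close>

definition cylinder ::
    "'u::set_universe set \<Rightarrow> 'u \<Rightarrow> 'u \<Rightarrow> 'u literal list \<Rightarrow> 'u list \<Rightarrow> 'u set" where
  "cylinder V L X ps xs = {M \<in> Str V L X. \<forall>p\<in>set ps. lit_sat M xs p}"

definition closed_family :: "'u::set_universe set \<Rightarrow> 'u \<Rightarrow> 'u \<Rightarrow> 'u \<Rightarrow> 'u \<Rightarrow> bool" where
  "closed_family V k L X S \<longleftrightarrow> S \<in> V \<and>
     (\<forall>A\<in>elts S. elts A \<subseteq> Str V L X) \<and>
     (\<forall>p xs. set xs \<subseteq> elts X \<longrightarrow> is_literal L (length xs) p \<longrightarrow>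
        cylinder V L X [p] xs \<in> elts ` elts S) \<and>
     (\<forall>A\<in>elts S. Str V L X - elts A \<in> elts ` elts S) \<and>
     (\<forall>F\<in>V. elts F \<subseteq> elts S \<longrightarrow> size_le V F k \<longrightarrow> (\<Union>A\<in>elts F. elts A) \<in> elts ` elts S)"

text \<open>The smallest closed family, computed in \<open>V\<close>: the intersection of all those belonging to \<open>V\<close>.\<close>

definition measurable_sets :: "'u::set_universe set \<Rightarrow> 'u \<Rightarrow> 'u \<Rightarrow> 'u \<Rightarrow> 'u set set" where
  "measurable_sets V k L X = {A. \<forall>S. closed_family V k L X S \<longrightarrow> A \<in> elts ` elts S}"

definition val :: "'u::set_universe \<Rightarrow> 'u set \<Rightarrow> real" where
  "val \<mu> A = (THE r. codes_real (app \<mu> (as_set A)) r)"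

text \<open>
  Additivity in \<open>V\<close> for disjoint families indexed by \<open>I\<close>.  Only families belonging to \<open>V\<close> are
  considered; the sum of nonnegative reals itself is absolute.
\<close>

definition additive_over ::
    "'u::set_universe set \<Rightarrow> 'u \<Rightarrow> 'u \<Rightarrow> 'u \<Rightarrow> 'u \<Rightarrow> 'u \<Rightarrow> bool" where
  "additive_over V k L X I \<mu> \<longleftrightarrow>
     (\<forall>f\<in>V. function_on f (elts I) \<longrightarrow> (\<forall>i\<in>elts I. elts (app f i) \<in> measurable_sets V k L X) \<longrightarrow>
        disjoint_family_on (\<lambda>i. elts (app f i)) (elts I) \<longrightarrow>
        ((\<lambda>i. val \<mu> (elts (app f i))) has_sum val \<mu> (\<Union>i\<in>elts I. elts (app f i))) (elts I))"

definition probability_kappa_measure ::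
    "'u::set_universe set \<Rightarrow> 'u \<Rightarrow> 'u \<Rightarrow> 'u \<Rightarrow> 'u \<Rightarrow> bool" where
  "probability_kappa_measure V k L X \<mu> \<longleftrightarrow> \<mu> \<in> V \<and>
     function_on \<mu> (as_set ` measurable_sets V k L X) \<and>
     (\<forall>A\<in>measurable_sets V k L X.
        (\<exists>r. codes_real (app \<mu> (as_set A)) r) \<and> val \<mu> A \<ge> 0) \<and>
     val \<mu> (Str V L X) = 1 \<and>
     additive_over V k L X omega \<mu> \<and> additive_over V k L X k \<mu>"

definition act :: "'u::set_universe \<Rightarrow> 'u \<Rightarrow> 'u \<Rightarrow> 'u \<Rightarrow> 'u" where
  "act L X g M = (THE N. is_structure L X N \<and>
     (\<forall>R n xs. has_arity L R n \<longrightarrow> length xs = n \<longrightarrow> set xs \<subseteq> elts X \<longrightarrow>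
        (tuple (map (app g) xs) \<in> elts (app N R) \<longleftrightarrow> tuple xs \<in> elts (app M R))))"

definition invariant_measure ::
    "'u::set_universe set \<Rightarrow> 'u \<Rightarrow> 'u \<Rightarrow> 'u \<Rightarrow> 'u \<Rightarrow> bool" where
  "invariant_measure V k L X \<mu> \<longleftrightarrow> probability_kappa_measure V k L X \<mu> \<and>
     (\<forall>g\<in>Sym V X. \<forall>A\<in>measurable_sets V k L X. val \<mu> (act L X g ` A) = val \<mu> A)"

definition almost_invariant ::
    "'u::set_universe set \<Rightarrow> 'u \<Rightarrow> 'u \<Rightarrow> 'u \<Rightarrow> 'u set \<Rightarrow> bool" where
  "almost_invariant V L X \<mu> A \<longleftrightarrow>
     (\<forall>g\<in>Sym V X. val \<mu> ((act L X g ` A - A) \<union> (A - act L X g ` A)) = 0)"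

definition ergodic :: "'u::set_universe set \<Rightarrow> 'u \<Rightarrow> 'u \<Rightarrow> 'u \<Rightarrow> 'u \<Rightarrow> bool" where
  "ergodic V k L X \<mu> \<longleftrightarrow> invariant_measure V k L X \<mu> \<and>
     (\<forall>A\<in>measurable_sets V k L X. almost_invariant V L X \<mu> A \<longrightarrow> val \<mu> A \<in> {0, 1})"

definition is_relativization ::
    "'u::set_universe set \<Rightarrow> 'u set \<Rightarrow> 'u \<Rightarrow> 'u \<Rightarrow> 'u \<Rightarrow> 'u \<Rightarrow> 'u \<Rightarrow> bool" where
  "is_relativization V0 V1 k L X \<mu> \<nu> \<longleftrightarrow> probability_kappa_measure V1 k L X \<nu> \<and>
     (\<forall>ps xs. set xs \<subseteq> elts X \<longrightarrow> (\<forall>p\<in>set ps. is_literal L (length xs) p) \<longrightarrow>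
        val \<nu> (cylinder V1 L X ps xs) = val \<mu> (cylinder V0 L X ps xs))"

end

theory Submission
  imports Defs "HOL-Analysis.Elementary_Metric_Spaces"
begin

text \<open>
  For an invariant measure \<open>\<mu>\<close> of a single model, ergodicity fails iff there are a clopen set \<open>C\<close> (a
  finite Boolean combination of atomic events) and \<open>\<epsilon>\<close> with \<open>\<epsilon> < \<mu> C < 1 - \<epsilon>\<close> and
  \<open>\<mu> (g C \<triangle> C) \<le> \<epsilon>\<close> for all permutations \<open>g\<close>.  This only concerns measures of clopen sets and finite
  parts of permutations, so it is absolute.  Given an almost invariant \<open>A\<close> with \<open>0 < \<mu> A < 1\<close>, such a \<open>C\<close> is a clopen
  approximation of \<open>A\<close>.  Conversely, let \<open>\<Psi> E\<close> be the limit of the measure of agreement of \<open>E\<close> with \<open>g C\<close>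
  as \<open>g\<close> moves the support of \<open>C\<close> off larger and larger finite sets.  \<open>\<Psi>\<close> is modular, continuous and
  invariant, hence a maximizer of \<open>\<Psi>\<close> that has largest measure among all maximizers is almost
  invariant; it is found, inside the model, as the limes superior of a sequence of near maximizers.
  Since \<open>\<Psi> C \<ge> 1 - \<epsilon>\<close>, its measure differs from \<open>\<mu> C\<close> by at most \<open>\<epsilon>\<close>.

  That sets constructed from measurable sets, permutations and sequences belong to the model is shown
  by exhibiting first-order definitions; natural numbers and finiteness are definable because the
  models are transitive.  Real numbers are compared in a model through dyadic rationals only.
\<close>

section \<open>Definability in a transitive model\<close>

text \<open>Sets witnessing non-ergodicity in \<open>V0\<close> and in \<open>V1\<close> cannot be
  compared directly, since the larger model may have more measurable sets and more permutations;
  hence a criterion on clopen sets. Its hard half turns approximate invariance with a fixed error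
  into almost invariance. A translate of C far from the support of a clopen E meets E in a measure
  independent of the translate, because a permutation exchanges any two such translates; so the
  limit exists. Up to a constant, \<Psi> E is lim 2 \<mu>(g C \<inter> E) - \<mu> E, a signed
  measure, and its maximizers are the positive sets of Hahn decompositions. They are not unique up
  to null sets, and largest measure removes this freedom: P and g P are maximizers, by modularity so
  is their union, and then \<mu>(P \<union> g P) = \<mu> P. The supremum of \<Psi> is not directly
  available inside the model, which is only given comparisons of measures with rationals and
  sequences chosen by them. So maximality is asked only up to 2/2^n at stage n, an error that can be
  summed.\<close>

lemma as_set_elts [simp]: "as_set (elts x) = x"
  unfolding as_set_def using injD[OF inj_elts] by (intro the_equality) auto

lemma elts_inject: "elts x = elts y \<longleftrightarrow> x = y"
  using injD[OF inj_elts] by auto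

lemma not_mem_self: "x \<notin> elts x"
  using wf_elts wf_not_refl by fastforce

section \<open>Predicates definable from parameters and their closure properties\<close>

primrec rename_formula :: "(nat \<Rightarrow> nat) \<Rightarrow> set_formula \<Rightarrow> set_formula" where
  "rename_formula f (FMem i j) = FMem (f i) (f j)"
| "rename_formula f (FEq i j) = FEq (f i) (f j)"
| "rename_formula f (FNeg p) = FNeg (rename_formula f p)"
| "rename_formula f (FConj p q) = FConj (rename_formula f p) (rename_formula f q)"
| "rename_formula f (FAll i p) = FAll (f i) (rename_formula f p)"

text \<open>Bound variables are renamed too; injectivity of \<open>f\<close> keeps the update that a
  quantifier makes at \<open>f i\<close> away from all other variables.\<close>

lemma fsat_rename:
  assumes "inj f"
  shows "fsat el V e (rename_formula f p) \<longleftrightarrow> fsat el V (e \<circ> f) p"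
proof (induction p arbitrary: e)
  case (FAll i p)
  have "(e(f i := x)) \<circ> f = (e \<circ> f)(i := x)" for x
    using assms by (auto simp: inj_eq)
  then show ?case by (simp only: rename_formula.simps fsat.simps FAll)
qed auto

text \<open>Even variables are free, odd variables carry the parameters.\<close>

definition interleave :: "(nat \<Rightarrow> 'u) \<Rightarrow> (nat \<Rightarrow> 'u) \<Rightarrow> nat \<Rightarrow> 'u" where
  "interleave e c = (\<lambda>n. if even n then e (n div 2) else c (n div 2))"

text \<open>The formula has to agree with \<open>P\<close> only on valuations in \<open>V\<close>.
  Hence a HOL predicate written with \<open>finite\<close>, lists or definite descriptions may be
  definable, and separation and replacement then apply to it.\<close>

definition definable :: "'u::set_universe set \<Rightarrow> ((nat \<Rightarrow> 'u) \<Rightarrow> bool) \<Rightarrow> bool" where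
  "definable V P \<longleftrightarrow> (\<exists>p c. range c \<subseteq> V \<and>
     (\<forall>e. range e \<subseteq> V \<longrightarrow> (fsat elts V (interleave e c) p \<longleftrightarrow> P e)))"

text \<open>A term enters formulas through its graph: slot 0 holds the value and the arguments move
  up by one slot. Values in \<open>V\<close> are required so that quantifiers over \<open>V\<close>
  reach them.\<close>

definition definable_term :: "'u::set_universe set \<Rightarrow> ((nat \<Rightarrow> 'u) \<Rightarrow> 'u) \<Rightarrow> bool" where
  "definable_term V t \<longleftrightarrow> (\<forall>e. range e \<subseteq> V \<longrightarrow> t e \<in> V) \<and>
     definable V (\<lambda>e. e 0 = t (\<lambda>i. e (Suc i)))"

lemma definable_cong:
  assumes "definable V P" and "\<And>e. range e \<subseteq> V \<Longrightarrow> P e \<longleftrightarrow> Q e"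
  shows "definable V Q"
  using assms unfolding definable_def by metis

lemma definable_not: "definable V P \<Longrightarrow> definable V (\<lambda>e. \<not> P e)"
  unfolding definable_def by (metis fsat.simps(3))

lemma definable_conj:
  assumes "definable V P" "definable V Q"
  shows "definable V (\<lambda>e. P e \<and> Q e)"
proof -
  obtain p c where p: "range c \<subseteq> V"
    "\<And>e. range e \<subseteq> V \<Longrightarrow> fsat elts V (interleave e c) p \<longleftrightarrow> P e"
    using assms(1) unfolding definable_def by blast
  obtain q d where q: "range d \<subseteq> V"
    "\<And>e. range e \<subseteq> V \<Longrightarrow> fsat elts V (interleave e d) q \<longleftrightarrow> Q e"
    using assms(2) unfolding definable_def by blast
  \<comment> \<open>The two parameter sequences share the odd variables: variable
    \<open>2 * k + 1\<close> moves to \<open>4 * k + 1\<close> in the first formula and to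
    \<open>4 * k + 3\<close> in the second.\<close>
  define f g :: "nat \<Rightarrow> nat"
    where "f = (\<lambda>n. if even n then n else 2 * n - 1)" and "g = (\<lambda>n. if even n then n else 2 * n + 1)"
  have injf: "inj f" and injg: "inj g"
    unfolding f_def g_def inj_def by (simp_all, presburger+)
  have *: "interleave e (interleave c d) \<circ> f = interleave e c"
    "interleave e (interleave c d) \<circ> g = interleave e d" for e
    by (auto simp: f_def g_def interleave_def fun_eq_iff double_not_eq_Suc_double elim!: oddE evenE)
  show ?thesis unfolding definable_def
  proof (intro exI conjI allI impI)
    show "range (interleave c d) \<subseteq> V" using p(1) q(1) by (auto simp: interleave_def)
    fix e :: "nat \<Rightarrow> 'a" assume "range e \<subseteq> V"
    then show "fsat elts V (interleave e (interleave c d))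
      (FConj (rename_formula f p) (rename_formula g q)) = (P e \<and> Q e)"
      by (simp add: fsat_rename injf injg * p q)
  qed
qed

lemma definable_disj:
  assumes "definable V P" "definable V Q"
  shows "definable V (\<lambda>e. P e \<or> Q e)"
  by (rule definable_cong[OF definable_not[OF definable_conj[OF assms[THEN definable_not]]]]) simp

lemma definable_imp:
  assumes "definable V P" "definable V Q"
  shows "definable V (\<lambda>e. P e \<longrightarrow> Q e)"
  by (rule definable_cong[OF definable_disj[OF assms(1)[THEN definable_not] assms(2)]]) blast

lemma definable_iff:
  assumes "definable V P" "definable V Q"
  shows "definable V (\<lambda>e. P e \<longleftrightarrow> Q e)"
  by (rule definable_cong[OF definable_conj[OF definable_imp[OF assms] definable_imp[OF assms(2,1)]]])
    blast

lemma range_case_nat: "range (case_nat x e) \<subseteq> V \<longleftrightarrow> x \<in> V \<and> range e \<subseteq> V"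
proof
  assume *: "range (case_nat x e) \<subseteq> V"
  have "case_nat x e 0 \<in> V" "\<And>i. case_nat x e (Suc i) \<in> V" using * by blast+
  then show "x \<in> V \<and> range e \<subseteq> V" by auto
qed (auto simp: image_subset_iff split: nat.split)

text \<open>The slots behave like de Bruijn indices: under the quantifier the bound element occupies
  slot 0 and all other slots move up. Nested quantifiers are thus handled by repeated
  introduction.\<close>

lemma definable_all:
  assumes "definable V (\<lambda>e. P (e 0) (\<lambda>i. e (Suc i)))"
  shows "definable V (\<lambda>e. \<forall>x\<in>V. P x e)"
proof -
  obtain p c where p: "range c \<subseteq> V"
    "\<And>e. range e \<subseteq> V \<Longrightarrow> fsat elts V (interleave e c) p \<longleftrightarrow> P (e 0) (\<lambda>i. e (Suc i))"
    using assms unfolding definable_def by blast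
  \<comment> \<open>Variable 0 becomes the parameter variable 1; the other even variables move down
    and the odd ones up by one place. The dummy value \<open>c 0\<close> at variable 1 is
    overwritten by the quantifier.\<close>
  define f :: "nat \<Rightarrow> nat" where "f = (\<lambda>n. if n = 0 then 1 else if even n then n - 2 else n + 2)"
  have injf: "inj f" unfolding f_def inj_def by (simp, presburger)
  have *: "(interleave e (case_nat (c 0) c))(Suc 0 := x) \<circ> f = interleave (case_nat x e) c" for e x
    by (auto simp: f_def interleave_def fun_eq_iff elim!: oddE evenE split: nat.split)
  show ?thesis unfolding definable_def
  proof (intro exI conjI allI impI)
    show "range (case_nat (c 0) c) \<subseteq> V" using p(1) by (auto simp: range_case_nat)
    fix e :: "nat \<Rightarrow> 'a" assume e: "range e \<subseteq> V"
    have "fsat elts V (interleave (case_nat x e) c) p \<longleftrightarrow> P x e" if "x \<in> V" for x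
      using p(2)[of "case_nat x e"] e that by (simp add: range_case_nat)
    then show "fsat elts V (interleave e (case_nat (c 0) c))
      (FAll 1 (rename_formula f p)) = (\<forall>x\<in>V. P x e)"
      by (simp add: fsat_rename injf * del: comp_apply)
  qed
qed

lemma definable_ex:
  "definable V (\<lambda>e. P (e 0) (\<lambda>i. e (Suc i))) \<Longrightarrow> definable V (\<lambda>e. \<exists>x\<in>V. P x e)"
  by (rule definable_cong[OF definable_not[OF definable_all[OF definable_not]]]) auto

lemma definable_reindex:
  assumes "definable V P" and "inj f"
  shows "definable V (\<lambda>e. P (\<lambda>i. e (f i)))"
proof -
  obtain p c where p: "range c \<subseteq> V"
    "\<And>e. range e \<subseteq> V \<Longrightarrow> fsat elts V (interleave e c) p \<longleftrightarrow> P e"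
    using assms unfolding definable_def by blast
  define h where "h = (\<lambda>n. if even n then 2 * f (n div 2) else n)"
  have "inj h" 
    by (rule injI) (use assms(2) in \<open>auto simp: h_def inj_eq split: if_splits elim!: evenE\<close>)
  moreover have "interleave e c \<circ> h = interleave (\<lambda>i. e (f i)) c" for e
    by (auto simp: h_def interleave_def fun_eq_iff)
  moreover have "range (\<lambda>i. e (f i)) \<subseteq> V" if "range e \<subseteq> V" for e using that by auto
  ultimately show ?thesis unfolding definable_def
    using p by (metis fsat_rename)
qed

lemma definable_term_shift:
  assumes "definable_term V t"
  shows "definable_term V (\<lambda>e. t (\<lambda>i. e (Suc i)))"
proof -
  have "inj (case_nat 0 (\<lambda>i. Suc (Suc i)))"
    by (auto simp: inj_def split: nat.split_asm)
  from definable_reindex[OF conjunct2[OF assms[unfolded definable_term_def]] this]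
  show ?thesis using assms unfolding definable_term_def by (auto simp: image_subset_iff)
qed

text \<open>The term is eliminated by quantifying over its value, so that only its graph
  occurs.\<close>

lemma definable_subst:
  assumes "definable V (\<lambda>e. P (e 0) (\<lambda>i. e (Suc i)))" and "definable_term V t"
  shows "definable V (\<lambda>e. P (t e) e)"
proof (rule definable_cong)
  show "definable V (\<lambda>e. \<exists>x\<in>V. x = t e \<and> P x e)"
    by (rule definable_ex, rule definable_conj) (use assms in \<open>auto simp: definable_term_def\<close>)
qed (use assms(2) in \<open>auto simp: definable_term_def\<close>)

text \<open>Substitution acts on slot 0, so the arguments are put in reverse order and substituted
  from the last to the first. With these rules a predicate has to be shown definable only for
  variables as arguments.\<close>

lemma definable_subst2:
  assumes "definable V (\<lambda>e. Q (e 0) (e 1))" and a: "definable_term V a" and b: "definable_term V b"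
  shows "definable V (\<lambda>e. Q (a e) (b e))"
proof -
  have inj: "inj (\<lambda>i::nat. if i = 0 then 1 else if i = 1 then 0 else i)"
    by (auto simp: inj_def)
  have "definable V (\<lambda>e. Q (e 1) (e 0))"
    using definable_reindex[OF assms(1) inj] by simp
  then have "definable V (\<lambda>e. Q (e 0) (b (\<lambda>i. e (Suc i))))"
    by (intro definable_subst[where P = "\<lambda>y e. Q (e 0) y"] definable_term_shift b) simp
  then show ?thesis
    by (intro definable_subst[where P = "\<lambda>x e. Q x (b e)"] a)
qed

lemma definable_subst3:
  assumes "definable V (\<lambda>e. Q (e 0) (e 1) (e 2))"
    and a: "definable_term V a" and b: "definable_term V b" and c: "definable_term V c"
  shows "definable V (\<lambda>e. Q (a e) (b e) (c e))"
proof -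
  have inj: "inj (\<lambda>i::nat. if i = 0 then 2 else if i = 2 then 0 else i)"
    by (auto simp: inj_def)
  have "definable V (\<lambda>e. Q (e 2) (e 1) (e 0))"
    using definable_reindex[OF assms(1) inj] by simp
  then have "definable V (\<lambda>e. Q (e 1) (e 0) (c (\<lambda>i. e (Suc (Suc i)))))"
    by (intro definable_subst[where P = "\<lambda>z e. Q (e 1) (e 0) z"] definable_term_shift c)
      (simp add: numeral_2_eq_2)
  then have "definable V (\<lambda>e. Q (e 0) (b (\<lambda>i. e (Suc i))) (c (\<lambda>i. e (Suc i))))"
    by (intro definable_subst[where P = "\<lambda>y e. Q (e 0) y (c (\<lambda>i. e (Suc i)))"] definable_term_shift b)
      simp
  then show ?thesis
    by (intro definable_subst[where P = "\<lambda>x e. Q x (b e) (c e)"] a)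
qed

lemma definable_subst4:
  assumes "definable V (\<lambda>e. Q (e 0) (e 1) (e 2) (e 3))"
    and a: "definable_term V a" and b: "definable_term V b"
    and c: "definable_term V c" and d: "definable_term V d"
  shows "definable V (\<lambda>e. Q (a e) (b e) (c e) (d e))"
proof -
  have inj: "inj (\<lambda>i::nat. if i = 0 then 3 else if i = 3 then 0 else if i = 1 then 2 else if i = 2 then 1 else i)"
    by (auto simp: inj_def)
  have "definable V (\<lambda>e. Q (e 3) (e 2) (e 1) (e 0))"
    using definable_reindex[OF assms(1) inj] by simp
  then have "definable V (\<lambda>e. Q (e 2) (e 1) (e 0) (d (\<lambda>i. e (Suc (Suc (Suc i))))))"
    by (intro definable_subst[where P = "\<lambda>z e. Q (e 2) (e 1) (e 0) z"] definable_term_shift d)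
      (simp add: numeral_2_eq_2 numeral_3_eq_3)
  then have "definable V (\<lambda>e. Q (e 1) (e 0) (c (\<lambda>i. e (Suc (Suc i)))) (d (\<lambda>i. e (Suc (Suc i)))))"
    by (intro definable_subst[where P = "\<lambda>z e. Q (e 1) (e 0) z (d (\<lambda>i. e (Suc (Suc i))))"]
        definable_term_shift c) (simp add: numeral_2_eq_2)
  then have "definable V (\<lambda>e. Q (e 0) (b (\<lambda>i. e (Suc i))) (c (\<lambda>i. e (Suc i))) (d (\<lambda>i. e (Suc i))))"
    by (intro definable_subst[where P = "\<lambda>y e. Q (e 0) y (c (\<lambda>i. e (Suc i))) (d (\<lambda>i. e (Suc i)))"]
        definable_term_shift b) simp
  then show ?thesis
    by (intro definable_subst[where P = "\<lambda>x e. Q x (b e) (c e) (d e)"] a)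
qed

named_theorems definable_intros

lemmas [definable_intros] = definable_not definable_conj definable_disj definable_imp definable_iff
  definable_all definable_ex

section \<open>The axioms of ZFC in terms of \<open>elts\<close>\<close>

locale set_model =
  fixes V :: "'u::set_universe set"
  assumes model: "model_of_set_theory V"
begin

lemma elts_mem: "x \<in> V \<Longrightarrow> y \<in> elts x \<Longrightarrow> y \<in> V"
  using model unfolding model_of_set_theory_def by blast

lemma elts_subset: "x \<in> V \<Longrightarrow> elts x \<subseteq> V"
  using elts_mem by blast

lemmas zfc = conjunct2[OF model[unfolded model_of_set_theory_def], unfolded ZFC_def]

lemmas zfc_pairing = zfc[THEN conjunct2, THEN conjunct2, THEN conjunct1, rule_format]
lemmas zfc_union = zfc[THEN conjunct2, THEN conjunct2, THEN conjunct2, THEN conjunct1, rule_format]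
lemmas zfc_tail = zfc[THEN conjunct2, THEN conjunct2, THEN conjunct2, THEN conjunct2]
lemmas zfc_power = zfc_tail[THEN conjunct1, rule_format]
lemmas zfc_infinity = zfc_tail[THEN conjunct2, THEN conjunct1]
lemmas zfc_separation = zfc_tail[THEN conjunct2, THEN conjunct2, THEN conjunct1, rule_format]
lemmas zfc_replacement = zfc_tail[THEN conjunct2, THEN conjunct2, THEN conjunct2, THEN conjunct1, rule_format]
lemmas zfc_choice = zfc_tail[THEN conjunct2, THEN conjunct2, THEN conjunct2, THEN conjunct2, rule_format]

lemma nonempty: "V \<noteq> {}"
  using zfc_infinity by blast

text \<open>A relativized axiom fixes a set only up to elements outside \<open>V\<close>;
  transitivity excludes such elements.\<close>

lemma elts_eqI:
  assumes "u \<in> V" and "A \<subseteq> V" and "\<And>w. w \<in> V \<Longrightarrow> w \<in> elts u \<longleftrightarrow> w \<in> A"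
  shows "elts u = A"
  using assms(2,3) elts_subset[OF assms(1)] by blast

lemma pairing:
  assumes "x \<in> V" and "y \<in> V" shows "\<exists>z\<in>V. elts z = {x, y}"
proof -
  obtain z where "z \<in> V" "\<And>w. w \<in> V \<Longrightarrow> w \<in> elts z \<longleftrightarrow> w = x \<or> w = y"
    using zfc_pairing[OF assms] by auto
  then have "elts z = {x, y}" using assms by (intro elts_eqI) auto
  then show ?thesis using \<open>z \<in> V\<close> by blast
qed

lemma union: 
  assumes "x \<in> V" shows "\<exists>u\<in>V. elts u = \<Union> (elts ` elts x)"
proof -
  obtain u where "u \<in> V" "\<And>w. w \<in> V \<Longrightarrow> w \<in> elts u \<longleftrightarrow> (\<exists>y\<in>V. y \<in> elts x \<and> w \<in> elts y)"
    using zfc_union[OF assms] by blast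
  moreover have "\<Union> (elts ` elts x) \<subseteq> V"
    using elts_subset elts_mem[OF assms] by blast
  ultimately have "elts u = \<Union> (elts ` elts x)"
    using elts_mem[OF assms] by (intro elts_eqI) auto
  then show ?thesis using \<open>u \<in> V\<close> by blast
qed

lemma power_set: 
  assumes "x \<in> V" shows "\<exists>u\<in>V. elts u = {y\<in>V. elts y \<subseteq> elts x}"
proof -
  obtain u where "u \<in> V" "\<And>y. y \<in> V \<Longrightarrow> y \<in> elts u \<longleftrightarrow> (\<forall>z\<in>V. z \<in> elts y \<longrightarrow> z \<in> elts x)"
    using zfc_power[OF assms] by blast
  then have "elts u = {y\<in>V. elts y \<subseteq> elts x}"
    using elts_subset by (intro elts_eqI) auto
  then show ?thesis using \<open>u \<in> V\<close> by blast
qed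

lemma infinity:
  "\<exists>w\<in>V. (\<exists>s\<in>elts w. elts s = {}) \<and> (\<forall>x\<in>elts w. \<exists>s\<in>elts w. elts s = insert x (elts x))"
proof -
  obtain w where w: "w \<in> V" "\<exists>s\<in>V. s \<in> elts w \<and> (\<forall>z\<in>V. z \<notin> elts s)"
    "\<forall>x\<in>V. x \<in> elts w \<longrightarrow> (\<exists>s\<in>V. s \<in> elts w \<and> (\<forall>z\<in>V. z \<in> elts s \<longleftrightarrow> z \<in> elts x \<or> z = x))"
    by (rule bexE[OF zfc_infinity], erule conjE, rule that)
  have "\<exists>s\<in>elts w. elts s = {}" using w(2) elts_mem by blast
  moreover have "\<exists>s\<in>elts w. elts s = insert x (elts x)" if x: "x \<in> elts w" for x
  proof -
    have xV: "x \<in> V" using elts_mem w(1) x by blast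
    then obtain s where s: "s \<in> V" "s \<in> elts w" "\<forall>z\<in>V. z \<in> elts s \<longleftrightarrow> z \<in> elts x \<or> z = x"
      using w(3) x by blast
    have "elts s = insert x (elts x)" using s elts_mem xV by blast
    then show ?thesis using s(2) by blast
  qed
  ultimately show ?thesis using w(1) by blast
qed

lemma separation:
  assumes "definable V (\<lambda>e. P (e 0))" and "a \<in> V"
  shows "\<exists>b\<in>V. elts b = {x\<in>elts a. P x}"
proof -
  obtain p c where p: "range c \<subseteq> V"
    "\<And>e. range e \<subseteq> V \<Longrightarrow> fsat elts V (interleave e c) p \<longleftrightarrow> P (e 0)"
    using assms(1) unfolding definable_def by blast
  have eq: "(interleave (\<lambda>_. a) c)(0 := x) = interleave ((\<lambda>_. a)(0 := x)) c" for x
    by (auto simp: interleave_def fun_eq_iff elim!: evenE)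
  have sat: "fsat elts V ((interleave (\<lambda>_. a) c)(0 := x)) p \<longleftrightarrow> P x" if "x \<in> V" for x
    unfolding eq using p(2)[of "(\<lambda>_. a)(0 := x)"] that assms(2) by auto
  have "\<And>i. interleave (\<lambda>_. a) c i \<in> V" using p(1) assms(2) by (auto simp: interleave_def)
  then obtain b where b: "b \<in> V"
    "\<forall>x\<in>V. x \<in> elts b \<longleftrightarrow> x \<in> elts a \<and> fsat elts V ((interleave (\<lambda>_. a) c)(0 := x)) p"
    by (rule bexE[OF zfc_separation[OF _ assms(2), where p = p and e = "interleave (\<lambda>_. a) c"]])
  have "elts b = {x\<in>elts a. P x}"
    using b sat elts_subset[OF assms(2)] by (intro elts_eqI) auto
  then show ?thesis using b(1) by blast
qed

lemma replacement:
  assumes "definable V (\<lambda>e. e 1 = F (e 0))" and "a \<in> V" and F: "\<And>x. x \<in> elts a \<Longrightarrow> F x \<in> V"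
  shows "\<exists>b\<in>V. elts b = F ` elts a"
proof -
  obtain p c where p: "range c \<subseteq> V"
    "\<And>e. range e \<subseteq> V \<Longrightarrow> fsat elts V (interleave e c) p \<longleftrightarrow> e 1 = F (e 0)"
    using assms(1) unfolding definable_def by blast
  \<comment> \<open>The axiom expects the value in variable 1, which carries a parameter, while slot
    1 is variable 2. The renaming sends variable 2 to 1 and moves the parameters up by one place;
    \<open>d\<close> fills the freed place with the dummy \<open>a\<close>.\<close>
  define f :: "nat \<Rightarrow> nat" where "f = (\<lambda>n. if n = 2 then 1 else if even n then n else n + 2)"
  have injf: "inj f" unfolding f_def inj_def by (simp, presburger)
  define d where "d = (\<lambda>n. case n of 0 \<Rightarrow> a | Suc n \<Rightarrow> c n)"
  have dV: "range d \<subseteq> V" using p(1) assms(2) by (auto simp: d_def image_subset_iff split: nat.split)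
  have eq: "(interleave (\<lambda>_. a) d)(0 := x, 1 := y) \<circ> f = interleave ((\<lambda>_. a)(0 := x, 1 := y)) c" for x y
    by (auto simp: interleave_def fun_eq_iff f_def d_def elim!: evenE oddE split: nat.split)
  have sat: "fsat elts V ((interleave (\<lambda>_. a) d)(0 := x, 1 := y)) (rename_formula f p) \<longleftrightarrow> y = F x"
    if "x \<in> V" "y \<in> V" for x y
    unfolding fsat_rename[OF injf] eq using p(2)[of "(\<lambda>_. a)(0 := x, 1 := y)"] that assms(2) by auto
  have "\<And>i. interleave (\<lambda>_. a) d i \<in> V" using dV assms(2) by (auto simp: interleave_def)
  moreover have "\<exists>!y. y \<in> V \<and> fsat elts V ((interleave (\<lambda>_. a) d)(0 := x, 1 := y)) (rename_formula f p)"
    if "x \<in> V" "x \<in> elts a" for x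
    using sat[OF that(1)] F[OF that(2)] by blast
  ultimately obtain b where b: "b \<in> V"
    "\<forall>y\<in>V. y \<in> elts b \<longleftrightarrow> (\<exists>x\<in>V. x \<in> elts a \<and>
        fsat elts V ((interleave (\<lambda>_. a) d)(0 := x, 1 := y)) (rename_formula f p))"
    by (rule bexE[OF zfc_replacement[OF _ assms(2),
            where e = "interleave (\<lambda>_. a) d" and p = "rename_formula f p"]])
  have "elts b = F ` elts a"
    using b sat elts_mem[OF assms(2)] F by (intro elts_eqI) auto
  then show ?thesis using b(1) by blast
qed

lemma choice:
  assumes "x \<in> V" and "\<And>y. y \<in> elts x \<Longrightarrow> elts y \<noteq> {}"
    and "\<And>y y'. y \<in> elts x \<Longrightarrow> y' \<in> elts x \<Longrightarrow> y \<noteq> y' \<Longrightarrow> elts y \<inter> elts y' = {}"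
  shows "\<exists>c\<in>V. \<forall>y\<in>elts x. \<exists>!z. z \<in> elts y \<and> z \<in> elts c"
proof -
  have "\<exists>z\<in>V. z \<in> elts y" if "y \<in> elts x" for y
    using assms(2)[OF that] elts_mem[OF elts_mem[OF assms(1) that]] by blast
  moreover have "\<not> (\<exists>z\<in>V. z \<in> elts y \<and> z \<in> elts y')"
    if "y \<in> elts x" "y' \<in> elts x" "y \<noteq> y'" for y y'
    using assms(3)[OF that] by blast
  ultimately have "\<exists>c\<in>V. \<forall>y\<in>V. y \<in> elts x \<longrightarrow> (\<exists>!z. z \<in> V \<and> z \<in> elts y \<and> z \<in> elts c)"
    by (intro zfc_choice[OF assms(1)])
  then obtain c where "c \<in> V" "\<And>y. y \<in> V \<Longrightarrow> y \<in> elts x \<Longrightarrow> \<exists>!z. z \<in> V \<and> z \<in> elts y \<and> z \<in> elts c"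
    by blast
  moreover from this have "\<exists>!z. z \<in> elts y \<and> z \<in> elts c" if "y \<in> elts x" for y
    using that elts_mem[OF assms(1) that] elts_mem by metis
  ultimately show ?thesis by blast
qed

section \<open>Atomic formulas and bounded quantifiers\<close>

lemma term_var [definable_intros]: "definable_term V (\<lambda>e. e i)"
proof -
  obtain a where a: "a \<in> V" using nonempty by blast
  have "definable V (\<lambda>e. e 0 = e (Suc i))"
    unfolding definable_def
  proof (intro exI conjI allI impI)
    show "range (\<lambda>_. a) \<subseteq> V" using a by auto
    fix e :: "nat \<Rightarrow> 'u"  assume "range e \<subseteq> V"
    show "fsat elts V (interleave e (\<lambda>_. a)) (FEq 0 (2 * Suc i)) = (e 0 = e (Suc i))"
      by (simp add: interleave_def)
  qed
  then show ?thesis unfolding definable_term_def by blast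
qed

lemma term_const [definable_intros]:
  assumes "a \<in> V" shows "definable_term V (\<lambda>e. a)"
proof -
  have "definable V (\<lambda>e. e 0 = a)"
    unfolding definable_def
  proof (intro exI conjI allI impI)
    show "range (\<lambda>_. a) \<subseteq> V" using assms by auto
    fix e :: "nat \<Rightarrow> 'u"  assume "range e \<subseteq> V"
    show "fsat elts V (interleave e (\<lambda>_. a)) (FEq 0 1) = (e 0 = a)"
      by (simp add: interleave_def)
  qed
  then show ?thesis unfolding definable_term_def using assms by blast
qed

lemma definable_eq [definable_intros]:
  assumes "definable_term V a" and "definable_term V b"
  shows "definable V (\<lambda>e. a e = b e)"
proof (rule definable_subst2[OF _ assms])
  show "definable V (\<lambda>e. e 0 = e 1)"
    using term_var[of 0] unfolding definable_term_def by simp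
qed

lemma definable_mem [definable_intros]:
  assumes "definable_term V a" and "definable_term V b"
  shows "definable V (\<lambda>e. a e \<in> elts (b e))"
proof (rule definable_subst2[OF _ assms])
  obtain a where a: "a \<in> V" using nonempty by blast
  show "definable V (\<lambda>e. e 0 \<in> elts (e 1))"
    unfolding definable_def
  proof (intro exI conjI allI impI)
    show "range (\<lambda>_. a) \<subseteq> V" using a by auto
    fix e :: "nat \<Rightarrow> 'u"  assume "range e \<subseteq> V"
    show "fsat elts V (interleave e (\<lambda>_. a)) (FMem 0 2) = (e 0 \<in> elts (e 1))"
      by (simp add: interleave_def)
  qed
qed

lemma definable_ball [definable_intros]:
  assumes "definable_term V a" and "definable V (\<lambda>e. P (e 0) (\<lambda>i. e (Suc i)))"
  shows "definable V (\<lambda>e. \<forall>x\<in>elts (a e). P x e)"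
proof (rule definable_cong)
  show "definable V (\<lambda>e. \<forall>x\<in>V. x \<in> elts (a e) \<longrightarrow> P x e)"
    by (intro definable_intros definable_term_shift assms)
  show "(\<forall>x\<in>V. x \<in> elts (a e) \<longrightarrow> P x e) = (\<forall>x\<in>elts (a e). P x e)" if "range e \<subseteq> V" for e
    using assms(1) that elts_mem unfolding definable_term_def by blast
qed

lemma definable_bex [definable_intros]:
  assumes "definable_term V a" and "definable V (\<lambda>e. P (e 0) (\<lambda>i. e (Suc i)))"
  shows "definable V (\<lambda>e. \<exists>x\<in>elts (a e). P x e)"
proof (rule definable_cong)
  show "definable V (\<lambda>e. \<exists>x\<in>V. x \<in> elts (a e) \<and> P x e)"
    by (intro definable_intros definable_term_shift assms)
  show "(\<exists>x\<in>V. x \<in> elts (a e) \<and> P x e) = (\<exists>x\<in>elts (a e). P x e)" if "range e \<subseteq> V" for e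
    using assms(1) that elts_mem unfolding definable_term_def by blast
qed

end

section \<open>Elementary set theory in a transitive model\<close>

lemma mem_asym: "x \<in> elts y \<Longrightarrow> y \<notin> elts x"
  using wf_asym[OF wf_elts, of x y] by simp

section \<open>HOL sets that are the extension of a member of the model\<close>

context set_model
begin

lemma as_set_mem: "A \<in> elts ` V \<Longrightarrow> as_set A \<in> V"
  by auto

lemma elts_as_set_mem: "A \<in> elts ` V \<Longrightarrow> elts (as_set A) = A"
  by auto

lemma elts_image: "x \<in> V \<Longrightarrow> elts x \<in> elts ` V"
  by blast

lemma coded_subset: "A \<in> elts ` V \<Longrightarrow> A \<subseteq> V"
  using elts_subset by blast

lemma coded_separation:
  assumes "definable V (\<lambda>e. P (e 0))" and "A \<in> elts ` V"
  shows "{x\<in>A. P x} \<in> elts ` V"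
proof -
  obtain a where "a \<in> V" "A = elts a" using assms(2) by blast
  with separation[OF assms(1), of a] show ?thesis by (metis imageI)
qed

lemma coded_replacement:
  assumes "definable V (\<lambda>e. R (e 0) (e 1))" and "A \<in> elts ` V"
    and "\<And>x. x \<in> A \<Longrightarrow> F x \<in> V" and "\<And>x y. x \<in> A \<Longrightarrow> y \<in> V \<Longrightarrow> R x y \<longleftrightarrow> y = F x"
  shows "F ` A \<in> elts ` V"
proof -
  obtain a where a: "a \<in> V" "A = elts a" using assms(2) by blast
  \<comment> \<open>\<open>R\<close> describes \<open>F\<close> on \<open>A\<close> only, whereas
    \<open>replacement\<close> wants a function whose graph is definable on all of \<open>V\<close>;
    outside \<open>A\<close> the identity is used.\<close>
  define G where "G = (\<lambda>x. if x \<in> A then F x else x)"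
  have "definable V (\<lambda>e. e 0 \<in> elts a \<and> R (e 0) (e 1) \<or> e 0 \<notin> elts a \<and> e 1 = e 0)"
    by (intro definable_intros a(1) assms(1))
  then have "definable V (\<lambda>e. e 1 = G (e 0))"
    by (rule definable_cong) (use assms(4) in \<open>auto simp: G_def a(2) image_subset_iff\<close>)
  from replacement[OF this a(1)] obtain b where "b \<in> V" "elts b = G ` A"
    using assms(3) a(2) by (auto simp: G_def)
  moreover have "G ` A = F ` A" by (auto simp: G_def)
  ultimately show ?thesis by auto
qed

lemma coded_finite:
  assumes "finite A" and "A \<subseteq> V"
  shows "A \<in> elts ` V"
  using assms
proof (induction A)
  case empty
  obtain a where "a \<in> V" using nonempty by blast
  moreover have "definable V (\<lambda>e. e 0 \<noteq> e 0)" by (intro definable_intros)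
  ultimately have "{x\<in>elts a. x \<noteq> x} \<in> elts ` V"
    by (intro coded_separation[where P = "\<lambda>x. x \<noteq> x"] elts_image)
  then show ?case by simp
next
  case (insert x A)
  then obtain a where a: "a \<in> V" "elts a = A" by auto
  obtain s where s: "s \<in> V" "elts s = {x}" using pairing[of x x] insert.prems by auto
  obtain p where p: "p \<in> V" "elts p = {s, a}" using pairing[OF s(1) a(1)] by blast
  have "\<Union> (elts ` elts p) = insert x A" using p(2) s(2) a(2) by simp
  then show ?case using union[OF p(1)] by auto
qed

lemma coded_power: 
  assumes "A \<in> elts ` V" shows "{y\<in>V. elts y \<subseteq> A} \<in> elts ` V"
proof -
  obtain a where "a \<in> V" "A = elts a" using assms by blast
  with power_set[of a] show ?thesis by auto
qed

lemma coded_Union: 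
  assumes "A \<in> elts ` V" shows "\<Union> (elts ` A) \<in> elts ` V"
proof -
  obtain a where "a \<in> V" "A = elts a" using assms by blast
  with union[of a] show ?thesis by auto
qed

lemma coded_Un:
  assumes "A \<in> elts ` V" "B \<in> elts ` V" shows "A \<union> B \<in> elts ` V"
proof -
  have "{as_set A, as_set B} \<in> elts ` V"
    using assms by (intro coded_finite) auto
  from coded_Union[OF this] show ?thesis using assms by auto
qed

end

section \<open>Pairs, numerals, tuples and functions as sets\<close>

lemma set_model_UNIV: "set_model (UNIV :: 'u::set_universe set)"
  by unfold_locales (simp add: model_of_set_theory_def ZFC_universe)

lemma elts_as_set_finite: "finite A \<Longrightarrow> elts (as_set A) = A"
  using set_model.elts_as_set_mem[OF set_model_UNIV] set_model.coded_finite[OF set_model_UNIV]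
  by blast

lemma elts_pair: "elts (pair x y) = {as_set {x}, as_set {x, y}}"
  unfolding pair_def by (rule elts_as_set_finite) auto

lemma as_set_eq_iff: "finite A \<Longrightarrow> finite B \<Longrightarrow> as_set A = as_set B \<longleftrightarrow> A = B"
  using elts_as_set_finite by metis

lemma pair_eq_iff [simp]: "pair x y = pair x' y' \<longleftrightarrow> x = x' \<and> y = y'"
proof
  assume "pair x y = pair x' y'"
  then have "{as_set {x}, as_set {x, y}} = {as_set {x'}, as_set {x', y'}}"
    using elts_pair by metis
  then show "x = x' \<and> y = y'"
    by (auto simp: doubleton_eq_iff as_set_eq_iff)
qed auto

lemma elts_pair_cases: "z \<in> elts (pair x y) \<longleftrightarrow> elts z = {x} \<or> elts z = {x, y}"
proof -
  have "z = as_set A \<longleftrightarrow> elts z = A" if "finite A" for A :: "'a set"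
    using elts_as_set_finite[OF that] as_set_elts[of z] by metis
  then show ?thesis by (simp add: elts_pair)
qed

definition succ :: "'u::set_universe \<Rightarrow> 'u" where
  "succ x = as_set (insert x (elts x))"

lemma elts_succ [simp]: "elts (succ x) = insert x (elts x)"
proof -
  interpret U: set_model "UNIV :: 'a set" by (rule set_model_UNIV)
  have "elts x \<union> {x} \<in> elts ` UNIV"
    by (intro U.coded_Un U.elts_image U.coded_finite) auto
  then show ?thesis unfolding succ_def by (intro U.elts_as_set_mem) simp
qed

lemma succ_inject [simp]: "succ x = succ y \<longleftrightarrow> x = y"
proof
  assume "succ x = succ y"
  then have "insert x (elts x) = insert y (elts y)" by (metis elts_succ)
  then have "x = y \<or> x \<in> elts y" "y = x \<or> y \<in> elts x" by auto
  then show "x = y" using mem_asym[of x y] by auto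
qed auto

lemma numeral_set_Suc: "numeral_set (Suc n) = succ (numeral_set n)"
  by (simp add: succ_def)

declare numeral_set.simps(2) [simp del]

lemma elts_numeral_0 [simp]: "elts (numeral_set 0) = {}"
  by (simp add: elts_as_set_finite)

lemma elts_numeral: "elts (numeral_set n) = numeral_set ` {..<n}"
  by (induction n) (auto simp: numeral_set_Suc lessThan_Suc simp del: numeral_set.simps)

declare numeral_set.simps(1) [simp del]

lemma numeral_inject [simp]: "numeral_set m = numeral_set n \<longleftrightarrow> m = n"
proof -
  have "m < n \<Longrightarrow> numeral_set m \<noteq> (numeral_set n :: 'a)" for m n
    using not_mem_self elts_numeral by (metis image_eqI lessThan_iff)
  then show ?thesis by (metis linorder_neq_iff)
qed

lemma numeral_mem_numeral [simp]: "numeral_set m \<in> elts (numeral_set n) \<longleftrightarrow> m < n"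
  by (auto simp: elts_numeral)

lemma elts_tuple: "elts (tuple xs) = {pair (numeral_set i) (xs ! i) |i. i < length xs}"
  unfolding tuple_def by (rule elts_as_set_finite) simp

lemma tuple_inject [simp]: "tuple xs = tuple ys \<longleftrightarrow> xs = ys"
proof
  assume eq: "tuple xs = tuple ys"
  have *: "pair (numeral_set i) y \<in> elts (tuple zs) \<longleftrightarrow> i < length zs \<and> y = zs ! i" for i y and zs :: "'a list"
    by (auto simp: elts_tuple)
  have "i < length xs \<longleftrightarrow> i < length ys" for i
    using *[of i _ xs] *[of i _ ys] eq by metis
  then have "length xs = length ys" by (metis linorder_neq_iff)
  moreover have "xs ! i = ys ! i" if "i < length xs" for i
    using *[of i "xs ! i" xs] *[of i "xs ! i" ys] eq that by simp
  ultimately show "xs = ys" by (intro nth_equalityI) auto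
qed auto

lemma function_on_iff: 
  assumes "function_on f A" "x \<in> A" shows "pair x y \<in> elts f \<longleftrightarrow> y = app f x"
proof -
  have *: "\<exists>!y. pair x y \<in> elts f" using assms unfolding function_on_def by blast
  have "pair x (app f x) \<in> elts f" unfolding app_def by (rule theI'[OF *])
  then show ?thesis using * by auto
qed

lemma function_onI:
  assumes "elts f = {pair x (F x) |x. x \<in> A}"
  shows "function_on f A" and "\<And>x. x \<in> A \<Longrightarrow> app f x = F x"
proof -
  show *: "function_on f A" unfolding function_on_def by (auto simp: assms)
  show "app f x = F x" if "x \<in> A" for x
    using function_on_iff[OF * that, of "F x"] that by (auto simp: assms)
qed

lemma function_on_relation:
  assumes "elts f = {pair x y |x y. x \<in> A \<and> Q x y}" and "\<And>x. x \<in> A \<Longrightarrow> \<exists>!y. Q x y"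
  shows "function_on f A" and "\<And>x. x \<in> A \<Longrightarrow> Q x (app f x)"
proof -
  have iff: "pair x y \<in> elts f \<longleftrightarrow> Q x y" if "x \<in> A" for x y
    using that by (simp add: assms(1))
  show *: "function_on f A"
    unfolding function_on_def
  proof (intro conjI ballI)
    show "\<exists>x\<in>A. \<exists>y. p = pair x y" if "p \<in> elts f" for p
      using that unfolding assms(1) by blast
    show "\<exists>!y. pair x y \<in> elts f" if "x \<in> A" for x
      using assms(2)[OF that] by (simp only: iff[OF that])
  qed
  show "Q x (app f x)" if "x \<in> A" for x
    using function_on_iff[OF * that, of "app f x"] iff[OF that] by simp
qed

lemma elts_function: 
  assumes "function_on f A" shows "elts f = {pair x (app f x) |x. x \<in> A}"
  using function_on_iff[OF assms] assms unfolding function_on_def by fastforce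

section \<open>Pairs and numerals inside a model\<close>

context set_model
begin

lemma pair_mem_iff [simp]: "pair x y \<in> V \<longleftrightarrow> x \<in> V \<and> y \<in> V"
proof
  assume *: "pair x y \<in> V"
  have "as_set {x, y} \<in> V" using * by (rule elts_mem) (simp add: elts_pair)
  then show "x \<in> V \<and> y \<in> V" using elts_mem[of "as_set {x, y}"] by (auto simp: elts_as_set_finite)
next
  assume "x \<in> V \<and> y \<in> V"
  then have "as_set {x} \<in> V" "as_set {x, y} \<in> V" by (auto intro!: as_set_mem coded_finite)
  then show "pair x y \<in> V" unfolding pair_def by (auto intro!: as_set_mem coded_finite)
qed

lemma pair_mem_elts: 
  assumes "pair x y \<in> elts f" "f \<in> V" shows "x \<in> V" and "y \<in> V"
  using elts_mem[OF assms(2,1)] by auto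

lemma term_pair [definable_intros]:
  assumes "definable_term V a" "definable_term V b"
  shows "definable_term V (\<lambda>e. pair (a e) (b e))"
proof -
  have "definable V (\<lambda>e. \<forall>z\<in>V. z \<in> elts (e 0) \<longleftrightarrow>
      ((\<forall>w\<in>V. w \<in> elts z \<longleftrightarrow> w = e 1) \<or> (\<forall>w\<in>V. w \<in> elts z \<longleftrightarrow> w = e 1 \<or> w = e 2)))"
    by (intro definable_intros)
  then have *: "definable V (\<lambda>e. e 0 = pair (e 1) (e 2))"
  proof (rule definable_cong)
    fix e :: "nat \<Rightarrow> 'u" assume "range e \<subseteq> V"
    then have V: "e i \<in> V" for i by auto
    have 1: "(\<forall>w\<in>V. w \<in> elts z \<longleftrightarrow> w = e 1) \<longleftrightarrow> elts z = {e 1}" if "z \<in> V" for z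
      using V[of 1] elts_subset[OF that] by blast
    have 2: "(\<forall>w\<in>V. w \<in> elts z \<longleftrightarrow> w = e 1 \<or> w = e 2) \<longleftrightarrow> elts z = {e 1, e 2}" if "z \<in> V" for z
      using V[of 1] V[of 2] elts_subset[OF that] by blast
    have "(\<forall>z\<in>V. z \<in> elts (e 0) \<longleftrightarrow> z \<in> elts (pair (e 1) (e 2))) \<longleftrightarrow> e 0 = pair (e 1) (e 2)"
      using elts_subset[OF V[of 0]] elts_subset[of "pair (e 1) (e 2)"] V elts_inject[of "e 0" "pair (e 1) (e 2)"]
      by auto
    then show "(\<forall>z\<in>V. z \<in> elts (e 0) \<longleftrightarrow>
      ((\<forall>w\<in>V. w \<in> elts z \<longleftrightarrow> w = e 1) \<or> (\<forall>w\<in>V. w \<in> elts z \<longleftrightarrow> w = e 1 \<or> w = e 2))) \<longleftrightarrow> e 0 = pair (e 1) (e 2)"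
      using 1 2 by (simp add: elts_pair_cases)
  qed
  have "definable V (\<lambda>e. e 0 = pair (a (\<lambda>i. e (Suc i))) (b (\<lambda>i. e (Suc i))))"
    by (rule definable_subst3[OF *]) (intro definable_intros definable_term_shift assms)+
  then show ?thesis using assms unfolding definable_term_def by simp
qed

lemma succ_mem: "x \<in> V \<Longrightarrow> succ x \<in> V"
proof -
  assume "x \<in> V"
  then have "elts x \<union> {x} \<in> elts ` V" by (intro coded_Un elts_image coded_finite) auto
  then show "succ x \<in> V" unfolding succ_def by (intro as_set_mem) simp
qed

lemma term_succ [definable_intros]:
  assumes "definable_term V a"
  shows "definable_term V (\<lambda>e. succ (a e))"
proof -
  have "definable V (\<lambda>e. \<forall>z\<in>V. z \<in> elts (e 0) \<longleftrightarrow> z \<in> elts (e 1) \<or> z = e 1)"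
    by (intro definable_intros)
  then have *: "definable V (\<lambda>e. e 0 = succ (e 1))"
  proof (rule definable_cong)
    fix e :: "nat \<Rightarrow> 'u" assume "range e \<subseteq> V"
    then have V: "e i \<in> V" for i by auto
    show "(\<forall>z\<in>V. z \<in> elts (e 0) \<longleftrightarrow> z \<in> elts (e 1) \<or> z = e 1) \<longleftrightarrow> e 0 = succ (e 1)"
      using elts_subset[OF V[of 0]] elts_subset[OF V[of 1]] V[of 1] elts_inject[of "e 0" "succ (e 1)"]
      by auto
  qed
  have "definable V (\<lambda>e. e 0 = succ (a (\<lambda>i. e (Suc i))))"
    by (rule definable_subst2[OF *]) (intro definable_intros definable_term_shift assms)+
  then show ?thesis using assms succ_mem unfolding definable_term_def by simp
qed

lemma numeral_mem [simp]: "numeral_set n \<in> V"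
proof (induction n)
  case 0
  then show ?case unfolding numeral_set.simps by (intro as_set_mem coded_finite) auto
qed (auto simp: numeral_set_Suc succ_mem)

lemma tuple_mem: "set xs \<subseteq> V \<Longrightarrow> tuple xs \<in> V"
  unfolding tuple_def by (intro as_set_mem coded_finite) (auto simp: subset_iff)

text \<open>The least inductive set of \<open>V\<close> has no nonstandard element: an \<open>\<in>\<close>-minimal one could be
  removed.\<close>

lemma coded_omega: "range numeral_set \<in> elts ` V"
proof -
  \<comment> \<open>Falsity is written as \<open>z \<noteq> z\<close>, so the first clause asks for
    an empty element in a form to which the rules for definability apply.\<close>
  define ind where "ind = (\<lambda>w::'u. (\<exists>s\<in>elts w. \<forall>z\<in>elts s. z \<noteq> z) \<and> (\<forall>x\<in>elts w. succ x \<in> elts w))"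
  have ind_iff: "ind w \<longleftrightarrow> numeral_set 0 \<in> elts w \<and> (\<forall>x\<in>elts w. succ x \<in> elts w)" for w :: 'u
    using elts_inject[of _ "numeral_set 0"] unfolding ind_def by auto
  obtain w where w: "w \<in> V" "ind w"
    using infinity unfolding ind_def succ_def by (metis as_set_elts empty_iff)
  have [definable_intros]: "definable V (\<lambda>e. ind (e i))" for i
    unfolding ind_def by (intro definable_intros)
  have "{x\<in>elts w. \<forall>v\<in>V. ind v \<longrightarrow> x \<in> elts v} \<in> elts ` V"
    by (intro coded_separation[where P = "\<lambda>x. \<forall>v\<in>V. ind v \<longrightarrow> x \<in> elts v"] elts_image w definable_intros)
  then obtain s where s: "s \<in> V" "elts s = {x\<in>elts w. \<forall>v\<in>V. ind v \<longrightarrow> x \<in> elts v}" by blast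
  have "numeral_set n \<in> elts v" if "ind v" for v :: 'u and n
    by (induction n) (use that in \<open>auto simp: ind_iff numeral_set_Suc\<close>)
  then have 1: "range numeral_set \<subseteq> elts s" using s(2) w by auto
  have inds: "ind s" using w unfolding ind_iff s(2) by auto
  have "x \<in> range numeral_set" if "x \<in> elts s" for x
    using wf_elts that
  proof (induction x rule: wf_induct_rule)
    case (less x)
    show ?case
    proof (rule ccontr)
      assume nx: "x \<notin> range numeral_set"
      have "definable V (\<lambda>e. e 0 \<noteq> x)"
        by (intro definable_intros elts_mem[OF s(1) less.prems])
      then have "{z\<in>elts s. z \<noteq> x} \<in> elts ` V"
        by (rule coded_separation[where P = "\<lambda>z. z \<noteq> x"]) (use s(1) in blast)
      then obtain t where t: "t \<in> V" "elts t = {z\<in>elts s. z \<noteq> x}" by blast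
      have "succ z \<noteq> x" if "z \<in> elts s" for z
        using less.IH[of z] that nx by (auto simp flip: numeral_set_Suc)
      then have "ind t" using inds nx unfolding ind_iff t(2) by auto
      then have "x \<in> elts t" using less.prems s(2) t(1) by blast
      then show False using t(2) by simp
    qed
  qed
  then have "elts s = range numeral_set" using 1 by blast
  then show ?thesis using s(1) by blast
qed

lemma omega_mem [simp]: "omega \<in> V"
  unfolding omega_def using coded_omega by (rule as_set_mem)

end

lemma elts_omega: "elts omega = range numeral_set"
  unfolding omega_def
  by (rule set_model.elts_as_set_mem[OF set_model_UNIV set_model.coded_omega[OF set_model_UNIV]])

section \<open>Finiteness, products, functions and choice of sequences\<close>

context set_model
begin

text \<open>The witness is a numeral \<open>n\<close> and a relation in \<open>V\<close> that
  reaches every element from a member of \<open>n\<close> related to nothing else. For a finite set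
  an enumerating \<open>tuple\<close> is such a relation, and it belongs to \<open>V\<close>;
  conversely numerals have finitely many elements because \<open>omega\<close> is standard.\<close>

lemma definable_finite [definable_intros]:
  assumes "definable_term V a"
  shows "definable V (\<lambda>e. finite (elts (a e)))"
proof -
  have "definable V (\<lambda>e. \<exists>n\<in>elts omega. \<exists>f\<in>V. \<forall>x\<in>elts (e 0). \<exists>i\<in>elts n.
      pair i x \<in> elts f \<and> (\<forall>y\<in>V. pair i y \<in> elts f \<longrightarrow> y = x))"
    by (intro definable_intros) simp
  then have "definable V (\<lambda>e. finite (elts (e 0)))"
  proof (rule definable_cong)
    fix e :: "nat \<Rightarrow> 'u" assume "range e \<subseteq> V"
    then have V: "e 0 \<in> V" by auto
    show "(\<exists>n\<in>elts omega. \<exists>f\<in>V. \<forall>x\<in>elts (e 0). \<exists>i\<in>elts n.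
      pair i x \<in> elts f \<and> (\<forall>y\<in>V. pair i y \<in> elts f \<longrightarrow> y = x)) \<longleftrightarrow> finite (elts (e 0))"
    proof
      assume "\<exists>n\<in>elts omega. \<exists>f\<in>V. \<forall>x\<in>elts (e 0). \<exists>i\<in>elts n.
        pair i x \<in> elts f \<and> (\<forall>y\<in>V. pair i y \<in> elts f \<longrightarrow> y = x)"
      then obtain n f where n: "n \<in> elts omega" "f \<in> V" and *: "\<And>x. x \<in> elts (e 0) \<Longrightarrow> \<exists>i\<in>elts n.
        pair i x \<in> elts f \<and> (\<forall>y\<in>V. pair i y \<in> elts f \<longrightarrow> y = x)" by blast
      have "x \<in> (\<lambda>i. THE y. y \<in> V \<and> pair i y \<in> elts f) ` elts n" if x: "x \<in> elts (e 0)" for x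
      proof -
        obtain i where i: "i \<in> elts n" "pair i x \<in> elts f" "\<forall>y\<in>V. pair i y \<in> elts f \<longrightarrow> y = x"
          using *[OF x] by blast
        have "(THE y. y \<in> V \<and> pair i y \<in> elts f) = x"
          by (rule the_equality) (use i(2,3) elts_mem[OF V x] in blast)+
        then show ?thesis using i(1) by blast
      qed
      then have "elts (e 0) \<subseteq> (\<lambda>i. THE y. y \<in> V \<and> pair i y \<in> elts f) ` elts n" by blast
      moreover have "finite (elts n)" using n(1) by (auto simp: elts_omega elts_numeral)
      ultimately show "finite (elts (e 0))" using finite_surj by blast
    next
      assume "finite (elts (e 0))"
      then obtain xs where xs: "set xs = elts (e 0)" using finite_list by blast
      show "\<exists>n\<in>elts omega. \<exists>f\<in>V. \<forall>x\<in>elts (e 0). \<exists>i\<in>elts n.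
        pair i x \<in> elts f \<and> (\<forall>y\<in>V. pair i y \<in> elts f \<longrightarrow> y = x)"
      proof (rule bexI[of _ "numeral_set (length xs)"], rule bexI[of _ "tuple xs"], rule ballI)
        fix x assume "x \<in> elts (e 0)"
        then obtain i where "i < length xs" "x = xs ! i" using xs by (metis in_set_conv_nth)
        then show "\<exists>i\<in>elts (numeral_set (length xs)).
          pair i x \<in> elts (tuple xs) \<and> (\<forall>y\<in>V. pair i y \<in> elts (tuple xs) \<longrightarrow> y = x)"
          by (intro bexI[of _ "numeral_set i"]) (auto simp: elts_tuple)
      next
        show "tuple xs \<in> V" using xs elts_subset[OF V] by (intro tuple_mem) simp
      qed (simp add: elts_omega)
    qed
  qed
  then show ?thesis
    by (rule definable_subst[where P = "\<lambda>x e. finite (elts x)", OF _ assms])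
qed

text \<open>Kuratowski pairs over \<open>A\<close> and \<open>B\<close> lie in the double power set
  of \<open>A \<union> B\<close>, from which the product is separated.\<close>

lemma coded_times:
  assumes "A \<in> elts ` V" "B \<in> elts ` V"
  shows "{pair x y |x y. x \<in> A \<and> y \<in> B} \<in> elts ` V"
proof -
  obtain a b where ab: "a \<in> V" "A = elts a" "b \<in> V" "B = elts b" using assms by blast
  let ?P = "{y\<in>V. elts y \<subseteq> {y\<in>V. elts y \<subseteq> A \<union> B}}"
  have "?P \<in> elts ` V"
    using assms by (intro coded_power coded_Un)
  moreover have "definable V (\<lambda>e. \<exists>x\<in>elts a. \<exists>y\<in>elts b. e 0 = pair x y)"
    by (intro definable_intros ab)
  ultimately have "{p\<in>?P. \<exists>x\<in>elts a. \<exists>y\<in>elts b. p = pair x y} \<in> elts ` V"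
    by (intro coded_separation[where P = "\<lambda>p. \<exists>x\<in>elts a. \<exists>y\<in>elts b. p = pair x y"])
  also have "{p\<in>?P. \<exists>x\<in>elts a. \<exists>y\<in>elts b. p = pair x y} = {pair x y |x y. x \<in> A \<and> y \<in> B}"
  proof -
    have "pair x y \<in> ?P" if "x \<in> A" "y \<in> B" for x y
    proof -
      have xy: "x \<in> V" "y \<in> V" using that coded_subset assms by blast+
      then have "as_set {x} \<in> V" "as_set {x, y} \<in> V" by (auto intro!: as_set_mem coded_finite)
      then show ?thesis using that xy by (auto simp: elts_pair elts_as_set_finite)
    qed
    then show ?thesis using ab by blast
  qed
  finally show ?thesis .
qed

lemma coded_relation:
  assumes "definable V (\<lambda>e. R (e 0) (e 1))" and "A \<in> elts ` V" "B \<in> elts ` V"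
  shows "{pair x y |x y. x \<in> A \<and> y \<in> B \<and> R x y} \<in> elts ` V"
proof -
  have "definable V (\<lambda>e. \<exists>x\<in>V. \<exists>y\<in>V. e 0 = pair x y \<and> R x y)"
    by (intro definable_intros definable_subst2[OF assms(1)])
  from coded_separation[OF this coded_times[OF assms(2,3)]]
  have "{p\<in>{pair x y |x y. x \<in> A \<and> y \<in> B}. \<exists>x\<in>V. \<exists>y\<in>V. p = pair x y \<and> R x y} \<in> elts ` V" .
  also have "{p\<in>{pair x y |x y. x \<in> A \<and> y \<in> B}. \<exists>x\<in>V. \<exists>y\<in>V. p = pair x y \<and> R x y} =
    {pair x y |x y. x \<in> A \<and> y \<in> B \<and> R x y}"
    using coded_subset assms(2,3) by auto
  finally show ?thesis .
qed

text \<open>The recurrent way to bring a HOL function into the model. The definable relation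
  \<open>R\<close> has to describe \<open>F\<close> on \<open>A\<close> only, so it may be written
  without care for arguments elsewhere.\<close>

lemma function_exists:
  assumes R: "definable V (\<lambda>e. R (e 0) (e 1))" and A: "A \<in> elts ` V"
    and F: "\<And>x. x \<in> A \<Longrightarrow> F x \<in> V" "\<And>x y. x \<in> A \<Longrightarrow> y \<in> V \<Longrightarrow> R x y \<longleftrightarrow> y = F x"
  shows "\<exists>f\<in>V. function_on f A \<and> (\<forall>x\<in>A. app f x = F x) \<and> elts f = {pair x (F x) |x. x \<in> A}"
proof -
  have AV: "x \<in> V" if "x \<in> A" for x using that coded_subset A by blast
  have "definable V (\<lambda>e. \<exists>y\<in>V. e 1 = pair (e 0) y \<and> R (e 0) y)"
    by (intro definable_intros definable_subst2[OF R])
  then have "(\<lambda>x. pair x (F x)) ` A \<in> elts ` V"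
    by (rule coded_replacement[where R = "\<lambda>x z. \<exists>y\<in>V. z = pair x y \<and> R x y"])
      (use A F AV in auto)
  then obtain f where f: "f \<in> V" "elts f = {pair x (F x) |x. x \<in> A}" by (auto simp: Setcompr_eq_image)
  then show ?thesis using function_onI[OF f(2)] by blast
qed

text \<open>The axiom of choice is stated for disjoint families. The candidates for an index
  \<open>x\<close> are therefore tagged as \<open>pair x y\<close>; a transversal of the tagged
  families is the graph of the sequence.\<close>

lemma sequence_choice:
  assumes R: "definable V (\<lambda>e. R (e 0) (e 1))" and A: "A \<in> elts ` V"
    and ex: "\<And>n. \<exists>y\<in>A. R (numeral_set n) y"
  shows "\<exists>f\<in>V. function_on f (elts omega) \<and>
    (\<forall>n. app f (numeral_set n) \<in> A \<and> R (numeral_set n) (app f (numeral_set n)))"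
proof -
  obtain a where a: "a \<in> V" "A = elts a" using A by blast
  define S where "S = (\<lambda>x::'u. {p\<in>{pair x y |x y. x \<in> elts omega \<and> y \<in> A}. \<exists>y\<in>elts a. p = pair x y \<and> R x y})"
  have SV: "S x \<in> elts ` V" if "x \<in> V" for x :: 'u
  proof -
    have "definable V (\<lambda>e. \<exists>y\<in>elts a. e 0 = pair x y \<and> R x y)"
      by (intro definable_intros a definable_subst2[OF R] that)
    then show ?thesis unfolding S_def
      by (rule coded_separation) (intro coded_times elts_image omega_mem A)
  qed
  have omV: "x \<in> V" if "x \<in> elts omega" for x :: 'u using that elts_mem[OF omega_mem] by blast
  have Seq: "S x = {pair x y |y. y \<in> A \<and> R x y}" if "x \<in> elts omega" for x :: 'u
    using that a(2) unfolding S_def by auto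
  have "(\<lambda>x. as_set (S x)) ` elts omega \<in> elts ` V"
  proof (rule coded_replacement)
    show "definable V (\<lambda>e. \<forall>p\<in>V. p \<in> elts (e 1) \<longleftrightarrow> (\<exists>y\<in>elts a. p = pair (e 0) y \<and> R (e 0) y))"
      by (intro definable_intros a definable_subst2[OF R])
    fix x y :: 'u assume x: "x \<in> elts omega" and y: "y \<in> V"
    have "S x \<subseteq> V" using SV[OF omV[OF x]] coded_subset by blast
    then have "(\<forall>p\<in>V. p \<in> elts y \<longleftrightarrow> p \<in> S x) \<longleftrightarrow> elts y = S x"
      by (metis elts_eqI[OF y])
    also have "\<dots> \<longleftrightarrow> y = as_set (S x)"
      using elts_as_set_mem[OF SV[OF omV[OF x]]] as_set_elts[of y] by metis
    finally show "(\<forall>p\<in>V. p \<in> elts y \<longleftrightarrow> (\<exists>y\<in>elts a. p = pair x y \<and> R x y)) \<longleftrightarrow> y = as_set (S x)"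
      unfolding Seq[OF x] a(2) by blast
  qed (use SV omV in \<open>auto intro!: as_set_mem\<close>)
  then obtain s where s: "s \<in> V" "elts s = (\<lambda>x. as_set (S x)) ` elts omega" by blast
  have S: "elts (as_set (S x)) = S x" if "x \<in> elts omega" for x :: 'u
    using SV[OF omV[OF that]] by (rule elts_as_set_mem)
  have "\<exists>c\<in>V. \<forall>y\<in>elts s. \<exists>!z. z \<in> elts y \<and> z \<in> elts c"
  proof (rule choice[OF s(1)])
    show "elts y \<noteq> {}" if "y \<in> elts s" for y
      using that ex S Seq unfolding s(2) by (fastforce simp: elts_omega)
    show "elts y \<inter> elts y' = {}" if "y \<in> elts s" "y' \<in> elts s" "y \<noteq> y'" for y y'
      using that S Seq unfolding s(2) by fastforce
  qed
  then obtain c where c: "c \<in> V" "\<And>x. x \<in> elts omega \<Longrightarrow> \<exists>!z. z \<in> S x \<and> z \<in> elts c"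
    unfolding s(2) using S by auto
  have "{pair x y |x y. x \<in> elts omega \<and> y \<in> A \<and> R x y \<and> pair x y \<in> elts c} \<in> elts ` V"
    by (rule coded_relation[where R = "\<lambda>x y. R x y \<and> pair x y \<in> elts c"])
      (intro definable_intros R c(1) elts_image omega_mem A)+
  then obtain f where f: "f \<in> V" "elts f = {pair x y |x y. x \<in> elts omega \<and> y \<in> A \<and> R x y \<and> pair x y \<in> elts c}"
    by blast
  have uniq: "\<exists>!y. y \<in> A \<and> R x y \<and> pair x y \<in> elts c" if x: "x \<in> elts omega" for x
  proof -
    obtain z where z: "z \<in> S x \<and> z \<in> elts c" "\<And>z'. z' \<in> S x \<and> z' \<in> elts c \<Longrightarrow> z' = z"
      using c(2)[OF x] by (elim ex1E) blast
    then obtain y where y: "z = pair x y" "y \<in> A" "R x y" unfolding Seq[OF x] by blast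
    show ?thesis
    proof (intro ex1I[of _ y])
      fix y' assume "y' \<in> A \<and> R x y' \<and> pair x y' \<in> elts c"
      then have "pair x y' = z" by (intro z(2)) (auto simp: Seq[OF x])
      then show "y' = y" using y by simp
    qed (use y z(1) in auto)
  qed
  have "app f (numeral_set n) \<in> A \<and> R (numeral_set n) (app f (numeral_set n))" for n
    using function_on_relation(2)[OF f(2) uniq, of "numeral_set n"] by (auto simp: elts_omega)
  moreover have "function_on f (elts omega)"
    by (rule function_on_relation(1)[OF f(2) uniq])
  ultimately show ?thesis using f(1) by blast
qed

end

section \<open>Ordinals, cardinality bounds and recursion on natural numbers\<close>

text \<open>Two nested inductions along \<open>\<in>\<close>: for incomparable \<open>i\<close> and
  \<open>j\<close> the hypotheses give both inclusions between their extensions, hence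
  equality.\<close>

lemma ordinal_linear:
  assumes k: "ordinal k" and "i \<in> elts k" "j \<in> elts k"
  shows "i \<in> elts j \<or> i = j \<or> j \<in> elts i"
proof -
  have tr: "elts x \<subseteq> elts k" if "x \<in> elts k" for x using k that unfolding ordinal_def by blast
  have tr2: "elts y \<subseteq> elts x" if "x \<in> elts k" "y \<in> elts x" for x y
    using k that unfolding ordinal_def by blast
  have "\<forall>j\<in>elts k. i \<in> elts j \<or> i = j \<or> j \<in> elts i" if "i \<in> elts k" for i
    using wf_elts that
  proof (induction i rule: wf_induct_rule)
    case (less i)
    have IH: "i' \<in> elts j \<or> i' = j \<or> j \<in> elts i'" if "i' \<in> elts i" "j \<in> elts k" for i' j
      using less.IH[of i'] that tr[OF less.prems] by auto
    show ?case
    proof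
      fix j assume "j \<in> elts k"
      with wf_elts show "i \<in> elts j \<or> i = j \<or> j \<in> elts i"
      proof (induction j rule: wf_induct_rule)
        case (less j)
        note j = \<open>j \<in> elts k\<close>
        have IH2: "i \<in> elts j' \<or> i = j' \<or> j' \<in> elts i" if "j' \<in> elts j" for j'
          using less.IH[of j'] that tr[OF j] by auto
        show ?case
        proof (rule ccontr)
          assume n: "\<not> ?thesis"
          have "elts i \<subseteq> elts j"
          proof
            fix x assume x: "x \<in> elts i"
            then show "x \<in> elts j"
              using IH[OF x j] n tr2[OF \<open>i \<in> elts k\<close> x] by auto
          qed
          moreover have "elts j \<subseteq> elts i"
          proof
            fix x assume x: "x \<in> elts j"
            then show "x \<in> elts i"
              using IH2[OF x] n tr2[OF j x] by auto
          qed
          ultimately have "i = j" by (metis as_set_elts subset_antisym)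
          then show False using n by simp
        qed
      qed
    qed
  qed
  then show ?thesis using assms by blast
qed

lemma ordinal_least:
  assumes k: "ordinal k" and "S \<subseteq> elts k" "S \<noteq> {}"
  shows "\<exists>!i. i \<in> S \<and> (\<forall>j\<in>elts i. j \<notin> S)"
proof -
  obtain i where i: "i \<in> S" "\<And>j. j \<in> elts i \<Longrightarrow> j \<notin> S"
    using wfE_min'[OF wf_elts assms(3)] by auto
  show ?thesis
  proof (intro ex1I[of _ i])
    fix i' assume i': "i' \<in> S \<and> (\<forall>j\<in>elts i'. j \<notin> S)"
    then show "i' = i"
      using ordinal_linear[OF k, of i i'] i i' assms(2) by blast
  qed (use i in blast)
qed

text \<open>An \<open>\<in>\<close>-minimal element of \<open>k\<close> outside the numeral
  \<open>n\<close> is an initial segment of \<open>n\<close>, hence a numeral, and being no element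
  of \<open>n\<close> it is \<open>n\<close> itself. This is what makes countable families
  admissible wherever \<kappa> bounds the size.\<close>

lemma omega_subset_ordinal:
  assumes k: "ordinal k" and inf: "infinite (elts k)"
  shows "elts omega \<subseteq> elts k"
proof -
  have "numeral_set n \<in> elts k" for n
  proof (induction n rule: less_induct)
    case (less n)
    have sub: "elts (numeral_set n) \<subseteq> elts k"
      using less by (auto simp: elts_numeral)
    have "finite (elts (numeral_set n))" by (simp add: elts_numeral)
    then have "elts k - elts (numeral_set n) \<noteq> {}"
      using inf by (metis Diff_eq_empty_iff finite_subset)
    then obtain x where x: "x \<in> elts k" "x \<notin> elts (numeral_set n)"
      "\<And>y. y \<in> elts x \<Longrightarrow> y \<notin> elts k - elts (numeral_set n)"
      using wfE_min'[OF wf_elts, of "elts k - elts (numeral_set n)"] by auto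
    have "elts x \<subseteq> elts k" using k x(1) unfolding ordinal_def by blast
    then have xs: "elts x \<subseteq> numeral_set ` {..<n}" using x(3) by (auto simp: elts_numeral)
    have xt: "elts y \<subseteq> elts x" if "y \<in> elts x" for y
      using k x(1) that unfolding ordinal_def by blast
    define N where "N = {i. numeral_set i \<in> elts x}"
    have ex: "elts x = numeral_set ` N" using xs unfolding N_def by auto
    have N: "N \<subseteq> {..<n}" using xs unfolding N_def by auto
    have down: "j \<in> N" if "i \<in> N" "j < i" for i j
      using xt[of "numeral_set i"] that unfolding N_def by (auto simp: subset_iff)
    have "N = {..<card N}"
    proof -
      define m where "m = (LEAST i. i \<notin> N)"
      have "\<exists>i. i \<notin> N" using N by (auto intro!: exI[of _ n])
      then have "m \<notin> N" "\<And>i. i < m \<Longrightarrow> i \<in> N"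
        unfolding m_def using LeastI_ex not_less_Least by metis+
      then have "N = {..<m}" using down by (metis lessThan_iff linorder_neqE_nat subsetI subset_antisym)
      then show ?thesis by simp
    qed
    then obtain m where m: "N = {..<m}" by blast
    then have "elts x = elts (numeral_set m)" using ex by (simp add: elts_numeral)
    then have "x = numeral_set m" by (metis as_set_elts)
    moreover have "m = n"
      using N m x(2) calculation by (metis le_neq_implies_less lessThan_subset_iff numeral_mem_numeral)
    ultimately show ?case using x(1) by simp
  qed
  then show ?thesis by (auto simp: elts_omega)
qed

context set_model
begin

lemma size_leI:
  assumes "h \<in> V" "function_on h (elts F)" "\<And>x. x \<in> elts F \<Longrightarrow> app h x \<in> elts k"
    and "\<And>x y. x \<in> elts F \<Longrightarrow> y \<in> elts F \<Longrightarrow> app h x = app h y \<Longrightarrow> x = y"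
  shows "size_le V F k"
  using assms unfolding size_le_def inj_on_def by blast

text \<open>An injection of the image needs no choice: \<open>y\<close> is sent to the least of the
  ordinals \<open>app h x\<close> with \<open>x\<close> a preimage of \<open>y\<close>. The least
  element is definable, so this map belongs to \<open>V\<close>.\<close>

lemma size_le_image:
  assumes k: "ordinal k" "k \<in> V" and F: "F \<in> V" "size_le V F k"
    and R: "definable V (\<lambda>e. R (e 0) (e 1))"
    and G: "\<And>x. x \<in> elts F \<Longrightarrow> G x \<in> V" "\<And>x y. x \<in> elts F \<Longrightarrow> y \<in> V \<Longrightarrow> R x y \<longleftrightarrow> y = G x"
  shows "G ` elts F \<in> elts ` V" and "size_le V (as_set (G ` elts F)) k"
proof -
  show GF: "G ` elts F \<in> elts ` V"
    by (rule coded_replacement[OF R elts_image[OF F(1)]]) (use G in auto)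
  obtain h where h: "h \<in> V" "function_on h (elts F)" "app h ` elts F \<subseteq> elts k" "inj_on (app h) (elts F)"
    using F(2) unfolding size_le_def by blast
  define S where "S y = {app h x |x. x \<in> elts F \<and> G x = y}" for y
  have S: "\<exists>!i. i \<in> S y \<and> (\<forall>j\<in>elts i. j \<notin> S y)" if "y \<in> G ` elts F" for y
    using that h(3) by (intro ordinal_least[OF k(1)]) (auto simp: S_def)
  define H where "H y = (THE i. i \<in> S y \<and> (\<forall>j\<in>elts i. j \<notin> S y))" for y
  have H: "H y \<in> S y \<and> (\<forall>j\<in>elts (H y). j \<notin> S y)" if "y \<in> G ` elts F" for y
    unfolding H_def by (rule theI'[OF S[OF that]])
  have SV: "S y \<subseteq> elts k" for y using h(3) by (auto simp: S_def)
  have mem: "i \<in> S y \<longleftrightarrow> (\<exists>x\<in>elts F. R x y \<and> pair x i \<in> elts h)" if "y \<in> V" for i y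
    using G(2)[OF _ that] function_on_iff[OF h(2)] unfolding S_def by blast
  have "\<exists>f\<in>V. function_on f (G ` elts F) \<and> (\<forall>x\<in>G ` elts F. app f x = H x) \<and>
      elts f = {pair x (H x) |x. x \<in> G ` elts F}"
  proof (rule function_exists[OF _ GF])
    show "definable V (\<lambda>e. (\<exists>x\<in>elts F. R x (e 0) \<and> pair x (e 1) \<in> elts h) \<and>
       (\<forall>j\<in>elts (e 1). \<not> (\<exists>x\<in>elts F. R x (e 0) \<and> pair x j \<in> elts h)))"
      by (intro definable_intros definable_subst2[OF R] F(1) h(1))
    fix y assume y: "y \<in> G ` elts F"
    then have yV: "y \<in> V" using G(1) by auto
    show "H y \<in> V" using H[OF y] SV elts_mem[OF k(2)] by blast
    fix i assume "i \<in> V"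
    show "((\<exists>x\<in>elts F. R x y \<and> pair x i \<in> elts h) \<and>
       (\<forall>j\<in>elts i. \<not> (\<exists>x\<in>elts F. R x y \<and> pair x j \<in> elts h))) \<longleftrightarrow> i = H y"
      unfolding mem[OF yV, symmetric] using S[OF y] H[OF y] by metis
  qed
  then obtain f where f: "f \<in> V" "function_on f (G ` elts F)" "\<And>x. x \<in> G ` elts F \<Longrightarrow> app f x = H x"
    by blast
  show "size_le V (as_set (G ` elts F)) k"
  proof (rule size_leI[OF f(1)])
    show "function_on f (elts (as_set (G ` elts F)))" using f(2) GF by (simp only: elts_as_set_mem)
    fix y assume "y \<in> elts (as_set (G ` elts F))"
    then have y: "y \<in> G ` elts F" using GF by (simp only: elts_as_set_mem)
    show "app f y \<in> elts k" using H[OF y] SV f(3)[OF y] by auto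
    fix y' assume "y' \<in> elts (as_set (G ` elts F))"
    then have y': "y' \<in> G ` elts F" using GF by (simp only: elts_as_set_mem)
    assume "app f y = app f y'"
    then have "H y \<in> S y" "H y \<in> S y'" using H[OF y] H[OF y'] f(3)[OF y] f(3)[OF y'] by auto
    then show "y = y'" using h(4) unfolding S_def inj_on_def by auto
  qed
qed

lemma size_le_subset_ordinal:
  assumes "F \<in> V" "elts F \<subseteq> elts k"
  shows "size_le V F k"
proof -
  have "\<exists>f\<in>V. function_on f (elts F) \<and> (\<forall>x\<in>elts F. app f x = x) \<and> elts f = {pair x x |x. x \<in> elts F}"
  proof (rule function_exists[where R = "\<lambda>x y. y = x"])
    show "definable V (\<lambda>e. e 1 = e 0)" by (intro definable_intros)
  qed (use assms elts_mem[OF assms(1)] in simp_all)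
  then obtain f where "f \<in> V" "function_on f (elts F)" "\<forall>x\<in>elts F. app f x = x" by blast
  then show ?thesis using assms(2) by (intro size_leI[of f]) auto
qed

lemma size_le_finite:
  assumes "F \<in> V" "finite (elts F)" "infinite (elts k)" "k \<in> V"
  shows "size_le V F k"
proof -
  obtain B where B: "finite B" "card B = card (elts F)" "B \<subseteq> elts k"
    using infinite_arbitrarily_large[OF assms(3)] by blast
  obtain g where g: "inj_on g (elts F)" "g ` elts F \<subseteq> elts k"
    using finite_same_card_bij[OF assms(2) B(1)] B by (auto simp: bij_betw_def)
  have "{pair x (g x) |x. x \<in> elts F} \<in> elts ` V"
    using assms g elts_mem[OF assms(1)] elts_mem[OF assms(4)] by (intro coded_finite) auto
  then obtain f where f: "f \<in> V" "elts f = {pair x (g x) |x. x \<in> elts F}" by blast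
  show ?thesis
    using g function_onI(2)[OF f(2)] by (intro size_leI[OF f(1) function_onI(1)[OF f(2)]]) (auto simp: inj_on_def)
qed

section \<open>Arithmetic functions defined inside the model\<close>

definition definable_nat_fun :: "(nat \<Rightarrow> nat) \<Rightarrow> bool" where
  "definable_nat_fun G \<longleftrightarrow> (\<exists>R. definable V (\<lambda>e. R (e 0) (e 1)) \<and>
     (\<forall>n. \<forall>y\<in>V. R (numeral_set n) y \<longleftrightarrow> y = numeral_set (G n)))"

text \<open>Recursion inside \<open>V\<close>: a value of the iteration is certified by a finite set that is closed under
  predecessors.\<close>

lemma definable_nat_fun_iterate:
  assumes "definable_nat_fun G"
  shows "definable_nat_fun (\<lambda>n. (G ^^ n) a)"
proof -
  obtain R where R: "definable V (\<lambda>e. R (e 0) (e 1))"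
    "\<And>n y. y \<in> V \<Longrightarrow> R (numeral_set n) y \<longleftrightarrow> y = numeral_set (G n)"
    using assms unfolding definable_nat_fun_def by blast
  define Q where "Q x y \<longleftrightarrow> (\<exists>h\<in>V. pair x y \<in> elts h \<and>
      (\<forall>p\<in>elts h. p = pair (numeral_set 0) (numeral_set a) \<or>
         (\<exists>i\<in>V. \<exists>j\<in>V. \<exists>k\<in>V. p = pair (succ i) k \<and> pair i j \<in> elts h \<and> R j k)))" for x y
  have "Q (numeral_set n) y \<longleftrightarrow> y = numeral_set ((G ^^ n) a)" if "y \<in> V" for n y
  proof
    assume "Q (numeral_set n) y"
    then obtain h where h: "h \<in> V" "pair (numeral_set n) y \<in> elts h" and
      *: "\<And>p. p \<in> elts h \<Longrightarrow> p = pair (numeral_set 0) (numeral_set a) \<or>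
         (\<exists>i\<in>V. \<exists>j\<in>V. \<exists>k\<in>V. p = pair (succ i) k \<and> pair i j \<in> elts h \<and> R j k)"
      unfolding Q_def by blast
    from h(2) show "y = numeral_set ((G ^^ n) a)"
    proof (induction n arbitrary: y)
      case 0
      have "numeral_set 0 \<noteq> succ i" for i
        using elts_succ[of i] elts_numeral_0 by (metis insert_not_empty)
      then show ?case using *[OF 0] by auto
    next
      case (Suc n)
      have "numeral_set (Suc n) \<noteq> numeral_set 0" by simp
      then obtain j where j: "pair (numeral_set n) j \<in> elts h" "R j y" "y \<in> V"
        using *[OF Suc.prems] by (auto simp: numeral_set_Suc)
      then show ?case using Suc.IH[OF j(1)] R(2)[OF j(3)] by simp
    qed
  next
    assume y: "y = numeral_set ((G ^^ n) a)"
    have "{pair (numeral_set i) (numeral_set ((G ^^ i) a)) |i. i \<le> n} \<in> elts ` V"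
      by (intro coded_finite) auto
    then obtain h where h: "h \<in> V" "elts h = {pair (numeral_set i) (numeral_set ((G ^^ i) a)) |i. i \<le> n}"
      by blast
    show "Q (numeral_set n) y"
      unfolding Q_def
    proof (rule bexI[OF _ h(1)], intro conjI ballI)
      show "pair (numeral_set n) y \<in> elts h" using h(2) y by blast
      fix p assume "p \<in> elts h"
      then obtain i where i: "i \<le> n" "p = pair (numeral_set i) (numeral_set ((G ^^ i) a))"
        using h(2) by blast
      show "p = pair (numeral_set 0) (numeral_set a) \<or>
         (\<exists>i\<in>V. \<exists>j\<in>V. \<exists>k\<in>V. p = pair (succ i) k \<and> pair i j \<in> elts h \<and> R j k)"
      proof (cases i)
        case (Suc m)
        have "p = pair (succ (numeral_set m)) (numeral_set ((G ^^ Suc m) a))"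
          using i(2) by (simp add: Suc numeral_set_Suc)
        moreover have "pair (numeral_set m) (numeral_set ((G ^^ m) a)) \<in> elts h"
          using h(2) i(1) Suc by auto
        moreover have "R (numeral_set ((G ^^ m) a)) (numeral_set ((G ^^ Suc m) a))"
          using R(2) by simp
        ultimately show ?thesis using numeral_mem by blast
      qed (use i in simp)
    qed
  qed
  moreover have "definable V (\<lambda>e. Q (e 0) (e 1))"
    unfolding Q_def by (intro definable_intros definable_subst2[OF R(1)] numeral_mem)
  ultimately show ?thesis unfolding definable_nat_fun_def by blast
qed

text \<open>Starting from \<open>succ\<close> alone, doubling arises by iterating
  \<open>n + 2\<close> from 0, and the powers by iterating doubling from 1. They are the
  denominators of the dyadic bounds that define near maximizers.\<close>

lemma definable_power_of_2: "definable_nat_fun (\<lambda>n. 2 ^ n)"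
proof -
  have "definable_nat_fun (\<lambda>n. n + 2)"
    unfolding definable_nat_fun_def
    by (intro exI[of _ "\<lambda>x y. y = succ (succ x)"] conjI definable_intros)
      (simp add: numeral_set_Suc)
  moreover have "((\<lambda>n. n + 2) ^^ n) 0 = 2 * n" for n :: nat by (induction n) auto
  ultimately have "definable_nat_fun (\<lambda>n. 2 * n)"
    using definable_nat_fun_iterate[of "\<lambda>n. n + 2" 0] by simp
  moreover have "((\<lambda>n. 2 * n) ^^ n) (Suc 0) = 2 ^ n" for n :: nat by (induction n) auto
  ultimately show ?thesis
    using definable_nat_fun_iterate[of "\<lambda>n. 2 * n" 1] by simp
qed

end

section \<open>Structures and the action of permutations\<close>

definition sat :: "'u::set_universe \<Rightarrow> 'u \<times> 'u list \<Rightarrow> bool" where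
  "sat M a \<longleftrightarrow> tuple (snd a) \<in> elts (app M (fst a))"

definition atoms :: "'u::set_universe \<Rightarrow> 'u \<Rightarrow> ('u \<times> 'u list) set" where
  "atoms L X = {(R, xs). has_arity L R (length xs) \<and> set xs \<subseteq> elts X}"

text \<open>For finite \<open>I\<close> these are the clopen sets of the space of truth assignments
  to atoms, cut down to structures in \<open>V\<close>. A predicate \<open>Q\<close> on the set of
  true atoms replaces a syntax of Boolean combinations, so the same \<open>I\<close> and
  \<open>Q\<close> name a set in every model.\<close>

definition clopen_set ::
    "'u::set_universe set \<Rightarrow> 'u \<Rightarrow> 'u \<Rightarrow> ('u \<times> 'u list) set \<Rightarrow> (('u \<times> 'u list) set \<Rightarrow> bool) \<Rightarrow> 'u set" where
  "clopen_set V L X I Q = {M \<in> Str V L X. Q {a \<in> I. sat M a}}"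

definition support :: "('u \<times> 'u list) set \<Rightarrow> 'u set" where
  "support I = (\<Union>a\<in>I. set (snd a))"

definition move :: "('u \<Rightarrow> 'u) \<Rightarrow> 'u \<times> 'u list \<Rightarrow> 'u \<times> 'u list" where
  "move \<sigma> a = (fst a, map \<sigma> (snd a))"

text \<open>\<open>act\<close> is a definite description involving HOL lists. This relation and the
  next two describe its graph on tuples, structures and sets of structures by quantifiers over
  \<open>V\<close>, which makes the action definable.\<close>

definition maps_tuple :: "'u::set_universe set \<Rightarrow> 'u \<Rightarrow> 'u \<Rightarrow> 'u \<Rightarrow> bool" where
  "maps_tuple V g t t' \<longleftrightarrow>
     (\<forall>p\<in>elts t. \<exists>i\<in>V. \<exists>x\<in>V. \<exists>y\<in>V. p = pair i x \<and> pair x y \<in> elts g \<and> pair i y \<in> elts t') \<and>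
     (\<forall>p\<in>elts t'. \<exists>i\<in>V. \<exists>x\<in>V. \<exists>y\<in>V. p = pair i y \<and> pair x y \<in> elts g \<and> pair i x \<in> elts t)"

definition maps_structure :: "'u::set_universe set \<Rightarrow> 'u \<Rightarrow> 'u \<Rightarrow> 'u \<Rightarrow> bool" where
  "maps_structure V g M N \<longleftrightarrow> (\<forall>R\<in>V. \<forall>r\<in>V. \<forall>r'\<in>V. pair R r \<in> elts M \<longrightarrow> pair R r' \<in> elts N \<longrightarrow>
     (\<forall>t\<in>elts r. \<exists>t'\<in>elts r'. maps_tuple V g t t') \<and> (\<forall>t'\<in>elts r'. \<exists>t\<in>elts r. maps_tuple V g t t'))"

definition maps_set :: "'u::set_universe set \<Rightarrow> 'u \<Rightarrow> 'u \<Rightarrow> 'u \<Rightarrow> 'u \<Rightarrow> bool" where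
  "maps_set V S g A D \<longleftrightarrow> (\<forall>N\<in>V. N \<in> elts D \<longleftrightarrow> N \<in> elts S \<and> (\<exists>M\<in>elts A. maps_structure V g M N))"

definition is_permutation :: "'u::set_universe \<Rightarrow> 'u \<Rightarrow> bool" where
  "is_permutation X g \<longleftrightarrow> (\<forall>p\<in>elts g. \<exists>x\<in>elts X. \<exists>y\<in>elts X. p = pair x y) \<and>
     (\<forall>x\<in>elts X. \<exists>y\<in>elts X. pair x y \<in> elts g \<and> (\<forall>y'\<in>elts X. pair x y' \<in> elts g \<longrightarrow> y' = y)) \<and>
     (\<forall>y\<in>elts X. \<exists>x\<in>elts X. pair x y \<in> elts g \<and> (\<forall>x'\<in>elts X. pair x' y \<in> elts g \<longrightarrow> x' = x))"

text \<open>The atom is given by its code \<open>pair R t\<close>, so that a finite set of atoms can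
  be a member of the model.\<close>

definition holds :: "'u::set_universe set \<Rightarrow> 'u \<Rightarrow> 'u \<Rightarrow> bool" where
  "holds V M p \<longleftrightarrow> (\<exists>R\<in>V. \<exists>t\<in>V. \<exists>r\<in>V. p = pair R t \<and> pair R r \<in> elts M \<and> t \<in> elts r)"

lemma is_structure_app:
  assumes "is_structure L X M" "has_arity L R n"
  shows "pair R r \<in> elts M \<longleftrightarrow> r = app M R"
proof -
  have *: "\<exists>!r. pair R r \<in> elts M" using assms unfolding is_structure_def by blast
  have "pair R (app M R) \<in> elts M" unfolding app_def by (rule theI'[OF *])
  then show ?thesis using * by blast
qed

lemma is_structure_tuple:
  assumes "is_structure L X M" "has_arity L R n" "t \<in> elts (app M R)"
  obtains xs where "t = tuple xs" "length xs = n" "set xs \<subseteq> elts X"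
  using assms unfolding is_structure_def by blast

lemma is_structure_elts:
  assumes "is_structure L X M"
  shows "elts M = {pair R (app M R) |R. \<exists>n. has_arity L R n}"
proof (intro subset_antisym subsetI)
  fix p assume p: "p \<in> elts M"
  then obtain R n r where R: "has_arity L R n" "p = pair R r"
    using assms unfolding is_structure_def by blast
  then have "r = app M R" using is_structure_app[OF assms R(1)] p by simp
  then show "p \<in> {pair R (app M R) |R. \<exists>n. has_arity L R n}" using R by blast
next
  fix p assume "p \<in> {pair R (app M R) |R. \<exists>n. has_arity L R n}"
  then obtain R n where "has_arity L R n" "p = pair R (app M R)" by blast
  then show "p \<in> elts M" using is_structure_app[OF assms] by simp
qed

lemma structure_eqI:
  assumes M: "is_structure L X M" and N: "is_structure L X N"
    and eq: "\<And>a. a \<in> atoms L X \<Longrightarrow> sat M a \<longleftrightarrow> sat N a"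
  shows "M = N"
proof -
  have "app M R = app N R" if R: "has_arity L R n" for R n
  proof -
    have "elts (app M R) \<subseteq> elts (app N R)"
    proof
      fix t assume t: "t \<in> elts (app M R)"
      then obtain xs where "t = tuple xs" "length xs = n" "set xs \<subseteq> elts X"
        using is_structure_tuple[OF M R] by blast
      then show "t \<in> elts (app N R)" using eq[of "(R, xs)"] R t by (simp add: atoms_def sat_def)
    qed
    moreover have "elts (app N R) \<subseteq> elts (app M R)"
    proof
      fix t assume t: "t \<in> elts (app N R)"
      then obtain xs where "t = tuple xs" "length xs = n" "set xs \<subseteq> elts X"
        using is_structure_tuple[OF N R] by blast
      then show "t \<in> elts (app M R)" using eq[of "(R, xs)"] R t by (simp add: atoms_def sat_def)
    qed
    ultimately show ?thesis by (metis as_set_elts subset_antisym)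
  qed
  then have "elts M = elts N" unfolding is_structure_elts[OF M] is_structure_elts[OF N] by metis
  then show ?thesis by (metis as_set_elts)
qed

lemma move_cong: "support I \<subseteq> B \<Longrightarrow> (\<And>x. x \<in> B \<Longrightarrow> \<sigma> x = \<tau> x) \<Longrightarrow> a \<in> I \<Longrightarrow> move \<sigma> a = move \<tau> a"
  unfolding move_def support_def by auto

lemma support_atoms: "I \<subseteq> atoms L X \<Longrightarrow> support I \<subseteq> elts X"
  unfolding support_def atoms_def by fastforce

lemma finite_support: "finite I \<Longrightarrow> finite (support I)"
  unfolding support_def by auto

context set_model
begin

lemma definable_maps_tuple [definable_intros]:
  assumes "definable_term V g" "definable_term V t" "definable_term V t'"
  shows "definable V (\<lambda>e. maps_tuple V (g e) (t e) (t' e))"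
proof (rule definable_subst3[OF _ assms])
  show "definable V (\<lambda>e. maps_tuple V (e 0) (e 1) (e 2))"
    unfolding maps_tuple_def by (intro definable_intros)
qed

lemma definable_maps_structure [definable_intros]:
  assumes "definable_term V g" "definable_term V M" "definable_term V N"
  shows "definable V (\<lambda>e. maps_structure V (g e) (M e) (N e))"
proof (rule definable_subst3[OF _ assms])
  show "definable V (\<lambda>e. maps_structure V (e 0) (e 1) (e 2))"
    unfolding maps_structure_def by (intro definable_intros)
qed

lemma definable_maps_set [definable_intros]:
  assumes "definable_term V S" "definable_term V g" "definable_term V A" "definable_term V D"
  shows "definable V (\<lambda>e. maps_set V (S e) (g e) (A e) (D e))"
proof (rule definable_subst4[OF _ assms])
  show "definable V (\<lambda>e. maps_set V (e 0) (e 1) (e 2) (e 3))"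
    unfolding maps_set_def by (intro definable_intros)
qed

lemma definable_is_permutation [definable_intros]:
  assumes "definable_term V X" "definable_term V g"
  shows "definable V (\<lambda>e. is_permutation (X e) (g e))"
proof (rule definable_subst2[OF _ assms])
  show "definable V (\<lambda>e. is_permutation (e 0) (e 1))"
    unfolding is_permutation_def by (intro definable_intros)
qed

lemma definable_holds [definable_intros]:
  assumes "definable_term V M" "definable_term V p"
  shows "definable V (\<lambda>e. holds V (M e) (p e))"
proof (rule definable_subst2[OF _ assms])
  show "definable V (\<lambda>e. holds V (e 0) (e 1))"
    unfolding holds_def by (intro definable_intros)
qed

lemma Sym_iff: 
  assumes "X \<in> V"
  shows "g \<in> Sym V X \<longleftrightarrow> g \<in> V \<and> is_permutation X g"
proof (intro iffI conjI)
  assume g: "g \<in> Sym V X"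
  then have f: "function_on g (elts X)" and b: "bij_betw (app g) (elts X) (elts X)"
    unfolding Sym_def by auto
  note iff = function_on_iff[OF f]
  have im: "app g x \<in> elts X" if "x \<in> elts X" for x using b that bij_betwE by blast
  show "g \<in> V" using g unfolding Sym_def by auto
  show "is_permutation X g"
    unfolding is_permutation_def
  proof (intro conjI ballI)
    fix p assume "p \<in> elts g"
    then show "\<exists>x\<in>elts X. \<exists>y\<in>elts X. p = pair x y"
      using elts_function[OF f] im by auto
  next
    fix x assume x: "x \<in> elts X"
    show "\<exists>y\<in>elts X. pair x y \<in> elts g \<and> (\<forall>y'\<in>elts X. pair x y' \<in> elts g \<longrightarrow> y' = y)"
      using iff[OF x] im[OF x] by auto
  next
    fix y assume "y \<in> elts X"
    then obtain x where x: "x \<in> elts X" "y = app g x" using b unfolding bij_betw_def by auto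
    show "\<exists>x\<in>elts X. pair x y \<in> elts g \<and> (\<forall>x'\<in>elts X. pair x' y \<in> elts g \<longrightarrow> x' = x)"
    proof (intro bexI[OF _ x(1)] conjI ballI impI)
      show "pair x y \<in> elts g" using iff[OF x(1)] x(2) by simp
      fix x' assume "x' \<in> elts X" "pair x' y \<in> elts g"
      then show "x' = x" using iff[of x'] x b unfolding bij_betw_def inj_on_def by auto
    qed
  qed
next
  assume "g \<in> V \<and> is_permutation X g"
  then have gV: "g \<in> V" and g: "\<And>p. p \<in> elts g \<Longrightarrow> \<exists>x\<in>elts X. \<exists>y\<in>elts X. p = pair x y"
    "\<And>x. x \<in> elts X \<Longrightarrow> \<exists>y\<in>elts X. pair x y \<in> elts g \<and> (\<forall>y'\<in>elts X. pair x y' \<in> elts g \<longrightarrow> y' = y)"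
    "\<And>y. y \<in> elts X \<Longrightarrow> \<exists>x\<in>elts X. pair x y \<in> elts g \<and> (\<forall>x'\<in>elts X. pair x' y \<in> elts g \<longrightarrow> x' = x)"
    unfolding is_permutation_def by blast+
  have eq: "elts g = {pair x y |x y. x \<in> elts X \<and> pair x y \<in> elts g}"
    using g(1) by blast
  have inX: "x \<in> elts X \<and> y \<in> elts X" if "pair x y \<in> elts g" for x y
    using g(1)[OF that] by auto
  have ex1: "\<exists>!y. pair x y \<in> elts g" if "x \<in> elts X" for x
    using g(2)[OF that] inX by blast
  have f: "function_on g (elts X)" by (rule function_on_relation(1)[OF eq ex1])
  have app: "pair x (app g x) \<in> elts g" if "x \<in> elts X" for x
    by (rule function_on_relation(2)[OF eq ex1 that])
  have "bij_betw (app g) (elts X) (elts X)"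
    unfolding bij_betw_def
  proof
    show "inj_on (app g) (elts X)"
    proof (rule inj_onI)
      fix x y assume x: "x \<in> elts X" and y: "y \<in> elts X" and e: "app g x = app g y"
      show "x = y" using g(3)[of "app g x"] app[OF x] app[OF y] e inX x y by metis
    qed
    show "app g ` elts X = elts X"
    proof
      show "app g ` elts X \<subseteq> elts X" using app inX by blast
      show "elts X \<subseteq> app g ` elts X"
        using g(3) function_on_iff[OF f] by (metis imageI subsetI)
    qed
  qed
  then show "g \<in> Sym V X" using f gV unfolding Sym_def by blast
qed

text \<open>Inside the finite set \<open>Z\<close> the complements of \<open>Y\<close> and of its
  image have the same size, so \<sigma> extends to a permutation of \<open>Z\<close>, and by the
  identity to all of \<open>X\<close>. The result is definable from finite data and hence belongs to
  every model containing \<open>X\<close>: all models realize the same finite parts of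
  permutations.\<close>

lemma permutation_extension:
  assumes X: "X \<in> V" and Y: "finite Y" "Y \<subseteq> elts X" and \<sigma>: "inj_on \<sigma> Y" "\<sigma> ` Y \<subseteq> elts X"
  shows "\<exists>h\<in>Sym V X. \<forall>y\<in>Y. app h y = \<sigma> y"
proof -
  define Z where "Z = Y \<union> \<sigma> ` Y"
  have Z: "finite Z" "Z \<subseteq> elts X" "Y \<subseteq> Z" "\<sigma> ` Y \<subseteq> Z" using Y \<sigma> by (auto simp: Z_def)
  have "card (Z - Y) = card (Z - \<sigma> ` Y)"
    using Z Y(1) card_image[OF \<sigma>(1)] by (simp add: card_Diff_subset)
  then obtain \<tau> where \<tau>: "bij_betw \<tau> (Z - Y) (Z - \<sigma> ` Y)"
    using finite_same_card_bij Z(1) by blast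
  define \<pi> where "\<pi> x = (if x \<in> Y then \<sigma> x else \<tau> x)" for x
  have "bij_betw \<pi> (Y \<union> (Z - Y)) (\<sigma> ` Y \<union> (Z - \<sigma> ` Y))"
  proof (rule bij_betw_combine)
    show "bij_betw \<pi> Y (\<sigma> ` Y)"
      using \<sigma>(1) by (auto simp: bij_betw_def \<pi>_def inj_on_def)
    show "bij_betw \<pi> (Z - Y) (Z - \<sigma> ` Y)"
      by (rule iffD1[OF bij_betw_cong \<tau>]) (simp add: \<pi>_def)
  qed auto
  moreover have "Y \<union> (Z - Y) = Z" "\<sigma> ` Y \<union> (Z - \<sigma> ` Y) = Z" using Z by auto
  ultimately have \<pi>: "bij_betw \<pi> Z Z" by simp
  define H where "H x = (if x \<in> Z then \<pi> x else x)" for x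
  have "bij_betw H (Z \<union> (elts X - Z)) (Z \<union> (elts X - Z))"
  proof (rule bij_betw_combine)
    show "bij_betw H Z Z" by (rule iffD1[OF bij_betw_cong \<pi>]) (simp add: H_def)
    show "bij_betw H (elts X - Z) (elts X - Z)"
      by (rule iffD1[OF bij_betw_cong bij_betw_id]) (simp add: H_def)
  qed auto
  moreover have "Z \<union> (elts X - Z) = elts X" using Z by auto
  ultimately have H: "bij_betw H (elts X) (elts X)" by simp
  have ZV: "Z \<subseteq> V" using Z(2) elts_subset[OF X] by blast
  have HV: "H x \<in> V" if "x \<in> elts X" for x
    using H that elts_mem[OF X] bij_betwE by blast
  have "{pair x (H x) |x. x \<in> Z} \<in> elts ` V"
    using Z ZV HV by (intro coded_finite) (auto simp: subset_iff)
  then obtain f where f: "f \<in> V" "elts f = {pair x (H x) |x. x \<in> Z}" by blast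
  obtain z where z: "z \<in> V" "elts z = Z" using coded_finite[OF Z(1) ZV] by blast
  have "\<exists>h\<in>V. function_on h (elts X) \<and> (\<forall>x\<in>elts X. app h x = H x) \<and> elts h = {pair x (H x) |x. x \<in> elts X}"
  proof (rule function_exists[OF _ elts_image[OF X] HV])
    show "definable V (\<lambda>e. e 0 \<notin> elts z \<and> e 1 = e 0 \<or> pair (e 0) (e 1) \<in> elts f)"
      by (intro definable_intros z f)
    show "(x \<notin> elts z \<and> y = x \<or> pair x y \<in> elts f) \<longleftrightarrow> y = H x" for x y
      by (auto simp: z(2) f(2) H_def)
  qed
  then obtain h where h: "h \<in> V" "function_on h (elts X)" "\<And>x. x \<in> elts X \<Longrightarrow> app h x = H x" by blast
  have "bij_betw (app h) (elts X) (elts X)"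
    by (rule iffD1[OF bij_betw_cong H]) (simp add: h)
  then have "h \<in> Sym V X" using h unfolding Sym_def by blast
  moreover have "app h y = \<sigma> y" if "y \<in> Y" for y
  proof -
    have "y \<in> Z" "y \<in> elts X" using that Y(2) Z(3) by blast+
    then show ?thesis using h(3)[of y] that by (simp add: H_def \<pi>_def)
  qed
  ultimately show ?thesis by blast
qed

end

text \<open>That the structures of \<open>V\<close> form a member of \<open>V\<close> is an
  assumption here; it is later derived from the existence of a measure, through measurability of the
  whole space.\<close>

locale structure_space = set_model V for V :: "'u::set_universe set" +
  fixes L X :: 'u
  assumes X: "X \<in> V" and Str_coded: "Str V L X \<in> elts ` V"
begin

abbreviation "\<S> \<equiv> Str V L X"

abbreviation "clo \<equiv> clopen_set V L X"

lemma S_mem [simp]: "as_set \<S> \<in> V" and elts_S [simp]: "elts (as_set \<S>) = \<S>"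
  using Str_coded as_set_mem elts_as_set_mem by blast+

lemma S_structure: "M \<in> \<S> \<Longrightarrow> is_structure L X M" and S_V: "M \<in> \<S> \<Longrightarrow> M \<in> V"
  unfolding Str_def by auto

section \<open>Permutations and their action on structures\<close>

lemma Sym_app_mem: "g \<in> Sym V X \<Longrightarrow> x \<in> elts X \<Longrightarrow> app g x \<in> elts X"
  unfolding Sym_def bij_betw_def by blast

lemma Sym_app_inj: "g \<in> Sym V X \<Longrightarrow> inj_on (app g) (elts X)"
  unfolding Sym_def bij_betw_def by simp

lemma Sym_app_surj: "g \<in> Sym V X \<Longrightarrow> app g ` elts X = elts X"
  unfolding Sym_def bij_betw_def by simp

lemma Sym_V: "g \<in> Sym V X \<Longrightarrow> g \<in> V" 
  unfolding Sym_def by blast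

lemma Sym_pair: "g \<in> Sym V X \<Longrightarrow> pair x y \<in> elts g \<longleftrightarrow> x \<in> elts X \<and> y = app g x"
  using elts_function[of g "elts X"] unfolding Sym_def by auto

lemma Sym_map: "g \<in> Sym V X \<Longrightarrow> set xs \<subseteq> elts X \<Longrightarrow> set (map (app g) xs) \<subseteq> elts X"
  using Sym_app_mem by auto

lemma X_tuple_mem: "set xs \<subseteq> elts X \<Longrightarrow> tuple xs \<in> V"
  using elts_subset[OF X] by (intro tuple_mem) auto

lemma maps_tuple_iff:
  assumes g: "g \<in> Sym V X" and xs: "set xs \<subseteq> elts X" and t': "t' \<in> V"
  shows "maps_tuple V g (tuple xs) t' \<longleftrightarrow> t' = tuple (map (app g) xs)"
proof -
  have xsX: "xs ! i \<in> elts X" if "i < length xs" for i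
    using that xs nth_mem by blast
  have xsV: "xs ! i \<in> V" "app g (xs ! i) \<in> V" "xs ! i \<in> elts X" if "i < length xs" for i
    using xsX[OF that] elts_mem[OF X] Sym_app_mem[OF g] by blast+
  show ?thesis
  proof
    assume *: "maps_tuple V g (tuple xs) t'"
    have "elts t' = elts (tuple (map (app g) xs))"
    proof (intro subset_antisym subsetI)
      fix p assume "p \<in> elts t'"
      then obtain i x y where "p = pair i y" "pair x y \<in> elts g" "pair i x \<in> elts (tuple xs)"
        using * unfolding maps_tuple_def by blast
      then show "p \<in> elts (tuple (map (app g) xs))"
        using Sym_pair[OF g] by (auto simp: elts_tuple)
    next
      fix p assume "p \<in> elts (tuple (map (app g) xs))"
      then obtain i where i: "i < length xs" "p = pair (numeral_set i) (app g (xs ! i))"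
        by (auto simp: elts_tuple)
      then have "pair (numeral_set i) (xs ! i) \<in> elts (tuple xs)" by (auto simp: elts_tuple)
      then obtain i' x y where "pair (numeral_set i) (xs ! i) = pair i' x" "pair x y \<in> elts g"
        "pair i' y \<in> elts t'"
        using * unfolding maps_tuple_def by blast
      then show "p \<in> elts t'" using i(2) Sym_pair[OF g] by auto
    qed
    then show "t' = tuple (map (app g) xs)" by (metis as_set_elts)
  next
    assume t: "t' = tuple (map (app g) xs)"
    show "maps_tuple V g (tuple xs) t'"
      unfolding maps_tuple_def
    proof (intro conjI ballI)
      fix p assume "p \<in> elts (tuple xs)"
      then obtain i where i: "i < length xs" "p = pair (numeral_set i) (xs ! i)"
        by (auto simp: elts_tuple)
      have "pair (xs ! i) (app g (xs ! i)) \<in> elts g"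
        using Sym_pair[OF g] xsV[OF i(1)] by simp
      moreover have "pair (numeral_set i) (app g (xs ! i)) \<in> elts t'"
        using i(1) unfolding t elts_tuple by auto
      ultimately show "\<exists>i\<in>V. \<exists>x\<in>V. \<exists>y\<in>V. p = pair i x \<and> pair x y \<in> elts g \<and> pair i y \<in> elts t'"
        using i(2) xsV[OF i(1)] numeral_mem by blast
    next
      fix p assume "p \<in> elts t'"
      then obtain i where i: "i < length xs" "p = pair (numeral_set i) (app g (xs ! i))"
        by (auto simp: elts_tuple t)
      have "pair (xs ! i) (app g (xs ! i)) \<in> elts g"
        using Sym_pair[OF g] xsV[OF i(1)] by simp
      moreover have "pair (numeral_set i) (xs ! i) \<in> elts (tuple xs)"
        using i(1) unfolding elts_tuple by auto
      ultimately show "\<exists>i\<in>V. \<exists>x\<in>V. \<exists>y\<in>V. p = pair i y \<and> pair x y \<in> elts g \<and> pair i x \<in> elts (tuple xs)"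
        using i(2) xsV[OF i(1)] numeral_mem by blast
    qed
  qed
qed

lemma app_structure_mem:
  assumes "M \<in> \<S>" "has_arity L R n" shows "app M R \<in> V" "R \<in> V"
  using is_structure_app[OF S_structure[OF assms(1)] assms(2), of "app M R"]
    pair_mem_elts[OF _ S_V[OF assms(1)]] by blast+

lemma structure_tuple:
  assumes "M \<in> \<S>" "pair R r \<in> elts M" "t \<in> elts r"
  obtains xs where "t = tuple xs" "(R, xs) \<in> atoms L X" "r = app M R" "sat M (R, xs)"
proof -
  obtain n where n: "has_arity L R n" 
    using S_structure[OF assms(1)] assms(2) unfolding is_structure_def by fastforce
  then have r: "r = app M R" using is_structure_app[OF S_structure[OF assms(1)]] assms(2) by blast
  show ?thesis
    using is_structure_tuple[OF S_structure[OF assms(1)] n] assms(3) r n that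
    unfolding atoms_def sat_def by (metis (no_types, lifting) case_prodI fst_conv mem_Collect_eq snd_conv)
qed

lemma holds_iff:
  assumes "M \<in> \<S>"
  shows "holds V M p \<longleftrightarrow> (\<exists>R xs. (R, xs) \<in> atoms L X \<and> p = pair R (tuple xs) \<and> sat M (R, xs))"
proof
  assume "holds V M p"
  then obtain R t r where "p = pair R t" "pair R r \<in> elts M" "t \<in> elts r"
    unfolding holds_def by blast
  then show "\<exists>R xs. (R, xs) \<in> atoms L X \<and> p = pair R (tuple xs) \<and> sat M (R, xs)"
    using structure_tuple[OF assms] by metis
next
  assume "\<exists>R xs. (R, xs) \<in> atoms L X \<and> p = pair R (tuple xs) \<and> sat M (R, xs)"
  then obtain R xs where *: "has_arity L R (length xs)" "set xs \<subseteq> elts X" "p = pair R (tuple xs)"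
    "tuple xs \<in> elts (app M R)"
    unfolding atoms_def sat_def by auto
  have "pair R (app M R) \<in> elts M"
    using is_structure_app[OF S_structure[OF assms] *(1)] by simp
  then show "holds V M p"
    unfolding holds_def using * X_tuple_mem[OF *(2)] app_structure_mem[OF assms *(1)] by blast
qed

text \<open>The image is formed inside \<open>V\<close> by replacement at two levels: over the
  tuples of each interpretation, then over the interpretations making up \<open>M\<close>.\<close>

lemma image_structure_exists:
  assumes g: "g \<in> Sym V X" and M: "M \<in> \<S>"
  shows "\<exists>N\<in>\<S>. \<forall>a\<in>atoms L X. sat N (move (app g) a) \<longleftrightarrow> sat M a"
proof -
  \<comment> \<open>\<open>inv tuple\<close> decodes a tuple. Outside codes of tuples the value of
    \<open>F\<close> is arbitrary, and no such argument occurs in an interpretation.\<close>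
  define F where "F t = tuple (map (app g) (inv tuple t))" for t :: 'u
  have F: "F (tuple xs) = tuple (map (app g) xs)" for xs
    unfolding F_def by (simp add: inv_f_f inj_def)
  have Fiff: "maps_tuple V g t t' \<longleftrightarrow> t' = F t" and FV: "F t \<in> V"
    if r: "pair R r \<in> elts M" "t \<in> elts r" and t': "t' \<in> V" for R r t t'
  proof -
    obtain xs where "t = tuple xs" "(R, xs) \<in> atoms L X" using structure_tuple[OF M r] by blast
    then show "maps_tuple V g t t' \<longleftrightarrow> t' = F t" "F t \<in> V"
      using maps_tuple_iff[OF g _ t'] X_tuple_mem[OF Sym_map[OF g]] by (auto simp: F atoms_def)
  qed
  have r: "F ` elts r \<in> elts ` V" if "pair R r \<in> elts M" for R r
  proof (rule coded_replacement[where R = "\<lambda>t t'. maps_tuple V g t t'"])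
    show "definable V (\<lambda>e. maps_tuple V g (e 0) (e 1))" by (intro definable_intros Sym_V[OF g])
    show "elts r \<in> elts ` V" using pair_mem_elts[OF that S_V[OF M]] by blast
    show "F t \<in> V" if "t \<in> elts r" for t using FV[OF \<open>pair R r \<in> elts M\<close> that omega_mem] .
    show "maps_tuple V g t t' \<longleftrightarrow> t' = F t" if "t \<in> elts r" "t' \<in> V" for t t'
      using Fiff[OF \<open>pair R r \<in> elts M\<close> that] .
  qed
  define G where "G p = (THE q. \<exists>R r. p = pair R r \<and> q = pair R (as_set (F ` elts r)))" for p
  have G: "G (pair R r) = pair R (as_set (F ` elts r))" for R r
    unfolding G_def by (rule the_equality) auto
  have pM: "\<exists>R r. p = pair R r \<and> R \<in> V \<and> r \<in> V" if "p \<in> elts M" for p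
  proof -
    obtain R r where "p = pair R r" using S_structure[OF M] \<open>p \<in> elts M\<close> unfolding is_structure_def by blast
    then show ?thesis using pair_mem_elts[OF _ S_V[OF M]] that by blast
  qed
  have "G ` elts M \<in> elts ` V"
  proof (rule coded_replacement)
    show "definable V (\<lambda>e. \<exists>R\<in>V. \<exists>r\<in>V. \<exists>r'\<in>V. e 0 = pair R r \<and> e 1 = pair R r' \<and>
        (\<forall>t'\<in>V. t' \<in> elts r' \<longleftrightarrow> (\<exists>t\<in>elts r. maps_tuple V g t t')))"
      by (intro definable_intros Sym_V[OF g])
    show "elts M \<in> elts ` V" using S_V[OF M] by blast
    fix p assume p: "p \<in> elts M"
    then obtain R r where Rr: "p = pair R r" "R \<in> V" "r \<in> V" using pM by blast
    have r': "as_set (F ` elts r) \<in> V" "elts (as_set (F ` elts r)) = F ` elts r"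
      using r[OF p[unfolded Rr(1)]] by (rule as_set_mem elts_as_set_mem)+
    show "G p \<in> V" using Rr r' by (simp add: G)
    have *: "(\<forall>t'\<in>V. t' \<in> elts s \<longleftrightarrow> (\<exists>t\<in>elts r. maps_tuple V g t t')) \<longleftrightarrow> s = as_set (F ` elts r)"
      if s: "s \<in> V" for s
    proof -
      have eq: "(\<exists>t\<in>elts r. maps_tuple V g t t') \<longleftrightarrow> t' \<in> F ` elts r" if "t' \<in> V" for t'
        using Fiff[OF p[unfolded Rr(1)] _ that] by blast
      have "F ` elts r \<subseteq> V" using FV[OF p[unfolded Rr(1)] _ omega_mem] by blast
      then have "(\<forall>t'\<in>V. t' \<in> elts s \<longleftrightarrow> t' \<in> F ` elts r) \<longleftrightarrow> elts s = F ` elts r"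
        by (metis elts_eqI[OF s])
      also have "\<dots> \<longleftrightarrow> s = as_set (F ` elts r)" using r'(2) as_set_elts[of s] by metis
      finally show ?thesis using eq by simp
    qed
    show "(\<exists>R\<in>V. \<exists>r\<in>V. \<exists>r'\<in>V. p = pair R r \<and> q = pair R r' \<and>
        (\<forall>t'\<in>V. t' \<in> elts r' \<longleftrightarrow> (\<exists>t\<in>elts r. maps_tuple V g t t'))) \<longleftrightarrow> q = G p" for q
    proof -
      have "(\<exists>R\<in>V. \<exists>r\<in>V. \<exists>r'\<in>V. p = pair R r \<and> q = pair R r' \<and>
        (\<forall>t'\<in>V. t' \<in> elts r' \<longleftrightarrow> (\<exists>t\<in>elts r. maps_tuple V g t t'))) \<longleftrightarrow>
        (\<exists>r'\<in>V. q = pair R r' \<and> (\<forall>t'\<in>V. t' \<in> elts r' \<longleftrightarrow> (\<exists>t\<in>elts r. maps_tuple V g t t')))"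
        using Rr by simp
      also have "\<dots> \<longleftrightarrow> q = pair R (as_set (F ` elts r))" using * r'(1) by blast
      finally show ?thesis by (simp add: Rr(1) G)
    qed
  qed
  then obtain N where N: "N \<in> V" "elts N = G ` elts M" by blast
  have pN: "pair R s \<in> elts N \<longleftrightarrow> s = as_set (F ` elts (app M R))" if "has_arity L R n" for R s n
  proof -
    have "pair R s \<in> elts N \<longleftrightarrow> (\<exists>r. pair R r \<in> elts M \<and> s = as_set (F ` elts r))"
    proof
      assume "pair R s \<in> elts N"
      then obtain p where "p \<in> elts M" "pair R s = G p" unfolding N(2) by blast
      moreover from this obtain R' r where "p = pair R' r" using pM by blast
      ultimately show "\<exists>r. pair R r \<in> elts M \<and> s = as_set (F ` elts r)" by (auto simp: G)
    next
      assume "\<exists>r. pair R r \<in> elts M \<and> s = as_set (F ` elts r)"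
      then show "pair R s \<in> elts N" unfolding N(2) using G by (metis imageI)
    qed
    then show ?thesis using is_structure_app[OF S_structure[OF M] that] by simp
  qed
  have appN: "app N R = as_set (F ` elts (app M R))" if "has_arity L R n" for R n
    unfolding app_def by (rule the_equality) (use pN[OF that] in \<open>simp_all add: app_def\<close>)
  have eltsN: "elts (app N R) = F ` elts (app M R)" if "has_arity L R n" for R n
    unfolding appN[OF that]
    using r[of R "app M R"] is_structure_app[OF S_structure[OF M] that] by (intro elts_as_set_mem) blast
  have "is_structure L X N"
    unfolding is_structure_def
  proof (intro conjI allI impI ballI)
    fix q assume "q \<in> elts N"
    then obtain p where p: "p \<in> elts M" "q = G p" unfolding N(2) by blast
    then obtain R n r where "has_arity L R n" "p = pair R r"
      using S_structure[OF M] unfolding is_structure_def by blast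
    then show "\<exists>R n r. has_arity L R n \<and> q = pair R r" using p(2) G by metis
  next
    fix R n assume R: "has_arity L R n"
    show "\<exists>!r. pair R r \<in> elts N" using pN[OF R] by simp
    show "elts (app N R) \<subseteq> {tuple xs |xs. length xs = n \<and> set xs \<subseteq> elts X}"
    proof
      fix t' assume "t' \<in> elts (app N R)"
      then obtain t where t: "t \<in> elts (app M R)" "t' = F t" unfolding eltsN[OF R] by blast
      then obtain xs where "t = tuple xs" "length xs = n" "set xs \<subseteq> elts X"
        using is_structure_tuple[OF S_structure[OF M] R] by blast
      then show "t' \<in> {tuple xs |xs. length xs = n \<and> set xs \<subseteq> elts X}"
        using t(2) Sym_map[OF g, of xs] by (auto simp: F intro!: exI[of _ "map (app g) xs"])
    qed
  qed
  then have NS: "N \<in> \<S>" using N(1) unfolding Str_def by blast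
  have "sat N (move (app g) a) \<longleftrightarrow> sat M a" if a: "a \<in> atoms L X" for a
  proof -
    obtain R xs where Rxs: "a = (R, xs)" "has_arity L R (length xs)" "set xs \<subseteq> elts X"
      using a unfolding atoms_def by auto
    have "sat N (move (app g) a) \<longleftrightarrow> F (tuple xs) \<in> F ` elts (app M R)"
      unfolding sat_def move_def Rxs(1) fst_conv snd_conv eltsN[OF Rxs(2)] F ..
    also have "\<dots> \<longleftrightarrow> tuple xs \<in> elts (app M R)"
    proof
      assume "F (tuple xs) \<in> F ` elts (app M R)"
      then obtain t where t: "t \<in> elts (app M R)" "F (tuple xs) = F t" by blast
      then obtain ys where ys: "t = tuple ys" "set ys \<subseteq> elts X"
        using is_structure_tuple[OF S_structure[OF M] Rxs(2)] by blast
      then have "map (app g) xs = map (app g) ys" using t(2) by (simp add: F)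
      then have "xs = ys" 
        using Sym_app_inj[OF g] Rxs(3) ys(2) by (metis inj_on_map_eq_map inj_on_subset le_sup_iff)
      then show "tuple xs \<in> elts (app M R)" using t ys by simp
    qed blast
    finally show ?thesis by (simp add: sat_def Rxs(1))
  qed
  then show ?thesis using NS by blast
qed

lemma move_atoms: "g \<in> Sym V X \<Longrightarrow> a \<in> atoms L X \<Longrightarrow> move (app g) a \<in> atoms L X"
  unfolding atoms_def move_def using Sym_app_mem by auto

lemma atoms_move_surj:
  assumes g: "g \<in> Sym V X" and b: "b \<in> atoms L X"
  obtains a where "a \<in> atoms L X" "b = move (app g) a"
proof -
  obtain R ys where R: "b = (R, ys)" "has_arity L R (length ys)" "set ys \<subseteq> elts X"
    using b unfolding atoms_def by auto
  have "ys \<in> lists (app g ` elts X)" using R(3) Sym_app_surj[OF g] by auto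
  then obtain xs where "xs \<in> lists (elts X)" "ys = map (app g) xs" unfolding lists_image by blast
  then show ?thesis using R that[of "(R, xs)"] unfolding atoms_def move_def by auto
qed

text \<open>The description is unique because every atom is the translate of an atom, so all truth
  values of the image are prescribed.\<close>

lemma act_eqI:
  assumes g: "g \<in> Sym V X" and M: "M \<in> \<S>" and N: "N \<in> \<S>"
    and eq: "\<And>a. a \<in> atoms L X \<Longrightarrow> sat N (move (app g) a) \<longleftrightarrow> sat M a"
  shows "act L X g M = N"
  unfolding act_def
proof (rule the_equality)
  show "is_structure L X N \<and> (\<forall>R n xs. has_arity L R n \<longrightarrow> length xs = n \<longrightarrow> set xs \<subseteq> elts X \<longrightarrow>
        (tuple (map (app g) xs) \<in> elts (app N R)) = (tuple xs \<in> elts (app M R)))"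
    using S_structure[OF N] eq unfolding sat_def move_def atoms_def by fastforce
  fix N' assume N': "is_structure L X N' \<and> (\<forall>R n xs. has_arity L R n \<longrightarrow> length xs = n \<longrightarrow> set xs \<subseteq> elts X \<longrightarrow>
        (tuple (map (app g) xs) \<in> elts (app N' R)) = (tuple xs \<in> elts (app M R)))"
  show "N' = N"
  proof (rule structure_eqI[OF _ S_structure[OF N]])
    fix b assume b: "b \<in> atoms L X"
    then obtain a where a: "a \<in> atoms L X" "b = move (app g) a" using atoms_move_surj[OF g] by blast
    have "sat N' b \<longleftrightarrow> sat M a" using N' a unfolding sat_def move_def atoms_def by auto
    then show "sat N' b \<longleftrightarrow> sat N b" using eq[OF a(1)] a(2) by simp
  qed (use N' in blast)
qed

lemma act_mem: "g \<in> Sym V X \<Longrightarrow> M \<in> \<S> \<Longrightarrow> act L X g M \<in> \<S>"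
  and sat_act: "g \<in> Sym V X \<Longrightarrow> M \<in> \<S> \<Longrightarrow> a \<in> atoms L X \<Longrightarrow>
    sat (act L X g M) (move (app g) a) \<longleftrightarrow> sat M a"
  using image_structure_exists[of g M] act_eqI[of g M] by metis+

lemma Sym_inverse:
  assumes g: "g \<in> Sym V X"
  obtains g' where "g' \<in> Sym V X" "\<And>x. x \<in> elts X \<Longrightarrow> app g' (app g x) = x" "\<And>x. x \<in> elts X \<Longrightarrow> app g (app g' x) = x"
proof -
  have b: "bij_betw (app g) (elts X) (elts X)" using g unfolding Sym_def by blast
  define F where "F = inv_into (elts X) (app g)"
  have F: "bij_betw F (elts X) (elts X)" unfolding F_def by (rule bij_betw_inv_into[OF b])
  have FX: "F x \<in> elts X" if "x \<in> elts X" for x using F that bij_betwE by blast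
  have Fg: "app g (F x) = x" "F (app g x) = x" if "x \<in> elts X" for x
    using b that unfolding F_def by (simp_all add: bij_betw_inv_into_left bij_betw_inv_into_right)
  have "\<exists>f\<in>V. function_on f (elts X) \<and> (\<forall>x\<in>elts X. app f x = F x) \<and> elts f = {pair x (F x) |x. x \<in> elts X}"
  proof (rule function_exists[OF _ elts_image[OF X]])
    show "definable V (\<lambda>e. pair (e 1) (e 0) \<in> elts g)" by (intro definable_intros Sym_V[OF g])
    fix x assume x: "x \<in> elts X"
    show "F x \<in> V" using FX[OF x] elts_mem[OF X] by blast
    show "pair y x \<in> elts g \<longleftrightarrow> y = F x" for y
      using Sym_pair[OF g] Fg[OF x] Fg(2)[of y] FX[OF x] by auto
  qed
  then obtain f where f: "f \<in> V" "function_on f (elts X)" "\<And>x. x \<in> elts X \<Longrightarrow> app f x = F x" by blast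
  have "bij_betw (app f) (elts X) (elts X)"
    by (rule iffD1[OF bij_betw_cong F]) (simp add: f)
  then have "f \<in> Sym V X" using f unfolding Sym_def by blast
  then show ?thesis using that Fg f(3) Sym_app_mem[OF g] by simp
qed

lemma act_inverse:
  assumes g: "g \<in> Sym V X" and g': "g' \<in> Sym V X" "\<And>x. x \<in> elts X \<Longrightarrow> app g' (app g x) = x"
    and M: "M \<in> \<S>"
  shows "act L X g' (act L X g M) = M"
proof (rule act_eqI[OF g'(1) act_mem[OF g M] M])
  fix b assume "b \<in> atoms L X"
  then obtain a where a: "a \<in> atoms L X" "b = move (app g) a" using atoms_move_surj[OF g] by blast
  have "map (app g') (map (app g) (snd a)) = snd a"
    using a(1) g'(2) unfolding atoms_def by (auto intro!: map_idI)
  then have "move (app g') b = a" unfolding a(2) move_def by simp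
  then show "sat M (move (app g') b) \<longleftrightarrow> sat (act L X g M) b"
    using sat_act[OF g M a(1)] a(2) by simp
qed

lemma act_bij:
  assumes g: "g \<in> Sym V X" shows "bij_betw (act L X g) \<S> \<S>"
proof -
  obtain g' where "g' \<in> Sym V X" "\<And>x. x \<in> elts X \<Longrightarrow> app g' (app g x) = x" "\<And>x. x \<in> elts X \<Longrightarrow> app g (app g' x) = x"
    using Sym_inverse[OF g] by blast
  then show ?thesis
    by (intro bij_betw_byWitness[where f' = "act L X g'"]) (use act_inverse g act_mem in auto)
qed

lemma act_inj: "g \<in> Sym V X \<Longrightarrow> inj_on (act L X g) \<S>"
  using act_bij unfolding bij_betw_def by blast

lemma act_surj: "g \<in> Sym V X \<Longrightarrow> act L X g ` \<S> = \<S>"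
  using act_bij unfolding bij_betw_def by blast

text \<open>An atom holds in \<open>M\<close> iff its translate holds in the image of
  \<open>M\<close>. So the image of a clopen set is clopen, and its description involves
  \<open>g\<close> only through finitely many values when \<open>I\<close> is finite; this is the
  source of absoluteness.\<close>

lemma act_clopen:
  assumes g: "g \<in> Sym V X" and I: "I \<subseteq> atoms L X"
  shows "act L X g ` clo I Q = clo (move (app g) ` I) (\<lambda>S. Q {a \<in> I. move (app g) a \<in> S})"
proof -
  have *: "{a \<in> I. move (app g) a \<in> {b \<in> move (app g) ` I. sat (act L X g M) b}} = {a \<in> I. sat M a}"
    if "M \<in> \<S>" for M
    using sat_act[OF g that] I by auto
  show ?thesis
  proof (intro subset_antisym subsetI)
    fix N assume "N \<in> act L X g ` clo I Q"
    then show "N \<in> clo (move (app g) ` I) (\<lambda>S. Q {a \<in> I. move (app g) a \<in> S})"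
      using act_mem[OF g] * unfolding clopen_set_def by auto
  next
    fix N assume N: "N \<in> clo (move (app g) ` I) (\<lambda>S. Q {a \<in> I. move (app g) a \<in> S})"
    then have "N \<in> act L X g ` \<S>" unfolding act_surj[OF g] clopen_set_def by blast
    then obtain M where M: "M \<in> \<S>" "N = act L X g M" by blast
    then have "M \<in> clo I Q" using N *[OF M(1)] unfolding clopen_set_def by simp
    then show "N \<in> act L X g ` clo I Q" using M(2) by blast
  qed
qed

lemma maps_structure_iff:
  assumes g: "g \<in> Sym V X" and M: "M \<in> \<S>" and N: "N \<in> \<S>"
  shows "maps_structure V g M N \<longleftrightarrow> N = act L X g M"
proof
  assume *: "maps_structure V g M N"
  have "sat N (move (app g) a) \<longleftrightarrow> sat M a" if a: "a \<in> atoms L X" for a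
  proof -
    obtain R xs where Rxs: "a = (R, xs)" "has_arity L R (length xs)" "set xs \<subseteq> elts X"
      using a unfolding atoms_def by auto
    have RM: "pair R (app M R) \<in> elts M" "pair R (app N R) \<in> elts N"
      using is_structure_app[OF S_structure Rxs(2)] M N by blast+
    note V = app_structure_mem[OF M Rxs(2)] app_structure_mem[OF N Rxs(2)]
    have 1: "\<exists>t'\<in>elts (app N R). maps_tuple V g t t'" if "t \<in> elts (app M R)" for t
      using * RM V that unfolding maps_structure_def by blast
    have 2: "\<exists>t\<in>elts (app M R). maps_tuple V g t t'" if "t' \<in> elts (app N R)" for t'
      using * RM V that unfolding maps_structure_def by blast
    show ?thesis
    proof
      assume "sat N (move (app g) a)"
      then have t': "tuple (map (app g) xs) \<in> elts (app N R)" by (simp add: sat_def move_def Rxs(1))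
      from 2[OF t'] obtain t where t: "t \<in> elts (app M R)" "maps_tuple V g t (tuple (map (app g) xs))" by blast
      from is_structure_tuple[OF S_structure[OF M] Rxs(2) t(1)] obtain ys where
        ys: "t = tuple ys" "set ys \<subseteq> elts X" by blast
      have "tuple (map (app g) xs) = tuple (map (app g) ys)"
        using maps_tuple_iff[OF g ys(2) elts_mem[OF V(3) t']] t(2) ys(1) by simp
      then have "xs = ys" 
        using Sym_app_inj[OF g] Rxs(3) ys(2) by (metis inj_on_map_eq_map inj_on_subset le_sup_iff tuple_inject)
      then show "sat M a" using t(1) ys(1) by (simp add: sat_def Rxs(1))
    next
      assume "sat M a"
      then have t: "tuple xs \<in> elts (app M R)" by (simp add: sat_def Rxs(1))
      from 1[OF t] obtain t' where t': "t' \<in> elts (app N R)" "maps_tuple V g (tuple xs) t'" by blast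
      then have "t' = tuple (map (app g) xs)"
        using maps_tuple_iff[OF g Rxs(3) elts_mem[OF V(3) t'(1)]] by simp
      then show "sat N (move (app g) a)" using t'(1) by (simp add: sat_def move_def Rxs(1))
    qed
  qed
  then show "N = act L X g M" using act_eqI[OF g M N] by simp
next
  assume N': "N = act L X g M"
  show "maps_structure V g M N"
    unfolding maps_structure_def
  proof (intro ballI impI conjI)
    fix R r r' t assume r: "r \<in> V" "r' \<in> V" "pair R r \<in> elts M" "pair R r' \<in> elts N" and t: "t \<in> elts r"
    obtain xs where xs: "t = tuple xs" "(R, xs) \<in> atoms L X" "sat M (R, xs)"
      using structure_tuple[OF M r(3) t] by blast
    then have "sat N (move (app g) (R, xs))" using sat_act[OF g M] N' by simp
    moreover have "r' = app N R"
      using is_structure_app[OF S_structure[OF N]] r(4) xs(2) unfolding atoms_def by blast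
    ultimately have t': "tuple (map (app g) xs) \<in> elts r'" by (simp add: sat_def move_def)
    then show "\<exists>t'\<in>elts r'. maps_tuple V g t t'"
      using maps_tuple_iff[OF g _ elts_mem[OF r(2) t']] xs(1,2) unfolding atoms_def by blast
  next
    fix R r r' t' assume r: "r \<in> V" "r' \<in> V" "pair R r \<in> elts M" "pair R r' \<in> elts N" and t': "t' \<in> elts r'"
    obtain ys where ys: "t' = tuple ys" "(R, ys) \<in> atoms L X" "sat N (R, ys)"
      using structure_tuple[OF N r(4) t'] by blast
    then obtain a where a: "a \<in> atoms L X" "(R, ys) = move (app g) a" using atoms_move_surj[OF g] by blast
    then have "sat M a" using ys(3) sat_act[OF g M a(1)] N' by simp
    obtain xs where xs: "a = (R, xs)" "ys = map (app g) xs" "set xs \<subseteq> elts X"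
      using a unfolding move_def atoms_def by auto
    have "r = app M R"
      using is_structure_app[OF S_structure[OF M]] r(3) ys(2) unfolding atoms_def by blast
    then have "tuple xs \<in> elts r" using \<open>sat M a\<close> by (simp add: sat_def xs(1))
    then show "\<exists>t\<in>elts r. maps_tuple V g t t'"
      using maps_tuple_iff[OF g xs(3) elts_mem[OF r(2) t']] ys(1) xs(2) by blast
  qed
qed

lemma act_image_coded:
  assumes g: "g \<in> Sym V X" and A: "A \<in> elts ` V" "A \<subseteq> \<S>"
  shows "act L X g ` A \<in> elts ` V"
proof (rule coded_replacement[OF _ A(1)])
  show "definable V (\<lambda>e. e 1 \<in> elts (as_set \<S>) \<and> maps_structure V g (e 0) (e 1))"
    by (intro definable_intros S_mem Sym_V[OF g])
  fix M assume "M \<in> A"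
  then have M: "M \<in> \<S>" using A(2) by blast
  show "act L X g M \<in> V" using S_V act_mem[OF g M] by blast
  show "(N \<in> elts (as_set \<S>) \<and> maps_structure V g M N) \<longleftrightarrow> N = act L X g M" for N
    using maps_structure_iff[OF g M] act_mem[OF g M] by auto
qed

lemma maps_set_iff:
  assumes g: "g \<in> Sym V X" and A: "A \<in> elts ` V" "A \<subseteq> \<S>" and D: "D \<in> V"
  shows "maps_set V (as_set \<S>) g (as_set A) D \<longleftrightarrow> D = as_set (act L X g ` A)"
proof -
  have eA: "elts (as_set A) = A" using elts_as_set_mem[OF A(1)] .
  have "N \<in> \<S> \<and> (\<exists>M\<in>A. maps_structure V g M N) \<longleftrightarrow> N \<in> act L X g ` A" for N
    using maps_structure_iff[OF g] A(2) act_mem[OF g] by blast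
  then have "maps_set V (as_set \<S>) g (as_set A) D \<longleftrightarrow> (\<forall>N\<in>V. N \<in> elts D \<longleftrightarrow> N \<in> act L X g ` A)"
    unfolding maps_set_def eA elts_S by blast
  also have "\<dots> \<longleftrightarrow> elts D = act L X g ` A"
    using elts_eqI[OF D, of "act L X g ` A"] coded_subset[OF act_image_coded[OF g A]] by metis
  also have "\<dots> \<longleftrightarrow> D = as_set (act L X g ` A)"
    using elts_as_set_mem[OF act_image_coded[OF g A]] as_set_elts[of D] by metis
  finally show ?thesis .
qed

end

section \<open>Measures on the space of structures\<close>

abbreviation symdiff :: "'a set \<Rightarrow> 'a set \<Rightarrow> 'a set" where
  "symdiff A B \<equiv> (A - B) \<union> (B - A)"

context set_model
begin

lemma coded_eq_iff:
  assumes "C \<in> elts ` V" "y \<in> V"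
  shows "(\<forall>N\<in>V. N \<in> elts y \<longleftrightarrow> N \<in> C) \<longleftrightarrow> y = as_set C"
proof -
  have "(\<forall>N\<in>V. N \<in> elts y \<longleftrightarrow> N \<in> C) \<longleftrightarrow> elts y = C"
    by (metis elts_eqI[OF assms(2)] coded_subset[OF assms(1)])
  also have "\<dots> \<longleftrightarrow> y = as_set C" using elts_as_set_mem[OF assms(1)] as_set_elts[of y] by metis
  finally show ?thesis .
qed

lemma size_le_subset:
  assumes "F \<in> V" "size_le V F k" "G \<in> V" "elts G \<subseteq> elts F" "k \<in> V"
  shows "size_le V G k"
proof -
  obtain h where h: "h \<in> V" "function_on h (elts F)" "app h ` elts F \<subseteq> elts k" "inj_on (app h) (elts F)"
    using assms(2) unfolding size_le_def by blast
  have "\<exists>f\<in>V. function_on f (elts G) \<and> (\<forall>x\<in>elts G. app f x = app h x) \<and> elts f = {pair x (app h x) |x. x \<in> elts G}"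
  proof (rule function_exists[OF _ elts_image[OF assms(3)]])
    show "definable V (\<lambda>e. pair (e 0) (e 1) \<in> elts h)" by (intro definable_intros h)
    fix x assume x: "x \<in> elts G"
    then have xF: "x \<in> elts F" using assms(4) by blast
    show "app h x \<in> V" using h(3) elts_mem[OF assms(5)] xF by blast
    show "pair x y \<in> elts h \<longleftrightarrow> y = app h x" for y by (rule function_on_iff[OF h(2) xF])
  qed
  then obtain f where f: "f \<in> V" "function_on f (elts G)" "\<forall>x\<in>elts G. app f x = app h x" by blast
  show ?thesis
    using f h(3,4) assms(4) by (intro size_leI[OF f(1,2)]) (auto simp: inj_on_def subset_iff)
qed

end

section \<open>Values of measures as cuts, and clopen sets as seen by the model\<close>

lemma codes_real_unique:
  assumes "codes_real (y :: 'u::set_universe) r" "codes_real y s"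
  shows "r = s"
proof -
  have *: False if r: "codes_real y r" and s: "codes_real y s" and rs: "r < s" for r s
  proof -
    obtain q where q: "q \<in> \<rat>" "r < q" "q < s" using Rats_dense_in_real[OF rs] by blast
    obtain m n where mn: "q = real_of_int m / real n" "n \<noteq> 0"
      using q(1) unfolding Rats_eq_int_div_nat by auto
    \<comment> \<open>Numerators are differences of natural numbers; here one of \<open>a\<close>
      and \<open>b\<close> is 0, according to the sign of the integer.\<close>
    define a b where "a = nat m" and "b = nat (- m)"
    have ab: "(real a - real b) / real n = q"
      unfolding mn(1) a_def b_def by (cases "m \<ge> 0") auto
    have "pair (numeral_set a) (pair (numeral_set b) (numeral_set n)) \<in> elts y"
      using s q ab mn(2) unfolding codes_real_def by blast
    then obtain a' b' c' where "pair (numeral_set a) (pair (numeral_set b) (numeral_set n)) =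
      (pair (numeral_set a') (pair (numeral_set b') (numeral_set c')) :: 'u)" "(real a' - real b') / real c' < r"
      using r unfolding codes_real_def by blast
    then show False using ab q by simp
  qed
  show ?thesis using *[of r s] *[of s r] assms by argo
qed

lemma val_eq: "codes_real (app \<mu> (as_set A)) r \<Longrightarrow> val \<mu> A = r"
  unfolding val_def using codes_real_unique by blast

definition rational :: "nat \<Rightarrow> nat \<Rightarrow> nat \<Rightarrow> 'u::set_universe" where
  "rational a b c = pair (numeral_set a) (pair (numeral_set b) (numeral_set c))"

text \<open>The model reaches a measure only through its cut: for a measurable \<open>x\<close> this
  says that \<open>q\<close> codes a rational smaller than the measure of \<open>x\<close>.\<close>

definition below :: "'u::set_universe set \<Rightarrow> 'u \<Rightarrow> 'u \<Rightarrow> 'u \<Rightarrow> bool" where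
  "below V \<mu> x q \<longleftrightarrow> (\<exists>z\<in>V. pair x z \<in> elts \<mu> \<and> q \<in> elts z)"

text \<open>Quantification over predicates \<open>Q\<close> is not first-order; it is replaced by
  the statement that finitely many coded atoms decide membership. Elements of \<open>H\<close> that
  code no atom do no harm, as they hold in no structure.\<close>

definition is_clopen :: "'u::set_universe set \<Rightarrow> 'u \<Rightarrow> 'u \<Rightarrow> bool" where
  "is_clopen V S C \<longleftrightarrow> (\<forall>N\<in>elts C. N \<in> elts S) \<and> (\<exists>H\<in>V. finite (elts H) \<and>
     (\<forall>N\<in>elts S. \<forall>N'\<in>elts S. (\<forall>p\<in>elts H. holds V N p \<longleftrightarrow> holds V N' p) \<longrightarrow> (N \<in> elts C \<longleftrightarrow> N' \<in> elts C)))"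

definition is_agreement :: "'u::set_universe set \<Rightarrow> 'u \<Rightarrow> 'u \<Rightarrow> 'u \<Rightarrow> 'u \<Rightarrow> bool" where
  "is_agreement V S A B D \<longleftrightarrow> (\<forall>N\<in>V. N \<in> elts D \<longleftrightarrow> N \<in> elts S \<and> (N \<in> elts A \<longleftrightarrow> N \<in> elts B))"

context set_model
begin

lemma definable_below [definable_intros]:
  assumes "definable_term V \<mu>" "definable_term V x" "definable_term V q"
  shows "definable V (\<lambda>e. below V (\<mu> e) (x e) (q e))"
proof (rule definable_subst3[OF _ assms])
  show "definable V (\<lambda>e. below V (e 0) (e 1) (e 2))"
    unfolding below_def by (intro definable_intros)
qed

lemma definable_is_clopen [definable_intros]:
  assumes "definable_term V S" "definable_term V C"
  shows "definable V (\<lambda>e. is_clopen V (S e) (C e))"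
proof (rule definable_subst2[OF _ assms])
  show "definable V (\<lambda>e. is_clopen V (e 0) (e 1))"
    unfolding is_clopen_def by (intro definable_intros)
qed

lemma definable_is_agreement [definable_intros]:
  assumes "definable_term V S" "definable_term V A" "definable_term V B" "definable_term V D"
  shows "definable V (\<lambda>e. is_agreement V (S e) (A e) (B e) (D e))"
proof (rule definable_subst4[OF _ assms])
  show "definable V (\<lambda>e. is_agreement V (e 0) (e 1) (e 2) (e 3))"
    unfolding is_agreement_def by (intro definable_intros)
qed

end

lemma (in structure_space) is_clopen_iff:
  assumes C: "C \<in> V"
  shows "is_clopen V (as_set \<S>) C \<longleftrightarrow>
    (\<exists>I Q. finite I \<and> I \<subseteq> atoms L X \<and> elts C = clo I Q)"
proof
  assume "is_clopen V (as_set \<S>) C"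
  then obtain H where CS: "elts C \<subseteq> \<S>" and H: "H \<in> V" "finite (elts H)" and
    det: "\<And>N N'. N \<in> \<S> \<Longrightarrow> N' \<in> \<S> \<Longrightarrow> (\<forall>p\<in>elts H. holds V N p \<longleftrightarrow> holds V N' p) \<Longrightarrow> (N \<in> elts C \<longleftrightarrow> N' \<in> elts C)"
    unfolding is_clopen_def elts_S by blast
  define I where "I = {a \<in> atoms L X. pair (fst a) (tuple (snd a)) \<in> elts H}"
  have "inj_on (\<lambda>a. pair (fst a) (tuple (snd a))) I" by (auto simp: inj_on_def prod_eq_iff)
  moreover have "(\<lambda>a. pair (fst a) (tuple (snd a))) ` I \<subseteq> elts H" by (auto simp: I_def)
  ultimately have fin: "finite I" using H(2) by (metis finite_imageD finite_subset)
  have holds_I: "holds V N p \<longleftrightarrow> (\<exists>a\<in>I. p = pair (fst a) (tuple (snd a)) \<and> sat N a)"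
    if "p \<in> elts H" "N \<in> \<S>" for N p
    unfolding holds_iff[OF that(2)] using that(1) by (auto simp: I_def)
  have eq: "N \<in> elts C \<longleftrightarrow> N' \<in> elts C" if "N \<in> \<S>" "N' \<in> \<S>" "{a\<in>I. sat N a} = {a\<in>I. sat N' a}" for N N'
  proof (rule det[OF that(1,2)], rule ballI)
    fix p assume p: "p \<in> elts H"
    have "sat N a \<longleftrightarrow> sat N' a" if "a \<in> I" for a using that \<open>{a\<in>I. sat N a} = {a\<in>I. sat N' a}\<close> by blast
    then show "holds V N p \<longleftrightarrow> holds V N' p"
      unfolding holds_I[OF p that(1)] holds_I[OF p that(2)] by blast
  qed
  \<comment> \<open>\<open>Q\<close> is recovered as the collection of traces on \<open>I\<close> of
    the members of \<open>C\<close>.\<close>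
  have "elts C = clo I (\<lambda>S. \<exists>N\<in>elts C. {a\<in>I. sat N a} = S)"
    unfolding clopen_set_def using eq CS by blast
  then show "\<exists>I Q. finite I \<and> I \<subseteq> atoms L X \<and> elts C = clo I Q"
    using fin I_def by blast
next
  assume "\<exists>I Q. finite I \<and> I \<subseteq> atoms L X \<and> elts C = clo I Q"
  then obtain I Q where I: "finite I" "I \<subseteq> atoms L X" "elts C = clo I Q" by blast
  have IV: "pair (fst a) (tuple (snd a)) \<in> V" if "a \<in> I" "M \<in> \<S>" for a M
  proof -
    have a: "has_arity L (fst a) (length (snd a))" "set (snd a) \<subseteq> elts X"
      using that(1) I(2) unfolding atoms_def by fastforce+
    show ?thesis using X_tuple_mem[OF a(2)] app_structure_mem[OF that(2) a(1)] by simp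
  qed
  show "is_clopen V (as_set \<S>) C"
  \<comment> \<open>That the codes of the atoms in \<open>I\<close> belong to \<open>V\<close> is
    read off from a structure. If there is none, the set is empty and the empty \<open>H\<close>
    works.\<close>
  proof (cases "\<S> = {}")
    case True
    then show ?thesis unfolding is_clopen_def elts_S
      using I(3) by (auto simp: clopen_set_def intro!: bexI[OF _ numeral_mem[of 0]])
  next
    case False
    then have "(\<lambda>a. pair (fst a) (tuple (snd a))) ` I \<in> elts ` V"
      using IV I(1) by (intro coded_finite) auto
    then obtain H where H: "H \<in> V" "elts H = (\<lambda>a. pair (fst a) (tuple (snd a))) ` I" by blast
    show ?thesis unfolding is_clopen_def elts_S
    proof (intro conjI ballI bexI[OF _ H(1)] impI)
      show "N \<in> \<S>" if "N \<in> elts C" for N using that I(3) unfolding clopen_set_def by blast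
      show "finite (elts H)" using H(2) I(1) by simp
      fix N N' assume N: "N \<in> \<S>" "N' \<in> \<S>" and eq: "\<forall>p\<in>elts H. holds V N p \<longleftrightarrow> holds V N' p"
      have "sat M a \<longleftrightarrow> holds V M (pair (fst a) (tuple (snd a)))" if "M \<in> \<S>" "a \<in> I" for a M
        unfolding holds_iff[OF that(1)] using that(2) I(2) by auto
      then have "{a\<in>I. sat N a} = {a\<in>I. sat N' a}" using eq H(2) N by auto
      then show "N \<in> elts C \<longleftrightarrow> N' \<in> elts C" unfolding I(3) clopen_set_def using N by simp
    qed
  qed
qed

locale kappa_measure = set_model V for V :: "'u::set_universe set" +
  fixes \<kappa> L X \<mu> :: 'u
  assumes kappa: "\<kappa> \<in> V" "ordinal \<kappa>" "infinite (elts \<kappa>)"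
    and X_mem: "X \<in> V" and X_infinite: "infinite (elts X)"
    and measure: "probability_kappa_measure V \<kappa> L X \<mu>"
begin

section \<open>The measurable sets of one model\<close>

abbreviation "ms \<equiv> measurable_sets V \<kappa> L X"
abbreviation "m \<equiv> val \<mu>"

lemma mu: "\<mu> \<in> V" "function_on \<mu> (as_set ` ms)"
  using measure unfolding probability_kappa_measure_def by blast+

text \<open>Otherwise every set would be measurable and \<open>\<mu>\<close> would belong to its own domain.\<close>

lemma closed_family_exists: "\<exists>S. closed_family V \<kappa> L X S"
proof (rule ccontr)
  assume "\<not> ?thesis"
  then have "ms = UNIV" unfolding measurable_sets_def by blast
  then have "\<mu> \<in> as_set ` ms" by (metis as_set_elts UNIV_I imageI)
  then obtain y where y: "pair \<mu> y \<in> elts \<mu>"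
    using mu(2) unfolding function_on_def by blast
  define a where "a = as_set {\<mu>}"
  have a: "elts a = {\<mu>}" "a \<in> elts (pair \<mu> y)"
    unfolding a_def by (auto simp: elts_as_set_finite elts_pair)
  obtain z where "z \<in> {\<mu>, a, pair \<mu> y}" "\<And>w. w \<in> elts z \<Longrightarrow> w \<notin> {\<mu>, a, pair \<mu> y}"
    using wfE_min[OF wf_elts, of \<mu> "{\<mu>, a, pair \<mu> y}"] by auto
  then show False using y a by auto
qed

lemma ms_closed: "A \<in> ms \<Longrightarrow> closed_family V \<kappa> L X S \<Longrightarrow> A \<in> elts ` elts S"
  unfolding measurable_sets_def by blast

lemma ms_coded: "A \<in> ms \<Longrightarrow> A \<in> elts ` V" and ms_subset: "A \<in> ms \<Longrightarrow> A \<subseteq> Str V L X"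
proof -
  assume A: "A \<in> ms"
  obtain S where S: "closed_family V \<kappa> L X S" using closed_family_exists by blast
  have SV: "S \<in> V" and sub: "\<And>a. a \<in> elts S \<Longrightarrow> elts a \<subseteq> Str V L X"
    using S unfolding closed_family_def by blast+
  obtain a where a: "a \<in> elts S" "A = elts a" using ms_closed[OF A S] by blast
  show "A \<in> elts ` V" using a elts_mem[OF SV] by blast
  show "A \<subseteq> Str V L X" using sub a by blast
qed

lemma ms_cylinder: "set xs \<subseteq> elts X \<Longrightarrow> is_literal L (length xs) p \<Longrightarrow> cylinder V L X [p] xs \<in> ms"
  unfolding measurable_sets_def closed_family_def by simp

lemma ms_Str: "Str V L X \<in> ms"
proof -
  obtain x where "x \<in> elts X" using X_infinite by (metis finite.emptyI ex_in_conv)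
  then have "cylinder V L X [Eql 0 0] [x] \<in> ms" by (intro ms_cylinder) auto
  then show ?thesis by (simp add: cylinder_def)
qed

sublocale structure_space V L X
  by unfold_locales (rule X_mem ms_coded[OF ms_Str])+

lemma ms_compl: 
  assumes "A \<in> ms" shows "\<S> - A \<in> ms"
  unfolding measurable_sets_def
proof (intro CollectI allI impI)
  fix S assume S: "closed_family V \<kappa> L X S"
  obtain a where a: "a \<in> elts S" "A = elts a" using ms_closed[OF assms S] by blast
  show "\<S> - A \<in> elts ` elts S" using S a unfolding closed_family_def by blast
qed

lemma ms_Union:
  assumes "F \<in> V" "size_le V F \<kappa>" "\<And>a. a \<in> elts F \<Longrightarrow> elts a \<in> ms"
  shows "(\<Union>a\<in>elts F. elts a) \<in> ms"
  unfolding measurable_sets_def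
proof (intro CollectI allI impI)
  fix S assume S: "closed_family V \<kappa> L X S"
  have "elts F \<subseteq> elts S"
  proof
    fix a assume "a \<in> elts F"
    then obtain b where "b \<in> elts S" "elts a = elts b" using ms_closed[OF assms(3) S] by blast
    then show "a \<in> elts S" using elts_inject by metis
  qed
  then show "(\<Union>a\<in>elts F. elts a) \<in> elts ` elts S"
    using S assms(1,2) unfolding closed_family_def by blast
qed

lemma ms_finite_Union:
  assumes "finite \<A>" "\<And>A. A \<in> \<A> \<Longrightarrow> A \<in> ms"
  shows "\<Union>\<A> \<in> ms"
proof -
  have "as_set ` \<A> \<in> elts ` V"
    using assms ms_coded as_set_mem by (intro coded_finite) blast+
  then obtain F where F: "F \<in> V" "elts F = as_set ` \<A>" by blast
  have e: "elts (as_set A) = A" if "A \<in> \<A>" for A using elts_as_set_mem ms_coded assms(2) that by blast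
  have "(\<Union>a\<in>elts F. elts a) \<in> ms"
    using F assms e by (intro ms_Union[OF F(1)] size_le_finite kappa) auto
  moreover have "(\<Union>a\<in>elts F. elts a) = \<Union>\<A>" using e by (simp add: F(2))
  ultimately show ?thesis by simp
qed

lemma ms_Un: "A \<in> ms \<Longrightarrow> B \<in> ms \<Longrightarrow> A \<union> B \<in> ms"
  using ms_finite_Union[of "{A, B}"] by auto

lemma ms_empty: "{} \<in> ms"
  using ms_finite_Union[of "{}"] by auto

lemma ms_Int: "A \<in> ms \<Longrightarrow> B \<in> ms \<Longrightarrow> A \<inter> B \<in> ms"
proof -
  assume A: "A \<in> ms" "B \<in> ms"
  then have "\<S> - ((\<S> - A) \<union> (\<S> - B)) \<in> ms" by (intro ms_compl ms_Un)
  moreover have "\<S> - ((\<S> - A) \<union> (\<S> - B)) = A \<inter> B" using ms_subset A by blast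
  ultimately show ?thesis by simp
qed

lemma ms_Diff: "A \<in> ms \<Longrightarrow> B \<in> ms \<Longrightarrow> A - B \<in> ms"
proof -
  assume A: "A \<in> ms" "B \<in> ms"
  then have "A \<inter> (\<S> - B) \<in> ms" by (intro ms_compl ms_Int)
  moreover have "A \<inter> (\<S> - B) = A - B" using ms_subset A by blast
  ultimately show ?thesis by simp
qed

lemma ms_symdiff: "A \<in> ms \<Longrightarrow> B \<in> ms \<Longrightarrow> symdiff A B \<in> ms"
  by (intro ms_Un ms_Diff)

lemma ms_atom:
  assumes "a \<in> atoms L X" shows "{M\<in>\<S>. sat M a} \<in> ms"
proof -
  obtain R xs where a: "a = (R, xs)" "has_arity L R (length xs)" "set xs \<subseteq> elts X"
    using assms unfolding atoms_def by auto
  have "cylinder V L X [Rel R [0..<length xs]] xs \<in> ms"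
    using a by (intro ms_cylinder) auto
  moreover have "cylinder V L X [Rel R [0..<length xs]] xs = {M\<in>\<S>. sat M a}"
    by (simp add: cylinder_def sat_def a(1) map_nth)
  ultimately show ?thesis by simp
qed

lemma clo_insert:
  assumes "a \<notin> I"
  shows "clo (insert a I) Q =
    ({M\<in>\<S>. sat M a} \<inter> clo I (\<lambda>S. Q (insert a S))) \<union> ((\<S> - {M\<in>\<S>. sat M a}) \<inter> clo I Q)"
proof -
  have "{b \<in> insert a I. sat M b} = (if sat M a then insert a {b \<in> I. sat M b} else {b \<in> I. sat M b})" for M
    by auto
  then show ?thesis unfolding clopen_set_def by auto
qed

lemma ms_clo:
  assumes "finite I" "I \<subseteq> atoms L X" shows "clo I Q \<in> ms"
  using assms
proof (induction I arbitrary: Q)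
  case empty
  show ?case using ms_Str ms_empty by (cases "Q {}") (auto simp: clopen_set_def)
next
  case (insert a I)
  then show ?case unfolding clo_insert[OF insert(2)]
    by (intro ms_Un ms_Int ms_compl ms_atom insert.IH) auto
qed

lemma clo_compl: "\<S> - clo I Q = clo I (\<lambda>S. \<not> Q S)"
  unfolding clopen_set_def by auto

lemma clo_binary:
  shows "{M\<in>\<S>. b (M \<in> clo I Q) (M \<in> clo J P)} = clo (I \<union> J) (\<lambda>S. b (Q (S \<inter> I)) (P (S \<inter> J)))"
proof -
  have "{a \<in> I \<union> J. sat M a} \<inter> I = {a \<in> I. sat M a}" "{a \<in> I \<union> J. sat M a} \<inter> J = {a \<in> J. sat M a}" for M
    by auto
  then show ?thesis unfolding clopen_set_def by auto
qed

lemma clo_Un: "clo I Q \<union> clo J P = clo (I \<union> J) (\<lambda>S. Q (S \<inter> I) \<or> P (S \<inter> J))"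
proof -
  have "clo I Q \<union> clo J P = {M\<in>\<S>. (M \<in> clo I Q) \<or> (M \<in> clo J P)}"
    by (auto simp: clopen_set_def)
  then show ?thesis using clo_binary[where b = "(\<or>)"] by simp
qed

lemma clo_symdiff: "symdiff (clo I Q) (clo J P) = clo (I \<union> J) (\<lambda>S. Q (S \<inter> I) \<noteq> P (S \<inter> J))"
proof -
  have "symdiff (clo I Q) (clo J P) = {M\<in>\<S>. (M \<in> clo I Q) \<noteq> (M \<in> clo J P)}"
    by (auto simp: clopen_set_def)
  then show ?thesis using clo_binary[where b = "(\<noteq>)"] by simp
qed

lemma cylinder_clo:
  assumes "set xs \<subseteq> elts X" "is_literal L (length xs) p"
  shows "\<exists>I Q. finite I \<and> I \<subseteq> atoms L X \<and> cylinder V L X [p] xs = clo I Q"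
  using assms(2)
proof (induction p)
  case (Rel R vs)
  then have "has_arity L R (length vs)" "set (map (nth xs) vs) \<subseteq> elts X"
    using assms(1) by (auto simp: subset_iff)
  then have "{(R, map (nth xs) vs)} \<subseteq> atoms L X" by (simp add: atoms_def)
  moreover have "cylinder V L X [Rel R vs] xs = clo {(R, map (nth xs) vs)} (\<lambda>S. S \<noteq> {})"
    by (auto simp: cylinder_def clopen_set_def sat_def)
  ultimately show ?case by blast
next
  case (Eql i j)
  have "cylinder V L X [Eql i j] xs = clo {} (\<lambda>_. xs ! i = xs ! j)"
    by (auto simp: cylinder_def clopen_set_def)
  then show ?case by blast
next
  case (Neg p)
  then obtain I Q where "finite I" "I \<subseteq> atoms L X" "cylinder V L X [p] xs = clo I Q" by auto
  moreover have "cylinder V L X [Neg p] xs = \<S> - cylinder V L X [p] xs" by (auto simp: cylinder_def)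
  ultimately show ?case using clo_compl by metis
qed

text \<open>The smallest closed family is found as the domain of \<mu>, which belongs to
  \<open>V\<close>. With Kuratowski pairs, two unions lead from \<mu> to the components of its
  pairs.\<close>

lemma coded_ms: "as_set ` ms \<in> elts ` V"
proof -
  have "definable V (\<lambda>e. \<exists>y\<in>V. pair (e 0) y \<in> elts \<mu>)" by (intro definable_intros mu)
  moreover have "\<Union> (elts ` (\<Union> (elts ` elts \<mu>))) \<in> elts ` V" using mu(1) by (intro coded_Union elts_image)
  ultimately have "{x \<in> \<Union> (elts ` (\<Union> (elts ` elts \<mu>))). \<exists>y\<in>V. pair x y \<in> elts \<mu>} \<in> elts ` V"
    by (rule coded_separation)
  also have "{x \<in> \<Union> (elts ` (\<Union> (elts ` elts \<mu>))). \<exists>y\<in>V. pair x y \<in> elts \<mu>} = as_set ` ms"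
  proof (intro subset_antisym subsetI)
    fix x assume "x \<in> {x \<in> \<Union> (elts ` (\<Union> (elts ` elts \<mu>))). \<exists>y\<in>V. pair x y \<in> elts \<mu>}"
    then show "x \<in> as_set ` ms" using elts_function[OF mu(2)] by auto
  next
    fix x assume "x \<in> as_set ` ms"
    then have p: "pair x (app \<mu> x) \<in> elts \<mu>" using function_on_iff[OF mu(2)] by simp
    have "as_set {x} \<in> elts (pair x (app \<mu> x))" "x \<in> elts (as_set {x})"
      by (simp_all add: elts_pair elts_as_set_finite)
    then show "x \<in> {x \<in> \<Union> (elts ` (\<Union> (elts ` elts \<mu>))). \<exists>y\<in>V. pair x y \<in> elts \<mu>}"
      using p pair_mem_elts(2)[OF p mu(1)] by blast
  qed
  finally show ?thesis .
qed

definition MS :: 'u where "MS = as_set (as_set ` ms)"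

lemma MS_mem [simp]: "MS \<in> V" and elts_MS: "elts MS = as_set ` ms"
  unfolding MS_def using coded_ms by (rule as_set_mem, intro elts_as_set_mem coded_ms)

lemma elts_as_set_ms: "A \<in> ms \<Longrightarrow> elts (as_set A) = A"
  using elts_as_set_mem ms_coded by blast

lemma as_set_ms: "A \<in> ms \<Longrightarrow> as_set A \<in> V"
  using as_set_mem ms_coded by blast

lemma mem_MS: "x \<in> elts MS \<longleftrightarrow> elts x \<in> ms"
  unfolding elts_MS using elts_as_set_ms by (metis as_set_elts imageE imageI)

text \<open>The family is smallest only among the closed families that belong to \<open>V\<close>.
  Induction is therefore restricted to properties \<open>P\<close> that have a definable form
  \<open>R\<close>, for which the sets with the property form such a family.\<close>

lemma ms_induct:
  assumes A: "A \<in> ms" and R: "definable V (\<lambda>e. R (e 0))"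
    and iff: "\<And>A. A \<in> ms \<Longrightarrow> R (as_set A) \<longleftrightarrow> P A"
    and clo: "\<And>I Q. finite I \<Longrightarrow> I \<subseteq> atoms L X \<Longrightarrow> P (clo I Q)"
    and compl: "\<And>A. A \<in> ms \<Longrightarrow> P A \<Longrightarrow> P (\<S> - A)"
    and Un: "\<And>F. F \<in> V \<Longrightarrow> size_le V F \<kappa> \<Longrightarrow> (\<And>a. a \<in> elts F \<Longrightarrow> elts a \<in> ms \<and> P (elts a)) \<Longrightarrow>
      P (\<Union>a\<in>elts F. elts a)"
  shows "P A"
proof -
  have "{x \<in> elts MS. R x} \<in> elts ` V" by (intro coded_separation[OF R] elts_image MS_mem)
  then obtain S where S: "S \<in> V" "elts S = {x \<in> elts MS. R x}" by blast
  have mem: "x \<in> elts S \<longleftrightarrow> elts x \<in> ms \<and> P (elts x)" for x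
    using iff[of "elts x"] unfolding S(2) mem_Collect_eq mem_MS by (metis as_set_elts)
  have img: "B \<in> elts ` elts S" if "B \<in> ms" "P B" for B
    using mem[of "as_set B"] elts_as_set_ms[OF that(1)] that by (metis imageI)
  have "closed_family V \<kappa> L X S"
    unfolding closed_family_def
  proof (intro conjI allI impI ballI)
    show "S \<in> V" by (rule S(1))
    show "elts a \<subseteq> \<S>" if "a \<in> elts S" for a using that mem ms_subset by blast
    show "cylinder V L X [p] xs \<in> elts ` elts S" if "set xs \<subseteq> elts X" "is_literal L (length xs) p" for p xs
      using cylinder_clo[OF that] clo ms_clo img by metis
    show "\<S> - elts a \<in> elts ` elts S" if "a \<in> elts S" for a
      using that mem compl ms_compl by (intro img) auto
    fix F assume F: "F \<in> V" "elts F \<subseteq> elts S" "size_le V F \<kappa>"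
    then have "elts a \<in> ms \<and> P (elts a)" if "a \<in> elts F" for a using that mem by blast
    then show "(\<Union>a\<in>elts F. elts a) \<in> elts ` elts S"
      using F by (intro img ms_Union Un) auto
  qed
  from ms_closed[OF A this] show "P A" using mem by blast
qed

section \<open>Finite additivity and its consequences\<close>

lemma codes_real_m: "A \<in> ms \<Longrightarrow> codes_real (app \<mu> (as_set A)) (m A)"
  using measure val_eq unfolding probability_kappa_measure_def by blast

lemma m_nonneg: "A \<in> ms \<Longrightarrow> 0 \<le> m A"
  using measure unfolding probability_kappa_measure_def by auto

lemma m_Str: "m \<S> = 1"
  using measure unfolding probability_kappa_measure_def by auto

lemma pair_mu: "A \<in> ms \<Longrightarrow> pair (as_set A) z \<in> elts \<mu> \<longleftrightarrow> z = app \<mu> (as_set A)"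
  using function_on_iff[OF mu(2)] by blast

lemma app_mu_mem: "A \<in> ms \<Longrightarrow> app \<mu> (as_set A) \<in> V"
  using pair_mem_elts(2)[OF _ mu(1)] pair_mu by blast

lemma below_iff:
  assumes "A \<in> ms"
  shows "below V \<mu> (as_set A) q \<longleftrightarrow> (\<exists>a b c. q = rational a b c \<and> c > 0 \<and> (real a - real b) / real c < m A)"
proof -
  have "below V \<mu> (as_set A) q \<longleftrightarrow> q \<in> elts (app \<mu> (as_set A))"
    unfolding below_def pair_mu[OF assms] using app_mu_mem[OF assms] by auto
  then show ?thesis using codes_real_m[OF assms] unfolding codes_real_def rational_def by auto
qed

lemma below_rational:
  assumes "A \<in> ms" "c > 0"
  shows "below V \<mu> (as_set A) (rational a b c) \<longleftrightarrow> (real a - real b) / real c < m A"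
  unfolding below_iff[OF assms(1)] using assms(2) by (auto simp: rational_def)

text \<open>Additivity for a family given as a HOL function: a definable description
  \<open>R\<close> of its graph places the family in \<open>V\<close>.\<close>

lemma kappa_sum:
  assumes R: "definable V (\<lambda>e. R (e 0) (e 1))"
    and B: "\<And>i. i \<in> elts \<kappa> \<Longrightarrow> B i \<in> ms"
    and iff: "\<And>i y. i \<in> elts \<kappa> \<Longrightarrow> y \<in> V \<Longrightarrow> R i y \<longleftrightarrow> y = as_set (B i)"
    and disj: "disjoint_family_on B (elts \<kappa>)"
  shows "((\<lambda>i. m (B i)) has_sum m (\<Union>i\<in>elts \<kappa>. B i)) (elts \<kappa>)"
proof -
  have "\<exists>f\<in>V. function_on f (elts \<kappa>) \<and> (\<forall>i\<in>elts \<kappa>. app f i = as_set (B i)) \<and>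
      elts f = {pair i (as_set (B i)) |i. i \<in> elts \<kappa>}"
    by (rule function_exists[OF R elts_image[OF kappa(1)]]) (use as_set_ms B iff in auto)
  then obtain f where f: "f \<in> V" "function_on f (elts \<kappa>)" "\<And>i. i \<in> elts \<kappa> \<Longrightarrow> app f i = as_set (B i)"
    by blast
  have e: "elts (app f i) = B i" if "i \<in> elts \<kappa>" for i
    using f(3)[OF that] elts_as_set_ms[OF B[OF that]] by simp
  have "additive_over V \<kappa> L X \<kappa> \<mu>" using measure unfolding probability_kappa_measure_def by blast
  moreover have "\<forall>i\<in>elts \<kappa>. elts (app f i) \<in> ms" using e B by simp
  moreover have "disjoint_family_on (\<lambda>i. elts (app f i)) (elts \<kappa>)"
    using disj e unfolding disjoint_family_on_def by simp
  ultimately have "((\<lambda>i. m (elts (app f i))) has_sum m (\<Union>i\<in>elts \<kappa>. elts (app f i))) (elts \<kappa>)"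
    using f(1,2) unfolding additive_over_def by blast
  moreover have "(\<Union>i\<in>elts \<kappa>. elts (app f i)) = (\<Union>i\<in>elts \<kappa>. B i)" using e by simp
  ultimately show ?thesis using e has_sum_cong[of "elts \<kappa>" "\<lambda>i. m (elts (app f i))" "\<lambda>i. m (B i)"] by simp
qed

lemma two_indices:
  obtains i j where "i \<in> elts \<kappa>" "j \<in> elts \<kappa>" "i \<noteq> j"
proof -
  obtain i where i: "i \<in> elts \<kappa>" using kappa(3) by (metis finite.emptyI ex_in_conv)
  have "elts \<kappa> - {i} \<noteq> {}" using kappa(3) infinite_remove by (metis finite.emptyI)
  then show ?thesis using i that by blast
qed

text \<open>For the constant family of empty sets, two indices already give
  \<open>2 * m {} \<le> m {}\<close> by additivity and nonnegativity.\<close>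

lemma m_empty: "m {} = 0"
proof -
  have "((\<lambda>i. m {}) has_sum m (\<Union>i\<in>elts \<kappa>. {})) (elts \<kappa>)"
  proof (rule kappa_sum)
    show "definable V (\<lambda>e. e 1 = as_set {})" by (intro definable_intros as_set_ms ms_empty)
  qed (auto simp: ms_empty disjoint_family_on_def)
  then have hs: "((\<lambda>i. m {}) has_sum m {}) (elts \<kappa>)" by simp
  obtain i j where ij: "i \<in> elts \<kappa>" "j \<in> elts \<kappa>" "i \<noteq> j" by (rule two_indices)
  have "(\<Sum>k\<in>{i, j}. m {}) \<le> m {}"
    by (rule has_sum_mono2[OF has_sum_finite hs]) (use ij m_nonneg ms_empty in auto)
  then show ?thesis using ij m_nonneg[OF ms_empty] by simp
qed

text \<open>Additivity concerns families indexed by all of \<kappa>; the two sets are put at two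
  indices and the rest is padded with the empty set, whose measure is 0 by
  \<open>m_empty\<close>.\<close>

lemma m_disjoint:
  assumes A: "A \<in> ms" and B: "B \<in> ms" and "A \<inter> B = {}"
  shows "m (A \<union> B) = m A + m B"
proof -
  obtain i j where ij: "i \<in> elts \<kappa>" "j \<in> elts \<kappa>" "i \<noteq> j" by (rule two_indices)
  have ijV: "i \<in> V" "j \<in> V" using ij elts_mem[OF kappa(1)] by blast+
  define C where "C k = (if k = i then A else if k = j then B else {})" for k
  have "((\<lambda>k. m (C k)) has_sum m (\<Union>k\<in>elts \<kappa>. C k)) (elts \<kappa>)"
  proof (rule kappa_sum)
    show "definable V (\<lambda>e. e 0 = i \<and> e 1 = as_set A \<or> e 0 \<noteq> i \<and> (e 0 = j \<and> e 1 = as_set B \<or> e 0 \<noteq> j \<and> e 1 = as_set {}))"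
      by (intro definable_intros as_set_ms ms_empty A B ijV)
    show "C k \<in> ms" for k using A B ms_empty by (simp add: C_def)
    show "(k = i \<and> y = as_set A \<or> k \<noteq> i \<and> (k = j \<and> y = as_set B \<or> k \<noteq> j \<and> y = as_set {})) \<longleftrightarrow> y = as_set (C k)"
      for k y by (simp add: C_def)
    show "disjoint_family_on C (elts \<kappa>)"
      using assms(3) unfolding disjoint_family_on_def C_def by auto
  qed
  moreover have "(\<Union>k\<in>elts \<kappa>. C k) = A \<union> B" using ij unfolding C_def by (auto split: if_splits)
  ultimately have 1: "((\<lambda>k. m (C k)) has_sum m (A \<union> B)) (elts \<kappa>)" by simp
  have "((\<lambda>k. m (C k)) has_sum (\<Sum>k\<in>{i, j}. m (C k))) {i, j}" by (rule has_sum_finite) simp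
  then have "((\<lambda>k. m (C k)) has_sum (\<Sum>k\<in>{i, j}. m (C k))) (elts \<kappa>)"
    using has_sum_cong_neutral[of "elts \<kappa>" "{i, j}" "\<lambda>k. m (C k)" "\<lambda>k. m (C k)"] ij
    by (auto simp: C_def m_empty)
  then have "m (A \<union> B) = (\<Sum>k\<in>{i, j}. m (C k))" using 1 has_sum_unique by blast
  also have "\<dots> = m A + m B" using ij(3) by (simp add: C_def)
  finally show ?thesis .
qed

lemma m_Diff: "A \<in> ms \<Longrightarrow> B \<in> ms \<Longrightarrow> B \<subseteq> A \<Longrightarrow> m (A - B) = m A - m B"
  using m_disjoint[of "A - B" B] ms_Diff by (simp add: Un_absorb2 Int_commute)

lemma m_mono: "A \<in> ms \<Longrightarrow> B \<in> ms \<Longrightarrow> A \<subseteq> B \<Longrightarrow> m A \<le> m B"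
  using m_Diff[of B A] m_nonneg[OF ms_Diff[of B A]] by simp

lemma m_modular: "A \<in> ms \<Longrightarrow> B \<in> ms \<Longrightarrow> m (A \<union> B) + m (A \<inter> B) = m A + m B"
proof -
  assume A: "A \<in> ms" "B \<in> ms"
  have "m (A \<union> (B - A)) = m A + m (B - A)" using A by (intro m_disjoint ms_Diff) auto
  moreover have "m ((B - A) \<union> (A \<inter> B)) = m (B - A) + m (A \<inter> B)"
    using A by (intro m_disjoint ms_Diff ms_Int) auto
  moreover have "A \<union> (B - A) = A \<union> B" "(B - A) \<union> (A \<inter> B) = B" by auto
  ultimately show ?thesis by simp
qed

lemma m_Un_le: "A \<in> ms \<Longrightarrow> B \<in> ms \<Longrightarrow> m (A \<union> B) \<le> m A + m B"
  using m_modular[of A B] m_nonneg[OF ms_Int[of A B]] by simp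

lemma m_le_symdiff: "A \<in> ms \<Longrightarrow> B \<in> ms \<Longrightarrow> \<bar>m A - m B\<bar> \<le> m (symdiff A B)"
proof -
  have *: "m A \<le> m B + m (symdiff A B)" if "A \<in> ms" "B \<in> ms" for A B
  proof -
    have "m A \<le> m (B \<union> symdiff A B)"
      using that by (intro m_mono ms_Un ms_symdiff) auto
    also have "\<dots> \<le> m B + m (symdiff A B)" using that by (intro m_Un_le ms_symdiff)
    finally show ?thesis .
  qed
  assume "A \<in> ms" "B \<in> ms"
  moreover have "symdiff B A = symdiff A B" by auto
  ultimately show ?thesis using *[of A B] *[of B A] by (simp add: abs_le_iff)
qed

lemma m_symdiff_triangle:
  "A \<in> ms \<Longrightarrow> B \<in> ms \<Longrightarrow> C \<in> ms \<Longrightarrow> m (symdiff A C) \<le> m (symdiff A B) + m (symdiff B C)"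
proof -
  assume ABC: "A \<in> ms" "B \<in> ms" "C \<in> ms"
  have "m (symdiff A C) \<le> m (symdiff A B \<union> symdiff B C)"
    using ABC by (intro m_mono ms_Un ms_symdiff) auto
  also have "\<dots> \<le> m (symdiff A B) + m (symdiff B C)" using ABC by (intro m_Un_le ms_symdiff)
  finally show ?thesis .
qed

lemma m_sum:
  assumes "finite J" "\<And>i. i \<in> J \<Longrightarrow> B i \<in> ms" "disjoint_family_on B J"
  shows "m (\<Union>i\<in>J. B i) = (\<Sum>i\<in>J. m (B i))"
  using assms
proof (induction J)
  case empty
  show ?case by (simp add: m_empty)
next
  case (insert i J)
  have "disjoint_family_on B J" using insert.prems(2) by (rule disjoint_family_on_mono[rotated]) auto
  then have IH: "m (\<Union>i\<in>J. B i) = (\<Sum>i\<in>J. m (B i))" using insert by simp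
  have "(\<Union>i\<in>J. B i) \<in> ms"
    using insert.hyps(1) insert.prems(1) by (intro ms_finite_Union) auto
  moreover have "B i \<inter> (\<Union>i\<in>J. B i) = {}"
    using insert.prems(2) insert.hyps(2) unfolding disjoint_family_on_def by auto
  ultimately show ?case using m_disjoint[of "B i"] insert.prems(1) insert.hyps IH by simp
qed

text \<open>The only consequence of \<open>\<kappa>\<close>-additivity beyond finite additivity that is needed.  The family is
  made disjoint along its indexing by the ordinal \<open>\<kappa>\<close>.\<close>

lemma m_Union_approx:
  assumes F: "F \<in> V" "size_le V F \<kappa>" and ms: "\<And>a. a \<in> elts F \<Longrightarrow> elts a \<in> ms" and \<epsilon>: "\<epsilon> > 0"
  shows "\<exists>G. G \<subseteq> elts F \<and> finite G \<and> m (\<Union>a\<in>elts F. elts a) < m (\<Union>a\<in>G. elts a) + \<epsilon>"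
proof -
  obtain h where h: "h \<in> V" "function_on h (elts F)" "app h ` elts F \<subseteq> elts \<kappa>" "inj_on (app h) (elts F)"
    using F(2) unfolding size_le_def by blast
  have pair_h: "pair a i \<in> elts h \<longleftrightarrow> i = app h a" if "a \<in> elts F" for a i
    by (rule function_on_iff[OF h(2) that])
  define B where "B i = {N \<in> \<S>. \<exists>a\<in>elts F. app h a = i \<and> N \<in> elts a \<and>
      (\<forall>b\<in>elts F. app h b \<in> elts i \<longrightarrow> N \<notin> elts b)}" for i
  have Beq: "B (app h a) = elts a - (\<Union>b\<in>{b \<in> elts F. app h b \<in> elts (app h a)}. elts b)" if "a \<in> elts F" for a
  proof -
    have "elts a \<subseteq> \<S>" using ms_subset ms that by blast
    moreover have "a' = a" if "a' \<in> elts F" "app h a' = app h a" for a'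
      using h(4) that \<open>a \<in> elts F\<close> unfolding inj_on_def by blast
    ultimately show ?thesis unfolding B_def using that by blast
  qed
  have Bempty: "B i = {}" if "i \<notin> app h ` elts F" for i using that unfolding B_def by blast
  have Bms: "B i \<in> ms" if i: "i \<in> elts \<kappa>" for i
  proof (cases "i \<in> app h ` elts F")
    case True
    then obtain a where a: "a \<in> elts F" "i = app h a" by blast
    have iV: "i \<in> V" using elts_mem[OF kappa(1) i] .
    have "definable V (\<lambda>e. \<exists>j\<in>elts i. pair (e 0) j \<in> elts h)" by (intro definable_intros h iV)
    then have "{b \<in> elts F. \<exists>j\<in>elts i. pair b j \<in> elts h} \<in> elts ` V"
      by (rule coded_separation[OF _ elts_image[OF F(1)]])
    also have "{b \<in> elts F. \<exists>j\<in>elts i. pair b j \<in> elts h} = {b \<in> elts F. app h b \<in> elts (app h a)}"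
      by (rule Collect_cong) (auto simp: pair_h a(2))
    finally obtain G where G: "G \<in> V" "elts G = {b \<in> elts F. app h b \<in> elts (app h a)}" by blast
    have "(\<Union>b\<in>elts G. elts b) \<in> ms"
      by (rule ms_Union[OF G(1) size_le_subset[OF F G(1) _ kappa(1)]]) (use G(2) ms in auto)
    then show ?thesis unfolding a(2) Beq[OF a(1)] using G(2) ms[OF a(1)] by (intro ms_Diff) auto
  qed (simp add: Bempty ms_empty)
  have disj: "disjoint_family_on B (elts \<kappa>)"
    unfolding disjoint_family_on_def
  proof (intro ballI impI)
    fix i j assume ij: "i \<in> elts \<kappa>" "j \<in> elts \<kappa>" "i \<noteq> j"
    have *: "B i \<inter> B j = {}" if "i \<in> elts j" for i j using that unfolding B_def by blast
    show "B i \<inter> B j = {}" using ordinal_linear[OF kappa(2) ij(1,2)] ij(3) *[of i j] *[of j i] by blast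
  qed
  have Un: "(\<Union>i\<in>elts \<kappa>. B i) = (\<Union>a\<in>elts F. elts a)"
  proof (intro subset_antisym subsetI)
    fix N assume "N \<in> (\<Union>a\<in>elts F. elts a)"
    then obtain a where a: "a \<in> elts F" "N \<in> elts a" by blast
    define T where "T = {app h a |a. a \<in> elts F \<and> N \<in> elts a}"
    have "T \<subseteq> elts \<kappa>" "T \<noteq> {}" using h(3) a unfolding T_def by blast+
    from ordinal_least[OF kappa(2) this] obtain i where i: "i \<in> T" "\<And>j. j \<in> elts i \<Longrightarrow> j \<notin> T" by blast
    then obtain a' where a': "a' \<in> elts F" "N \<in> elts a'" "i = app h a'" unfolding T_def by blast
    have "N \<in> \<S>" using ms_subset[OF ms[OF a'(1)]] a'(2) by blast
    moreover have "\<forall>b\<in>elts F. app h b \<in> elts i \<longrightarrow> N \<notin> elts b" using i(2) unfolding T_def by blast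
    ultimately have "N \<in> B i" using a' unfolding B_def by blast
    moreover have "i \<in> elts \<kappa>" using h(3) a' by blast
    ultimately show "N \<in> (\<Union>i\<in>elts \<kappa>. B i)" by blast
  qed (use B_def in blast)
  have "((\<lambda>i. m (B i)) has_sum m (\<Union>i\<in>elts \<kappa>. B i)) (elts \<kappa>)"
  proof (rule kappa_sum[OF _ Bms _ disj])
    show "definable V (\<lambda>e. \<forall>N\<in>V. N \<in> elts (e 1) \<longleftrightarrow> N \<in> elts (as_set \<S>) \<and>
      (\<exists>a\<in>elts F. pair a (e 0) \<in> elts h \<and> N \<in> elts a \<and>
        (\<forall>b\<in>elts F. (\<exists>j\<in>elts (e 0). pair b j \<in> elts h) \<longrightarrow> N \<notin> elts b)))"
      by (intro definable_intros h F S_mem)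
    fix i y assume i: "i \<in> elts \<kappa>" and y: "y \<in> V"
    have "N \<in> elts (as_set \<S>) \<and> (\<exists>a\<in>elts F. pair a i \<in> elts h \<and> N \<in> elts a \<and>
        (\<forall>b\<in>elts F. (\<exists>j\<in>elts i. pair b j \<in> elts h) \<longrightarrow> N \<notin> elts b)) \<longleftrightarrow> N \<in> B i" for N
      unfolding elts_S B_def using pair_h by auto
    then show "(\<forall>N\<in>V. N \<in> elts y \<longleftrightarrow> N \<in> elts (as_set \<S>) \<and> (\<exists>a\<in>elts F. pair a i \<in> elts h \<and> N \<in> elts a \<and>
        (\<forall>b\<in>elts F. (\<exists>j\<in>elts i. pair b j \<in> elts h) \<longrightarrow> N \<notin> elts b))) \<longleftrightarrow> y = as_set (B i)"
      using coded_eq_iff[OF ms_coded[OF Bms[OF i]] y] by simp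
  qed
  then have "(sum (\<lambda>i. m (B i)) \<longlongrightarrow> m (\<Union>a\<in>elts F. elts a)) (finite_subsets_at_top (elts \<kappa>))"
    unfolding Un has_sum_def .
  \<comment> \<open>Convergence of the sum yields finitely many indices whose pieces carry all but
    \<epsilon> of the measure; \<open>h\<close> is injective, so finitely many members of
    \<open>F\<close> have these indices.\<close>
  from tendstoD[OF this \<epsilon>] obtain J where J: "finite J" "J \<subseteq> elts \<kappa>"
    "dist (\<Sum>i\<in>J. m (B i)) (m (\<Union>a\<in>elts F. elts a)) < \<epsilon>"
    unfolding eventually_finite_subsets_at_top by blast
  define G where "G = {a \<in> elts F. app h a \<in> J}"
  have "finite G"
  proof (rule finite_imageD)
    show "finite (app h ` G)" using J(1) by (rule finite_subset[rotated]) (auto simp: G_def)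
    show "inj_on (app h) G" using h(4) by (rule inj_on_subset) (auto simp: G_def)
  qed
  have "(\<Sum>i\<in>J. m (B i)) = m (\<Union>i\<in>J. B i)"
    using J disj Bms by (intro m_sum[symmetric] disjoint_family_on_mono[OF J(2) disj]) auto
  also have "\<dots> \<le> m (\<Union>a\<in>G. elts a)"
  proof (rule m_mono)
    show "(\<Union>i\<in>J. B i) \<in> ms" using J Bms by (intro ms_finite_Union) auto
    show "(\<Union>a\<in>G. elts a) \<in> ms" using \<open>finite G\<close> ms by (intro ms_finite_Union) (auto simp: G_def)
    show "(\<Union>i\<in>J. B i) \<subseteq> (\<Union>a\<in>G. elts a)" unfolding B_def G_def by blast
  qed
  finally have "m (\<Union>a\<in>elts F. elts a) < m (\<Union>a\<in>G. elts a) + \<epsilon>"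
    using J(3) by (simp add: dist_real_def abs_less_iff)
  moreover have "G \<subseteq> elts F" by (auto simp: G_def)
  ultimately show ?thesis using \<open>finite G\<close> by blast
qed

end

section \<open>Approximation by clopen sets\<close>

context kappa_measure
begin

lemma m_compl: "A \<in> ms \<Longrightarrow> m (\<S> - A) = 1 - m A"
  using m_Diff[OF ms_Str, of A] ms_subset m_Str by simp

lemma is_agreement_iff:
  assumes A: "A \<in> ms" "B \<in> ms" and C: "elts C = B" and D: "D \<in> V"
  shows "is_agreement V (as_set \<S>) (as_set A) C D \<longleftrightarrow> D = as_set (\<S> - symdiff A B)"
proof -
  have "N \<in> elts (as_set \<S>) \<and> (N \<in> elts (as_set A) \<longleftrightarrow> N \<in> elts C) \<longleftrightarrow> N \<in> \<S> - symdiff A B" for N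
    unfolding elts_S elts_as_set_ms[OF A(1)] C by blast
  then show ?thesis
    unfolding is_agreement_def
    using coded_eq_iff[OF ms_coded[OF ms_compl[OF ms_symdiff[OF A]]] D] by simp
qed

text \<open>The error bound survives enlarging the finite subfamily from \<open>G'\<close> to
  \<open>G\<close>, so that one subfamily can serve two measures.\<close>

lemma m_Union_approx_mono:
  assumes F: "F \<in> V" "size_le V F \<kappa>" and ms: "\<And>a. a \<in> elts F \<Longrightarrow> elts a \<in> ms"
    and G: "finite G" "G \<subseteq> elts F" "G' \<subseteq> G" "m (\<Union>a\<in>elts F. elts a) < m (\<Union>a\<in>G'. elts a) + \<epsilon>"
  shows "m (symdiff (\<Union>a\<in>elts F. elts a) (\<Union>a\<in>G. elts a)) < \<epsilon>"
proof -
  have fin: "(\<Union>a\<in>H. elts a) \<in> ms" if "H \<subseteq> G" for H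
  proof -
    have "finite H" using that G(1) finite_subset by blast
    then show ?thesis using that G(2) ms by (intro ms_finite_Union) auto
  qed
  have U: "(\<Union>a\<in>elts F. elts a) \<in> ms" by (rule ms_Union[OF F ms])
  have sub: "(\<Union>a\<in>G. elts a) \<subseteq> (\<Union>a\<in>elts F. elts a)" using G(2) by blast
  have "symdiff (\<Union>a\<in>elts F. elts a) (\<Union>a\<in>G. elts a) = (\<Union>a\<in>elts F. elts a) - (\<Union>a\<in>G. elts a)"
    using sub by blast
  moreover have "m (\<Union>a\<in>G'. elts a) \<le> m (\<Union>a\<in>G. elts a)"
    using G(3) fin by (intro m_mono) blast+
  ultimately show ?thesis using m_Diff[OF U fin sub] G(4) by simp
qed

end

text \<open>Agreement of two measures on clopen sets passes to a measurable set only if a single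
  clopen set approximates it in both. With both measures equal this is ordinary approximation; with
  an image measure it gives invariance.\<close>

locale two_measures = kappa_measure V \<kappa> L X \<mu> + second: kappa_measure V \<kappa> L X \<mu>'
  for V :: "'u::set_universe set" and \<kappa> L X \<mu> \<mu>'
begin

definition approximable :: "'u set \<Rightarrow> bool" where
  "approximable A \<longleftrightarrow> (\<forall>\<epsilon>>0. \<exists>I Q. finite I \<and> I \<subseteq> atoms L X \<and>
     m (symdiff A (clo I Q)) < \<epsilon> \<and> second.m (symdiff A (clo I Q)) < \<epsilon>)"

lemma approximableD:
  assumes "approximable A" "\<epsilon> > 0"
  obtains I Q where "finite I" "I \<subseteq> atoms L X" "m (symdiff A (clo I Q)) < \<epsilon>"
    "second.m (symdiff A (clo I Q)) < \<epsilon>"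
  using assms unfolding approximable_def by blast

lemma approximable_clo: 
  assumes "finite I" "I \<subseteq> atoms L X" shows "approximable (clo I Q)"
  unfolding approximable_def
  using assms m_empty second.m_empty by (intro allI impI exI[of _ I] exI[of _ Q]) auto

lemma approximable_compl: 
  assumes "A \<subseteq> \<S>" "approximable A" shows "approximable (\<S> - A)"
  unfolding approximable_def
proof (intro allI impI)
  fix \<epsilon> :: real assume "\<epsilon> > 0"
  then obtain I Q where I: "finite I" "I \<subseteq> atoms L X" "m (symdiff A (clo I Q)) < \<epsilon>"
    "second.m (symdiff A (clo I Q)) < \<epsilon>" using approximableD[OF assms(2)] by blast
  have "symdiff (\<S> - A) (\<S> - clo I Q) = symdiff A (clo I Q)"
    using assms(1) unfolding clopen_set_def by blast
  then have eq: "symdiff (\<S> - A) (clo I (\<lambda>S. \<not> Q S)) = symdiff A (clo I Q)" by (simp only: clo_compl)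
  show "\<exists>I Q. finite I \<and> I \<subseteq> atoms L X \<and> m (symdiff (\<S> - A) (clo I Q)) < \<epsilon> \<and>
      second.m (symdiff (\<S> - A) (clo I Q)) < \<epsilon>"
    by (intro exI[of _ I] exI[of _ "\<lambda>S. \<not> Q S"]) (simp only: eq I simp_thms)
qed

lemma approximable_Un:
  assumes A: "A \<in> ms" "B \<in> ms" and "approximable A" "approximable B"
  shows "approximable (A \<union> B)"
  unfolding approximable_def
proof (intro allI impI)
  fix \<epsilon> :: real assume \<epsilon>: "\<epsilon> > 0"
  obtain I Q where I: "finite I" "I \<subseteq> atoms L X" "m (symdiff A (clo I Q)) < \<epsilon> / 2"
    "second.m (symdiff A (clo I Q)) < \<epsilon> / 2"
    using approximableD[OF assms(3), of "\<epsilon> / 2"] \<epsilon> by auto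
  obtain J P where J: "finite J" "J \<subseteq> atoms L X" "m (symdiff B (clo J P)) < \<epsilon> / 2"
    "second.m (symdiff B (clo J P)) < \<epsilon> / 2"
    using approximableD[OF assms(4), of "\<epsilon> / 2"] \<epsilon> by auto
  let ?C = "clo (I \<union> J) (\<lambda>S. Q (S \<inter> I) \<or> P (S \<inter> J))"
  have sub: "symdiff (A \<union> B) ?C \<subseteq> symdiff A (clo I Q) \<union> symdiff B (clo J P)"
    unfolding clo_Un[symmetric] by blast
  have C: "clo I Q \<in> ms" "clo J P \<in> ms" "?C \<in> ms" using I J ms_clo by simp_all
  have "m (symdiff (A \<union> B) ?C) \<le> m (symdiff A (clo I Q) \<union> symdiff B (clo J P))"
    using sub A C by (intro m_mono ms_Un ms_symdiff)
  also have "\<dots> \<le> m (symdiff A (clo I Q)) + m (symdiff B (clo J P))"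
    using A C by (intro m_Un_le ms_symdiff)
  finally have 1: "m (symdiff (A \<union> B) ?C) < \<epsilon>" using I J by simp
  have "second.m (symdiff (A \<union> B) ?C) \<le> second.m (symdiff A (clo I Q) \<union> symdiff B (clo J P))"
    using sub A C by (intro second.m_mono ms_Un ms_symdiff)
  also have "\<dots> \<le> second.m (symdiff A (clo I Q)) + second.m (symdiff B (clo J P))"
    using A C by (intro second.m_Un_le ms_symdiff)
  finally have 2: "second.m (symdiff (A \<union> B) ?C) < \<epsilon>" using I J by simp
  show "\<exists>I Q. finite I \<and> I \<subseteq> atoms L X \<and> m (symdiff (A \<union> B) (clo I Q)) < \<epsilon> \<and>
      second.m (symdiff (A \<union> B) (clo I Q)) < \<epsilon>"
    by (intro exI[of _ "I \<union> J"] exI[of _ "\<lambda>S. Q (S \<inter> I) \<or> P (S \<inter> J)"]) (simp only: 1 2 I J finite_Un Un_least simp_thms)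
qed

lemma approximable_finite_Union:
  assumes "finite \<A>" "\<And>A. A \<in> \<A> \<Longrightarrow> A \<in> ms \<and> approximable A"
  shows "approximable (\<Union>\<A>)"
  using assms
proof (induction \<A>)
  case empty
  have "clo {} (\<lambda>_. False) = {}" by (simp add: clopen_set_def)
  then show ?case using approximable_clo[of "{}" "\<lambda>_. False"] by simp
next
  case (insert A \<A>)
  then have "\<Union>\<A> \<in> ms" by (intro ms_finite_Union) auto
  then show ?case using insert approximable_Un[of A "\<Union>\<A>"] by simp
qed

lemma approximable_Union:
  assumes F: "F \<in> V" "size_le V F \<kappa>" and a: "\<And>a. a \<in> elts F \<Longrightarrow> elts a \<in> ms \<and> approximable (elts a)"
  shows "approximable (\<Union>a\<in>elts F. elts a)"
  unfolding approximable_def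
proof (intro allI impI)
  fix \<epsilon> :: real assume \<epsilon>: "\<epsilon> > 0"
  have ms: "\<And>a. a \<in> elts F \<Longrightarrow> elts a \<in> ms" using a by blast
  obtain G1 where G1: "G1 \<subseteq> elts F" "finite G1" "m (\<Union>a\<in>elts F. elts a) < m (\<Union>a\<in>G1. elts a) + \<epsilon> / 2"
    using m_Union_approx[OF F ms, of "\<epsilon> / 2"] \<epsilon> by auto
  obtain G2 where G2: "G2 \<subseteq> elts F" "finite G2"
    "second.m (\<Union>a\<in>elts F. elts a) < second.m (\<Union>a\<in>G2. elts a) + \<epsilon> / 2"
    using second.m_Union_approx[OF F ms, of "\<epsilon> / 2"] \<epsilon> by auto
  define G where "G = G1 \<union> G2"
  let ?F = "\<Union>a\<in>elts F. elts a" and ?G = "\<Union>a\<in>G. elts a"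
  have G: "finite G" "G \<subseteq> elts F" "G1 \<subseteq> G" "G2 \<subseteq> G" using G1 G2 by (auto simp: G_def)
  have 1: "m (symdiff ?F ?G) < \<epsilon> / 2"
    by (rule m_Union_approx_mono[OF F ms G(1-3) G1(3)])
  have 2: "second.m (symdiff ?F ?G) < \<epsilon> / 2"
    by (rule second.m_Union_approx_mono[OF F ms G(1,2,4) G2(3)])
  have "approximable (\<Union> (elts ` G))" using G a by (intro approximable_finite_Union) auto
  then obtain I Q where I: "finite I" "I \<subseteq> atoms L X" "m (symdiff ?G (clo I Q)) < \<epsilon> / 2"
    "second.m (symdiff ?G (clo I Q)) < \<epsilon> / 2"
    using \<epsilon> approximableD[of ?G "\<epsilon> / 2"] by auto
  have mem: "?F \<in> ms" "?G \<in> ms" "clo I Q \<in> ms"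
    using ms_Union[OF F ms] ms_finite_Union[of "elts ` G"] G ms ms_clo[OF I(1,2)] by auto
  have "m (symdiff ?F (clo I Q)) < \<epsilon>"
    using m_symdiff_triangle[OF mem] 1 I(3) by simp
  moreover have "second.m (symdiff ?F (clo I Q)) < \<epsilon>"
    using second.m_symdiff_triangle[OF mem] 2 I(4) by simp
  ultimately show "\<exists>I Q. finite I \<and> I \<subseteq> atoms L X \<and> m (symdiff ?F (clo I Q)) < \<epsilon> \<and>
      second.m (symdiff ?F (clo I Q)) < \<epsilon>"
    using I(1,2) by blast
qed

text \<open>A definable form of \<open>approximable\<close>. The cut of the measure 1 of the whole
  space consists of the codes of all rationals below 1, so an error \<epsilon> is expressed as 1 -
  q, and a small symmetric difference as a large agreement.\<close>

definition approximable_code :: "'u \<Rightarrow> bool" where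
  "approximable_code x \<longleftrightarrow> (\<forall>q\<in>elts (app \<mu> (as_set \<S>)). \<exists>C\<in>V. \<exists>D\<in>V.
     is_clopen V (as_set \<S>) C \<and> is_agreement V (as_set \<S>) x C D \<and> below V \<mu> D q \<and> below V \<mu>' D q)"

lemma approximable_code_iff:
  assumes A: "A \<in> ms"
  shows "approximable_code (as_set A) \<longleftrightarrow> approximable A"
proof
  assume *: "approximable_code (as_set A)"
  show "approximable A"
    unfolding approximable_def
  proof (intro allI impI)
    fix \<epsilon> :: real assume "\<epsilon> > 0"
    then obtain n where n: "n > 0" "1 / real n < \<epsilon>"
      using reals_Archimedean[of \<epsilon>] by (auto simp: inverse_eq_divide) (metis of_nat_Suc zero_less_Suc)
    \<comment> \<open>This codes (n - 1) / n, that is 1 - 1 / n.\<close>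
    let ?q = "rational n 1 n :: 'u"
    have "below V \<mu> (as_set \<S>) ?q" using below_rational[OF ms_Str n(1)] m_Str n(1) by simp
    then have "?q \<in> elts (app \<mu> (as_set \<S>))"
      unfolding below_def pair_mu[OF ms_Str] by blast
    then obtain C D where CD: "C \<in> V" "D \<in> V" "is_clopen V (as_set \<S>) C"
      "is_agreement V (as_set \<S>) (as_set A) C D" "below V \<mu> D ?q" "below V \<mu>' D ?q"
      using * unfolding approximable_code_def by blast
    then obtain I Q where I: "finite I" "I \<subseteq> atoms L X" "elts C = clo I Q"
      using CD(3) unfolding is_clopen_iff[OF CD(1)] by blast
    have D: "D = as_set (\<S> - symdiff A (clo I Q))"
      using is_agreement_iff[OF A ms_clo[OF I(1,2)] I(3) CD(2)] CD(4) by blast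
    have sd: "symdiff A (clo I Q) \<in> ms" using A ms_clo[OF I(1,2)] by (rule ms_symdiff)
    have "1 - 1 / real n < m (\<S> - symdiff A (clo I Q))"
      using CD(5) n(1) unfolding D below_rational[OF ms_compl[OF sd] n(1)] by (simp add: diff_divide_distrib)
    moreover have "1 - 1 / real n < second.m (\<S> - symdiff A (clo I Q))"
      using CD(6) n(1) unfolding D second.below_rational[OF ms_compl[OF sd] n(1)] by (simp add: diff_divide_distrib)
    ultimately have "m (symdiff A (clo I Q)) < \<epsilon>" "second.m (symdiff A (clo I Q)) < \<epsilon>"
      using m_compl[OF sd] second.m_compl[OF sd] n(2) by simp_all
    then show "\<exists>I Q. finite I \<and> I \<subseteq> atoms L X \<and> m (symdiff A (clo I Q)) < \<epsilon> \<and> second.m (symdiff A (clo I Q)) < \<epsilon>"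
      using I by blast
  qed
next
  assume *: "approximable A"
  show "approximable_code (as_set A)"
    unfolding approximable_code_def
  proof
    fix q assume "q \<in> elts (app \<mu> (as_set \<S>))"
    then have "below V \<mu> (as_set \<S>) q"
      unfolding below_def using pair_mu[OF ms_Str] app_mu_mem[OF ms_Str] by blast
    then obtain a b c where q: "q = rational a b c" "c > 0" "(real a - real b) / real c < 1"
      unfolding below_iff[OF ms_Str] m_Str by blast
    obtain I Q where I: "finite I" "I \<subseteq> atoms L X"
      "m (symdiff A (clo I Q)) < 1 - (real a - real b) / real c"
      "second.m (symdiff A (clo I Q)) < 1 - (real a - real b) / real c"
      using approximableD[OF *, of "1 - (real a - real b) / real c"] q(3) by auto
    note C = ms_clo[OF I(1,2), of Q]
    note sd = ms_symdiff[OF A C]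
    show "\<exists>C\<in>V. \<exists>D\<in>V. is_clopen V (as_set \<S>) C \<and> is_agreement V (as_set \<S>) (as_set A) C D \<and>
       below V \<mu> D q \<and> below V \<mu>' D q"
    proof (rule bexI[OF _ as_set_ms[OF C]], rule bexI[OF _ as_set_ms[OF ms_compl[OF sd]]], intro conjI)
      show "is_clopen V (as_set \<S>) (as_set (clo I Q))"
        unfolding is_clopen_iff[OF as_set_ms[OF C]] using I(1,2) elts_as_set_ms[OF C] by blast
      show "is_agreement V (as_set \<S>) (as_set A) (as_set (clo I Q)) (as_set (\<S> - symdiff A (clo I Q)))"
        using is_agreement_iff[OF A C elts_as_set_ms[OF C] as_set_ms[OF ms_compl[OF sd]]] by blast
      show "below V \<mu> (as_set (\<S> - symdiff A (clo I Q))) q"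
        unfolding q(1) below_rational[OF ms_compl[OF sd] q(2)] m_compl[OF sd] using I(3) by simp
      show "below V \<mu>' (as_set (\<S> - symdiff A (clo I Q))) q"
        unfolding q(1) second.below_rational[OF ms_compl[OF sd] q(2)] second.m_compl[OF sd] using I(4) by simp
    qed
  qed
qed

lemma all_approximable:
  assumes "A \<in> ms" shows "approximable A"
  using assms
proof (rule ms_induct)
  show "definable V (\<lambda>e. approximable_code (e 0))"
    unfolding approximable_code_def
    by (intro definable_intros S_mem mu second.mu app_mu_mem ms_Str)
  show "approximable (\<S> - A)" if "A \<in> ms" "approximable A" for A
    using that by (intro approximable_compl ms_subset)
qed (simp_all add: approximable_code_iff approximable_clo approximable_Union)

lemma measure_eqI:
  assumes eq: "\<And>I Q. finite I \<Longrightarrow> I \<subseteq> atoms L X \<Longrightarrow> m (clo I Q) = second.m (clo I Q)" and A: "A \<in> ms"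
  shows "m A = second.m A"
proof -
  have "\<bar>m A - second.m A\<bar> \<le> \<epsilon>" if \<epsilon>: "\<epsilon> > 0" for \<epsilon>
  proof -
    obtain I Q where I: "finite I" "I \<subseteq> atoms L X" "m (symdiff A (clo I Q)) < \<epsilon> / 2"
      "second.m (symdiff A (clo I Q)) < \<epsilon> / 2"
      using approximableD[OF all_approximable[OF A], of "\<epsilon> / 2"] \<epsilon> by auto
    show ?thesis
      using m_le_symdiff[OF A ms_clo[OF I(1,2)], of Q] second.m_le_symdiff[OF A ms_clo[OF I(1,2)], of Q]
        eq[OF I(1,2), of Q] I(3,4) by (simp add: abs_le_iff)
  qed
  then have "\<bar>m A - second.m A\<bar> \<le> 0" by (rule field_le_epsilon) simp
  then show ?thesis by simp
qed

end

context kappa_measure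
begin

lemma clopen_approximation:
  assumes "A \<in> ms" "\<epsilon> > 0"
  obtains I Q where "finite I" "I \<subseteq> atoms L X" "m (symdiff A (clo I Q)) < \<epsilon>"
proof -
  interpret T: two_measures V \<kappa> L X \<mu> \<mu> by unfold_locales
  show ?thesis by (rule T.approximableD[OF T.all_approximable[OF assms(1)] assms(2)]) (rule that)
qed

section \<open>Translates of measurable sets and image measures\<close>

lemma maps_set_ms_iff:
  assumes g: "g \<in> Sym V X" and A: "A \<in> ms" and D: "D \<in> V"
  shows "maps_set V (as_set \<S>) g (as_set A) D \<longleftrightarrow> D = as_set (act L X g ` A)"
  using maps_set_iff[OF g ms_coded[OF A] ms_subset[OF A] D] .

lemma act_coded: "g \<in> Sym V X \<Longrightarrow> A \<in> ms \<Longrightarrow> act L X g ` A \<in> elts ` V"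
  by (intro act_image_coded ms_coded ms_subset)

lemma act_Diff:
  assumes g: "g \<in> Sym V X" and "A \<subseteq> \<S>" "B \<subseteq> \<S>"
  shows "act L X g ` (A - B) = act L X g ` A - act L X g ` B"
  using assms(2,3) by (intro inj_on_image_set_diff[OF act_inj[OF g]]) auto

lemma act_Int:
  assumes g: "g \<in> Sym V X" and "A \<subseteq> \<S>" "B \<subseteq> \<S>"
  shows "act L X g ` (A \<inter> B) = act L X g ` A \<inter> act L X g ` B"
  using assms(2,3) by (intro inj_on_image_Int[OF act_inj[OF g]])

lemma move_subset_atoms: "g \<in> Sym V X \<Longrightarrow> I \<subseteq> atoms L X \<Longrightarrow> move (app g) ` I \<subseteq> atoms L X"
  using move_atoms by blast

text \<open>Induction on measurable sets applies since \<open>MS\<close> belongs to \<open>V\<close>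
  and \<open>maps_set\<close> describes the image. At unions, \<open>size_le_image\<close> shows
  that the family of images is no larger than the given one allows.\<close>

lemma ms_act:
  assumes g: "g \<in> Sym V X" and A: "A \<in> ms"
  shows "act L X g ` A \<in> ms"
  using A
proof (rule ms_induct)
  show "definable V (\<lambda>e. \<exists>D\<in>elts MS. maps_set V (as_set \<S>) g (e 0) D)"
    by (intro definable_intros MS_mem S_mem Sym_V[OF g])
  show "(\<exists>D\<in>elts MS. maps_set V (as_set \<S>) g (as_set A) D) \<longleftrightarrow> act L X g ` A \<in> ms" if A: "A \<in> ms" for A
  proof
    assume "\<exists>D\<in>elts MS. maps_set V (as_set \<S>) g (as_set A) D"
    then obtain D where D: "elts D \<in> ms" "D \<in> V" "maps_set V (as_set \<S>) g (as_set A) D"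
      using mem_MS elts_mem[OF MS_mem] by blast
    then have "D = as_set (act L X g ` A)" using maps_set_ms_iff[OF g A D(2)] by blast
    then show "act L X g ` A \<in> ms" using D(1) elts_as_set_mem[OF act_coded[OF g A]] by simp
  next
    assume im: "act L X g ` A \<in> ms"
    then show "\<exists>D\<in>elts MS. maps_set V (as_set \<S>) g (as_set A) D"
      using maps_set_ms_iff[OF g A as_set_ms[OF im]] elts_MS by blast
  qed
  show "act L X g ` clo I Q \<in> ms" if "finite I" "I \<subseteq> atoms L X" for I Q
    unfolding act_clopen[OF g that(2)] using that move_subset_atoms[OF g] by (intro ms_clo) auto
  show "act L X g ` (\<S> - A) \<in> ms" if "A \<in> ms" "act L X g ` A \<in> ms" for A
    using that ms_subset[OF that(1)] by (simp add: act_Diff[OF g] act_surj[OF g] ms_compl)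
  fix F assume F: "F \<in> V" "size_le V F \<kappa>" and a: "\<And>a. a \<in> elts F \<Longrightarrow> elts a \<in> ms \<and> act L X g ` elts a \<in> ms"
  define G where "G a = as_set (act L X g ` elts a)" for a
  have GV: "G a \<in> V" if "a \<in> elts F" for a using a[OF that] as_set_ms unfolding G_def by blast
  have iff: "maps_set V (as_set \<S>) g a y \<longleftrightarrow> y = G a" if "a \<in> elts F" "y \<in> V" for a y
    using maps_set_ms_iff[OF g conjunct1[OF a[OF that(1)]] that(2)] unfolding G_def as_set_elts .
  have R: "definable V (\<lambda>e. maps_set V (as_set \<S>) g (e 0) (e 1))"
    by (intro definable_intros S_mem Sym_V[OF g])
  note img = size_le_image[OF kappa(2,1) F R GV iff]
  have eG: "elts (as_set (G ` elts F)) = G ` elts F" by (rule elts_as_set_mem[OF img(1)])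
  have "(\<Union>y\<in>elts (as_set (G ` elts F)). elts y) \<in> ms"
  proof (rule ms_Union[OF as_set_mem[OF img(1)] img(2)])
    show "elts y \<in> ms" if "y \<in> elts (as_set (G ` elts F))" for y
      using that a elts_as_set_ms unfolding eG G_def by auto
  qed
  moreover have "(\<Union>y\<in>elts (as_set (G ` elts F)). elts y) = act L X g ` (\<Union>a\<in>elts F. elts a)"
    unfolding eG using a elts_as_set_ms by (auto simp: G_def)
  ultimately show "act L X g ` (\<Union>a\<in>elts F. elts a) \<in> ms" by simp
qed

lemma image_additive:
  assumes g: "g \<in> Sym V X" and I: "I \<in> V" and add: "additive_over V \<kappa> L X I \<mu>"
    and f: "f \<in> V" "function_on f (elts I)" "\<And>i. i \<in> elts I \<Longrightarrow> elts (app f i) \<in> ms"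
      "disjoint_family_on (\<lambda>i. elts (app f i)) (elts I)"
  shows "((\<lambda>i. m (act L X g ` elts (app f i))) has_sum m (act L X g ` (\<Union>i\<in>elts I. elts (app f i)))) (elts I)"
proof -
  define B where "B i = act L X g ` elts (app f i)" for i
  have B: "B i \<in> ms" if "i \<in> elts I" for i unfolding B_def using f(3)[OF that] by (rule ms_act[OF g])
  have "\<exists>f'\<in>V. function_on f' (elts I) \<and> (\<forall>i\<in>elts I. app f' i = as_set (B i)) \<and>
      elts f' = {pair i (as_set (B i)) |i. i \<in> elts I}"
  proof (rule function_exists[OF _ elts_image[OF I]])
    show "definable V (\<lambda>e. \<exists>a\<in>V. pair (e 0) a \<in> elts f \<and> maps_set V (as_set \<S>) g a (e 1))"
      by (intro definable_intros f S_mem Sym_V[OF g])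
    fix i assume i: "i \<in> elts I"
    show "as_set (B i) \<in> V" using as_set_ms[OF B[OF i]] .
    have p: "pair i a \<in> elts f \<longleftrightarrow> a = app f i" for a by (rule function_on_iff[OF f(2) i])
    have aV: "app f i \<in> V" using p pair_mem_elts(2)[OF _ f(1)] by blast
    show "(\<exists>a\<in>V. pair i a \<in> elts f \<and> maps_set V (as_set \<S>) g a y) \<longleftrightarrow> y = as_set (B i)" if "y \<in> V" for y
      using maps_set_ms_iff[OF g f(3)[OF i] that] aV unfolding p B_def as_set_elts by blast
  qed
  then obtain f' where f': "f' \<in> V" "function_on f' (elts I)" "\<And>i. i \<in> elts I \<Longrightarrow> app f' i = as_set (B i)"
    by blast
  have e: "elts (app f' i) = B i" if "i \<in> elts I" for i
    using f'(3)[OF that] elts_as_set_ms[OF B[OF that]] by simp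
  have "B i \<inter> B j = {}" if "i \<in> elts I" "j \<in> elts I" "i \<noteq> j" for i j
  proof -
    have "elts (app f i) \<inter> elts (app f j) = {}" using f(4) that unfolding disjoint_family_on_def by blast
    then show ?thesis
      using act_Int[OF g ms_subset[OF f(3)[OF that(1)]] ms_subset[OF f(3)[OF that(2)]]] by (simp add: B_def)
  qed
  then have "disjoint_family_on (\<lambda>i. elts (app f' i)) (elts I)"
    unfolding disjoint_family_on_def using e by simp
  moreover have "\<forall>i\<in>elts I. elts (app f' i) \<in> ms" using e B by simp
  ultimately have "((\<lambda>i. m (elts (app f' i))) has_sum m (\<Union>i\<in>elts I. elts (app f' i))) (elts I)"
    using add f'(1,2) unfolding additive_over_def by blast
  moreover have "(\<Union>i\<in>elts I. elts (app f' i)) = act L X g ` (\<Union>i\<in>elts I. elts (app f i))"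
    using e by (auto simp: B_def)
  ultimately show ?thesis
    using has_sum_cong[of "elts I" "\<lambda>i. m (elts (app f' i))" "\<lambda>i. m (act L X g ` elts (app f i))"] e
    by (simp add: B_def)
qed

text \<open>Turns invariance under \<open>g\<close> into equality of two \<kappa>-measures of the
  same model, a question that clopen sets can decide.\<close>

lemma image_measure:
  assumes g: "g \<in> Sym V X"
  obtains \<mu>' where "kappa_measure V \<kappa> L X \<mu>'" "\<And>A. A \<in> ms \<Longrightarrow> val \<mu>' A = m (act L X g ` A)"
proof -
  define F where "F x = app \<mu> (as_set (act L X g ` elts x))" for x
  have "\<exists>f\<in>V. function_on f (elts MS) \<and> (\<forall>x\<in>elts MS. app f x = F x) \<and> elts f = {pair x (F x) |x. x \<in> elts MS}"
  proof (rule function_exists[OF _ elts_image[OF MS_mem]])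
    show "definable V (\<lambda>e. \<exists>D\<in>V. maps_set V (as_set \<S>) g (e 0) D \<and> pair D (e 1) \<in> elts \<mu>)"
      by (intro definable_intros S_mem mu Sym_V[OF g])
    fix x assume "x \<in> elts MS"
    then have x: "elts x \<in> ms" using mem_MS by blast
    note gx = ms_act[OF g x]
    show "F x \<in> V" unfolding F_def by (rule app_mu_mem[OF gx])
    show "(\<exists>D\<in>V. maps_set V (as_set \<S>) g x D \<and> pair D y \<in> elts \<mu>) \<longleftrightarrow> y = F x" for y
      using maps_set_ms_iff[OF g x] as_set_ms[OF gx] pair_mu[OF gx] unfolding as_set_elts F_def by auto
  qed
  then obtain \<mu>' where mu': "\<mu>' \<in> V" "function_on \<mu>' (elts MS)" "\<And>x. x \<in> elts MS \<Longrightarrow> app \<mu>' x = F x"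
    by blast
  have app: "app \<mu>' (as_set A) = app \<mu> (as_set (act L X g ` A))" if "A \<in> ms" for A
    using mu'(3)[of "as_set A"] that elts_as_set_ms[OF that] unfolding elts_MS F_def by simp
  then have val: "val \<mu>' A = m (act L X g ` A)" if "A \<in> ms" for A
    unfolding val_def using that by simp
  have add: "additive_over V \<kappa> L X I \<mu>'" if I: "I \<in> V" "additive_over V \<kappa> L X I \<mu>"
    "\<And>f. f \<in> V \<Longrightarrow> function_on f (elts I) \<Longrightarrow> (\<And>i. i \<in> elts I \<Longrightarrow> elts (app f i) \<in> ms) \<Longrightarrow>
      (\<Union>i\<in>elts I. elts (app f i)) \<in> ms" for I
    unfolding additive_over_def
  proof (intro ballI impI)
    fix f assume f: "f \<in> V" "function_on f (elts I)" "\<forall>i\<in>elts I. elts (app f i) \<in> ms"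
      "disjoint_family_on (\<lambda>i. elts (app f i)) (elts I)"
    have fi: "\<And>i. i \<in> elts I \<Longrightarrow> elts (app f i) \<in> ms" using f(3) by blast
    show "((\<lambda>i. val \<mu>' (elts (app f i))) has_sum val \<mu>' (\<Union>i\<in>elts I. elts (app f i))) (elts I)"
      using image_additive[OF g I(1,2) f(1,2) fi f(4)] val[OF I(3)[OF f(1,2) fi]]
        has_sum_cong[of "elts I" "\<lambda>i. val \<mu>' (elts (app f i))" "\<lambda>i. m (act L X g ` elts (app f i))"] val[OF fi]
      by simp
  qed
  \<comment> \<open>The value of \<mu>' is known on measurable sets only, so the unions in the
    additivity statements must first be seen to be measurable; index sets inside \<kappa> keep them
    small enough. Both \<open>omega\<close> and \<kappa> are of this kind.\<close>
  have Un: "(\<Union>i\<in>elts I. elts (app f i)) \<in> ms"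
    if f: "f \<in> V" "function_on f (elts I)" and ms: "\<And>i. i \<in> elts I \<Longrightarrow> elts (app f i) \<in> ms"
      and I: "I \<in> V" "elts I \<subseteq> elts \<kappa>" for I f
  proof -
    have p: "pair i a \<in> elts f \<longleftrightarrow> a = app f i" if "i \<in> elts I" for a i by (rule function_on_iff[OF f(2) that])
    have aV: "app f i \<in> V" if "i \<in> elts I" for i using p[OF that] pair_mem_elts(2)[OF _ f(1)] by blast
    have R: "definable V (\<lambda>e. pair (e 0) (e 1) \<in> elts f)" by (intro definable_intros f)
    note img = size_le_image[OF kappa(2,1) I(1) size_le_subset_ordinal[OF I] R aV p]
    have "(\<Union>y\<in>elts (as_set (app f ` elts I)). elts y) \<in> ms"
      using ms_Union[OF as_set_mem[OF img(1)] img(2)] ms elts_as_set_mem[OF img(1)] by auto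
    then show ?thesis using elts_as_set_mem[OF img(1)] by simp
  qed
  have "probability_kappa_measure V \<kappa> L X \<mu>'"
    unfolding probability_kappa_measure_def
  proof (intro conjI ballI)
    show "\<mu>' \<in> V" by (rule mu'(1))
    show "function_on \<mu>' (as_set ` ms)" using mu'(2) unfolding elts_MS .
    fix A assume A: "A \<in> ms"
    show "\<exists>r. codes_real (app \<mu>' (as_set A)) r" using codes_real_m[OF ms_act[OF g A]] app[OF A] by auto
    show "val \<mu>' A \<ge> 0" using m_nonneg[OF ms_act[OF g A]] val[OF A] by simp
  next
    show "val \<mu>' \<S> = 1" using val[OF ms_Str] by (simp add: act_surj[OF g] m_Str)
    show "additive_over V \<kappa> L X omega \<mu>'"
      using measure omega_subset_ordinal[OF kappa(2,3)] unfolding probability_kappa_measure_def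
      by (intro add Un omega_mem) blast+
    show "additive_over V \<kappa> L X \<kappa> \<mu>'"
      using measure kappa(1) unfolding probability_kappa_measure_def
      by (intro add Un) blast+
  qed
  then have "kappa_measure V \<kappa> L X \<mu>'"
    by unfold_locales (simp_all add: kappa X_mem X_infinite)
  then show ?thesis using val that by blast
qed

text \<open>The image of \<open>m\<close> under \<open>g\<close> is a \<kappa>-measure that agrees
  with \<open>m\<close> on clopen sets, hence everywhere by \<open>measure_eqI\<close>. This serves
  the relativized measure, whose values are given on clopen sets only.\<close>

lemma invariant_measureI:
  assumes "\<And>g I Q. g \<in> Sym V X \<Longrightarrow> finite I \<Longrightarrow> I \<subseteq> atoms L X \<Longrightarrow> m (act L X g ` clo I Q) = m (clo I Q)"
  shows "invariant_measure V \<kappa> L X \<mu>"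
  unfolding invariant_measure_def
proof (intro conjI ballI measure)
  fix g A assume g: "g \<in> Sym V X" and A: "A \<in> ms"
  obtain \<mu>' where mu': "kappa_measure V \<kappa> L X \<mu>'" "\<And>A. A \<in> ms \<Longrightarrow> val \<mu>' A = m (act L X g ` A)"
    using image_measure[OF g] by blast
  interpret T: two_measures V \<kappa> L X \<mu> \<mu>' 
    by (intro two_measures.intro kappa_measure_axioms mu'(1))
  have "m A = val \<mu>' A"
    by (rule T.measure_eqI[OF _ A]) (simp add: mu'(2) ms_clo assms g)
  then show "m (act L X g ` A) = m A" using mu'(2)[OF A] by simp
qed

end

section \<open>Agreement with far away translates\<close>

text \<open>The constant \<open>c\<close> may depend on \<epsilon>; it will be the eventual value
  belonging to a clopen approximation.\<close>

lemma filter_Cauchy_convergent: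
  fixes f :: "'a \<Rightarrow> real"
  assumes "F \<noteq> bot" and "\<And>\<epsilon>. \<epsilon> > 0 \<Longrightarrow> \<exists>c. eventually (\<lambda>x. \<bar>f x - c\<bar> < \<epsilon>) F"
  shows "\<exists>l. (f \<longlongrightarrow> l) F"
proof -
  have "cauchy_filter (filtermap f F)"
    unfolding cauchy_filter_metric_filtermap
  proof (intro allI impI)
    fix e :: real assume "e > 0"
    then obtain c where c: "eventually (\<lambda>x. \<bar>f x - c\<bar> < e / 2) F" using assms(2)[of "e / 2"] by auto
    show "\<exists>P. eventually P F \<and> (\<forall>x y. P x \<and> P y \<longrightarrow> dist (f x) (f y) < e)"
    proof (intro exI[of _ "\<lambda>x. \<bar>f x - c\<bar> < e / 2"] conjI allI impI c)
      fix x y assume "\<bar>f x - c\<bar> < e / 2 \<and> \<bar>f y - c\<bar> < e / 2"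
      then show "dist (f x) (f y) < e" unfolding dist_real_def by linarith
    qed
  qed
  then have "\<exists>l. filtermap f F \<le> nhds l"
    by (rule cauchy_filter_complete_converges[OF _ complete_UNIV]) (use assms(1) in \<open>auto simp: filtermap_bot_iff\<close>)
  then show ?thesis unfolding filterlim_def .
qed

locale invariant_kappa_measure = kappa_measure +
  assumes invariant: "\<And>g A. g \<in> Sym V X \<Longrightarrow> A \<in> ms \<Longrightarrow> m (act L X g ` A) = m A"
begin

lemma act_clo_fixed:
  assumes g: "g \<in> Sym V X" and I: "I \<subseteq> atoms L X" and eq: "\<And>x. x \<in> support I \<Longrightarrow> app g x = x"
  shows "act L X g ` clo I Q = clo I Q"
proof -
  have mv: "move (app g) a = a" if "a \<in> I" for a
    using move_cong[OF order_refl, of I "app g" "\<lambda>x. x" a] eq that by (simp add: move_def)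
  then have "move (app g) ` I = I" "\<And>S. {a \<in> I. move (app g) a \<in> S} = {a \<in> I. a \<in> S}" by auto
  then show ?thesis unfolding act_clopen[OF g I] by (simp add: clopen_set_def conj_commute cong: conj_cong)
qed

lemma act_clo_compose:
  assumes g: "g \<in> Sym V X" and h: "h \<in> Sym V X" and k: "k \<in> Sym V X" and I: "I \<subseteq> atoms L X"
    and eq: "\<And>x. x \<in> support I \<Longrightarrow> app k x = app h (app g x)"
  shows "act L X h ` act L X g ` clo I Q = act L X k ` clo I Q"
proof -
  have mv: "move (app k) a = move (app h) (move (app g) a)" if "a \<in> I" for a
    using move_cong[OF order_refl, of I "app k" "\<lambda>x. app h (app g x)" a] eq that by (simp add: move_def comp_def)
  have 1: "move (app k) ` I = move (app h) ` move (app g) ` I" using mv by (auto simp: image_image)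
  have 2: "{a \<in> I. move (app k) a \<in> S} = {a \<in> I. move (app g) a \<in> {b \<in> move (app g) ` I. move (app h) b \<in> S}}" for S
    using mv by auto
  show ?thesis
    unfolding act_clopen[OF g I] act_clopen[OF h move_subset_atoms[OF g I]] act_clopen[OF k I] 1 2 ..
qed

text \<open>Countable unions are unions of size at most \<kappa> because \<open>omega\<close> is
  contained in \<kappa>. A finite subfamily that nearly exhausts the union lies in an initial
  segment of the sequence.\<close>

lemma omega_Union:
  fixes E :: "nat \<Rightarrow> 'a set"
  assumes R: "definable V (\<lambda>e. R (e 0) (e 1))" and E: "\<And>n. E n \<in> ms"
    and iff: "\<And>n y. y \<in> V \<Longrightarrow> R (numeral_set n) y \<longleftrightarrow> y = as_set (E n)"
  shows "(\<Union>n. E n) \<in> ms" and "\<And>\<epsilon>. \<epsilon> > 0 \<Longrightarrow> \<exists>N. m (\<Union>n. E n) < m (\<Union>n\<le>N. E n) + \<epsilon>"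
proof -
  define G where "G x = as_set (E (THE n. numeral_set n = x))" for x :: 'a
  have G: "G (numeral_set n) = as_set (E n)" for n unfolding G_def by simp
  have GV: "G x \<in> V" if "x \<in> elts omega" for x using that G as_set_ms[OF E] by (auto simp: elts_omega)
  have Giff: "R x y \<longleftrightarrow> y = G x" if "x \<in> elts omega" "y \<in> V" for x y
    using that G iff by (auto simp: elts_omega)
  note size = size_le_subset_ordinal[OF omega_mem omega_subset_ordinal[OF kappa(2,3)]]
  note img = size_le_image[OF kappa(2,1) omega_mem size R GV Giff]
  define F where "F = as_set (G ` elts omega)"
  have F: "F \<in> V" "size_le V F \<kappa>" "elts F = range (\<lambda>n. as_set (E n))"
    unfolding F_def using as_set_mem[OF img(1)] img(2) elts_as_set_mem[OF img(1)]
    by (simp_all add: elts_omega image_image G)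
  have ms: "elts a \<in> ms" if "a \<in> elts F" for a using that E elts_as_set_ms by (auto simp: F(3))
  have U: "(\<Union>a\<in>elts F. elts a) = (\<Union>n. E n)" unfolding F(3) using elts_as_set_ms[OF E] by simp
  show "(\<Union>n. E n) \<in> ms" using ms_Union[OF F(1,2) ms] unfolding U .
  fix \<epsilon> :: real assume "\<epsilon> > 0"
  from m_Union_approx[OF F(1,2) ms this] obtain H where
    H: "H \<subseteq> elts F" "finite H" "m (\<Union>n. E n) < m (\<Union>a\<in>H. elts a) + \<epsilon>" unfolding U by blast
  obtain J where J: "finite J" "H = (\<lambda>n. as_set (E n)) ` J"
    using finite_subset_image[OF H(2) H(1)[unfolded F(3)]] by blast
  have UJ: "(\<Union>a\<in>H. elts a) = (\<Union>n\<in>J. E n)" unfolding J(2) using elts_as_set_ms[OF E] by simp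
  obtain N where N: "J \<subseteq> {..N}" using J(1) finite_nat_iff_bounded_le by blast
  have "m (\<Union>n\<in>J. E n) \<le> m (\<Union>n\<le>N. E n)"
    using J(1) E N by (intro m_mono ms_finite_Union) auto
  then show "\<exists>N. m (\<Union>n. E n) < m (\<Union>n\<le>N. E n) + \<epsilon>" 
    using H(3) unfolding UJ by (intro exI[of _ N]) linarith
qed

end

locale invariant_clopen = invariant_kappa_measure V \<kappa> L X \<mu>
  for V :: "'u::set_universe set" and \<kappa> L X \<mu> +
  fixes I0 :: "('u \<times> 'u list) set" and Q0 :: "('u \<times> 'u list) set \<Rightarrow> bool"
  assumes I0: "finite I0" "I0 \<subseteq> atoms L X"
begin

definition D0 :: "'u set" where "D0 = clo I0 Q0"

definition agree :: "'u set \<Rightarrow> 'u \<Rightarrow> 'u set" where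
  "agree E g = \<S> - symdiff (act L X g ` D0) E"

text \<open>Only the position of the translated support matters. The finite sets range over HOL
  sets; the form of this filter usable inside \<open>V\<close> is \<open>often_code\<close>.\<close>

definition far :: "'u filter" where
  "far = (INF F\<in>{F. finite F}. principal {g \<in> Sym V X. app g ` support I0 \<inter> F = {}})"

text \<open>This is \<Psi> of the overview. The total operator \<open>Lim\<close> has the intended
  meaning on measurable sets, by \<open>limit_exists\<close>.\<close>

definition limit :: "'u set \<Rightarrow> real" where
  "limit E = Lim far (\<lambda>g. m (agree E g))"

lemma ms_D0: "D0 \<in> ms"
  unfolding D0_def by (rule ms_clo[OF I0])

lemma support_I0: "finite (support I0)" "support I0 \<subseteq> elts X"
  using finite_support support_atoms I0 by blast+

lemma eventually_far:
  "eventually P far \<longleftrightarrow> (\<exists>F. finite F \<and> (\<forall>g\<in>Sym V X. app g ` support I0 \<inter> F = {} \<longrightarrow> P g))"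
  unfolding far_def
proof (subst eventually_INF_base)
  fix F G :: "'u set" assume "F \<in> {F. finite F}" "G \<in> {F. finite F}"
  then show "\<exists>H\<in>{F. finite F}. principal {g \<in> Sym V X. app g ` support I0 \<inter> H = {}}
      \<le> inf (principal {g \<in> Sym V X. app g ` support I0 \<inter> F = {}})
          (principal {g \<in> Sym V X. app g ` support I0 \<inter> G = {}})"
    by (intro bexI[of _ "F \<union> G"]) auto
qed (auto simp: eventually_principal)

lemma eventually_far_Sym: "eventually (\<lambda>g. g \<in> Sym V X) far"
  unfolding eventually_far by (rule exI[of _ "{}"]) auto

lemma far_nonempty:
  assumes "finite F"
  obtains g where "g \<in> Sym V X" "app g ` support I0 \<inter> F = {}"
proof -
  have "infinite (elts X - F)" using X_infinite assms by simp
  then obtain B where B: "finite B" "card B = card (support I0)" "B \<subseteq> elts X - F"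
    using infinite_arbitrarily_large by blast
  then obtain \<sigma> where \<sigma>: "bij_betw \<sigma> (support I0) B"
    using finite_same_card_bij[OF support_I0(1)] by metis
  have "\<exists>g\<in>Sym V X. \<forall>y\<in>support I0. app g y = \<sigma> y"
    using \<sigma> B by (intro permutation_extension[OF X_mem support_I0]) (auto simp: bij_betw_def)
  then obtain g where g: "g \<in> Sym V X" "\<And>y. y \<in> support I0 \<Longrightarrow> app g y = \<sigma> y" by blast
  have "app g ` support I0 = B" using g(2) \<sigma> by (simp add: bij_betw_def)
  then have "app g ` support I0 \<inter> F = {}" using B(3) by auto
  then show ?thesis using g(1) that by blast
qed

lemma far_not_bot: "far \<noteq> bot"
proof
  assume "far = bot"
  then have "eventually (\<lambda>_. False) far" by simp
  then obtain F where F: "finite F" "\<And>g. g \<in> Sym V X \<Longrightarrow> app g ` support I0 \<inter> F \<noteq> {}"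
    unfolding eventually_far by blast
  then show False using far_nonempty[OF F(1)] by metis
qed

lemma ms_agree: "E \<in> ms \<Longrightarrow> g \<in> Sym V X \<Longrightarrow> agree E g \<in> ms"
  unfolding agree_def using ms_act ms_D0 by (intro ms_compl ms_symdiff)

lemma m_agree: 
  assumes "E \<in> ms" "g \<in> Sym V X" 
  shows "m (agree E g) = 1 - m (symdiff (act L X g ` D0) E)"
  unfolding agree_def using ms_act[OF assms(2) ms_D0] assms(1) by (intro m_compl ms_symdiff)

lemma m_symdiff: "A \<in> ms \<Longrightarrow> B \<in> ms \<Longrightarrow> m (symdiff A B) = m A + m B - 2 * m (A \<inter> B)"
proof -
  assume A: "A \<in> ms" "B \<in> ms"
  have "m (symdiff A B) = m (A - B) + m (B - A)" using A by (intro m_disjoint ms_Diff) auto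
  moreover have "m (A - B) = m A - m (A \<inter> B)"
    using m_Diff[OF A(1) ms_Int[OF A]] by (simp add: Diff_Int)
  moreover have "m (B - A) = m B - m (A \<inter> B)"
    using m_Diff[OF A(2) ms_Int[OF A]] by (simp add: Diff_Int)
  ultimately show ?thesis by simp
qed

lemma m_act_D0: "g \<in> Sym V X \<Longrightarrow> m (act L X g ` D0) = m D0"
  by (rule invariant[OF _ ms_D0])

lemma agree_Lipschitz:
  assumes "E \<in> ms" "E' \<in> ms" "g \<in> Sym V X"
  shows "\<bar>m (agree E g) - m (agree E' g)\<bar> \<le> m (symdiff E E')"
proof -
  have D: "act L X g ` D0 \<in> ms" by (rule ms_act[OF assms(3) ms_D0])
  have "m (symdiff E' E) = m (symdiff E E')" by (simp add: Un_commute)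
  then show ?thesis
    using m_symdiff_triangle[OF D assms(1,2)] m_symdiff_triangle[OF D assms(2,1)]
    unfolding m_agree[OF assms(1,3)] m_agree[OF assms(2,3)] by (simp only: abs_le_iff) linarith
qed

text \<open>The measure of the agreement is 1 - m D0 - m E + 2 m (g D0 \<inter> E), and each term is
  constant or modular in \<open>E\<close>.\<close>

lemma agree_modular:
  assumes E: "E \<in> ms" "E' \<in> ms" and g: "g \<in> Sym V X"
  shows "m (agree (E \<union> E') g) + m (agree (E \<inter> E') g) = m (agree E g) + m (agree E' g)"
proof -
  let ?D = "act L X g ` D0"
  have D: "?D \<in> ms" by (rule ms_act[OF g ms_D0])
  have "?D \<inter> (E \<union> E') = (?D \<inter> E) \<union> (?D \<inter> E')" "?D \<inter> (E \<inter> E') = (?D \<inter> E) \<inter> (?D \<inter> E')" by auto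
  then have "m (?D \<inter> (E \<union> E')) + m (?D \<inter> (E \<inter> E')) = m (?D \<inter> E) + m (?D \<inter> E')"
    using m_modular[OF ms_Int[OF D E(1)] ms_Int[OF D E(2)]] by simp
  then show ?thesis
    using m_modular[OF E] E g D by (simp add: m_agree ms_Un ms_Int m_symdiff)
qed

text \<open>Applying \<open>h\<close> carries the agreement of \<open>E\<close> with one translate
  of \<open>D0\<close> onto that of the image of \<open>E\<close> with another. Any \<open>k\<close>
  acting like the composite on the support may be taken, so no product of permutations has to be
  formed.\<close>

lemma agree_move:
  assumes E: "E \<in> ms" and g: "g \<in> Sym V X" and h: "h \<in> Sym V X" and k: "k \<in> Sym V X"
    and eq: "\<And>x. x \<in> support I0 \<Longrightarrow> app k x = app h (app g x)"
  shows "m (agree (act L X h ` E) k) = m (agree E g)"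
proof -
  have "act L X k ` D0 = act L X h ` act L X g ` D0"
    unfolding D0_def using act_clo_compose[OF g h k I0(2) eq] by simp
  moreover have "act L X g ` D0 \<subseteq> \<S>" "E \<subseteq> \<S>"
    using ms_subset ms_act[OF g ms_D0] E by blast+
  moreover from this have "act L X h ` (\<S> - symdiff (act L X g ` D0) E) =
    act L X h ` \<S> - act L X h ` (symdiff (act L X g ` D0) E)"
    by (intro act_Diff[OF h]) auto
  ultimately have "agree (act L X h ` E) k = act L X h ` agree E g"
    unfolding agree_def by (simp only: image_Un act_Diff[OF h] act_surj[OF h])
  then show ?thesis using invariant[OF h ms_agree[OF E g]] by simp
qed

text \<open>Two far away translates of \<open>D0\<close> are interchanged by a permutation fixing the support of
  a given clopen set.\<close>

lemma agree_clo_constant: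
  assumes I: "I \<subseteq> atoms L X" "finite I" and g: "g \<in> Sym V X" "app g ` support I0 \<inter> support I = {}"
    and g': "g' \<in> Sym V X" "app g' ` support I0 \<inter> support I = {}"
  shows "m (agree (clo I Q) g') = m (agree (clo I Q) g)"
proof -
  \<comment> \<open>Since both translates avoid \<open>support I\<close>, the two clauses do not
    interfere and \<sigma> is injective on the union.\<close>
  define \<sigma> where "\<sigma> x = (if x \<in> support I then x else app g' (inv_into (elts X) (app g) x))" for x
  have inv: "inv_into (elts X) (app g) (app g x) = x" if "x \<in> support I0" for x
    using inv_into_f_f[OF Sym_app_inj[OF g(1)]] that support_I0 by blast
  have \<sigma>g: "\<sigma> (app g x) = app g' x" if "x \<in> support I0" for x
    using g(2) inv[OF that] that by (auto simp: \<sigma>_def)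
  have \<sigma>I: "\<sigma> x = x" if "x \<in> support I" for x using that by (simp add: \<sigma>_def)
  have g'inj: "x = y" if "x \<in> support I0" "y \<in> support I0" "app g' x = app g' y" for x y
    using Sym_app_inj[OF g'(1)] that support_I0(2) by (meson inj_onD subsetD)
  have "\<exists>h\<in>Sym V X. \<forall>y\<in>support I \<union> app g ` support I0. app h y = \<sigma> y"
  proof (rule permutation_extension[OF X_mem])
    show "finite (support I \<union> app g ` support I0)" using support_I0 finite_support[OF I(2)] by simp
    show "support I \<union> app g ` support I0 \<subseteq> elts X"
      using support_atoms[OF I(1)] support_I0 Sym_app_mem[OF g(1)] by blast
    show "\<sigma> ` (support I \<union> app g ` support I0) \<subseteq> elts X"
      using support_atoms[OF I(1)] support_I0 Sym_app_mem[OF g'(1)] \<sigma>g \<sigma>I by auto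
    have "inj_on \<sigma> (support I)" using \<sigma>I by (auto simp: inj_on_def)
    moreover have "inj_on \<sigma> (app g ` support I0)" 
      by (auto simp: inj_on_def \<sigma>g dest: g'inj)
    moreover have "\<sigma> ` support I \<inter> \<sigma> ` app g ` support I0 = {}"
      using g'(2) \<sigma>g \<sigma>I by (auto simp: image_image)
    ultimately show "inj_on \<sigma> (support I \<union> app g ` support I0)"
      using inj_on_Un[of \<sigma> "support I" "app g ` support I0"] by blast
  qed
  then obtain h where h: "h \<in> Sym V X" "\<And>x. x \<in> support I \<Longrightarrow> app h x = x"
    "\<And>x. x \<in> support I0 \<Longrightarrow> app h (app g x) = app g' x" using \<sigma>g \<sigma>I by auto
  have "m (agree (act L X h ` clo I Q) g') = m (agree (clo I Q) g)"
    by (rule agree_move[OF ms_clo[OF I(2,1)] g(1) h(1) g'(1)]) (simp add: h(3))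
  then show ?thesis using act_clo_fixed[OF h(1) I(1) h(2)] by simp
qed

text \<open>For a clopen \<open>E\<close> the measure of agreement is constant once the translate is
  off the support of \<open>E\<close>. A measurable set lies within \<epsilon> of a clopen one, and
  by \<open>agree_Lipschitz\<close> its values vary around that constant by less than
  \<epsilon>.\<close>

lemma limit_exists:
  assumes E: "E \<in> ms"
  shows "\<exists>l. ((\<lambda>g. m (agree E g)) \<longlongrightarrow> l) far"
proof (rule filter_Cauchy_convergent[OF far_not_bot])
  fix \<epsilon> :: real assume "\<epsilon> > 0"
  then obtain I Q where I: "finite I" "I \<subseteq> atoms L X" "m (symdiff E (clo I Q)) < \<epsilon>"
    using clopen_approximation[OF E] by blast
  obtain g0 where g0: "g0 \<in> Sym V X" "app g0 ` support I0 \<inter> support I = {}"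
    using far_nonempty[OF finite_support[OF I(1)]] by blast
  show "\<exists>c. eventually (\<lambda>g. \<bar>m (agree E g) - c\<bar> < \<epsilon>) far"
    unfolding eventually_far
  proof (intro exI[of _ "m (agree (clo I Q) g0)"] exI[of _ "support I"] conjI ballI impI)
    show "finite (support I)" by (rule finite_support[OF I(1)])
    fix g assume g: "g \<in> Sym V X" "app g ` support I0 \<inter> support I = {}"
    show "\<bar>m (agree E g) - m (agree (clo I Q) g0)\<bar> < \<epsilon>"
      using agree_clo_constant[OF I(2,1) g0 g, of Q] agree_Lipschitz[OF E ms_clo[OF I(1,2)] g(1), of Q] I(3)
      by simp
  qed
qed

section \<open>Modularity, continuity and invariance of the limit\<close>

lemma limit: "E \<in> ms \<Longrightarrow> ((\<lambda>g. m (agree E g)) \<longlongrightarrow> limit E) far"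
  using limit_exists tendsto_Lim[OF far_not_bot] unfolding limit_def by metis

lemma limit_modular:
  assumes E: "E \<in> ms" "E' \<in> ms"
  shows "limit (E \<union> E') + limit (E \<inter> E') = limit E + limit E'"
proof (rule tendsto_unique[OF far_not_bot])
  show "((\<lambda>g. m (agree E g) + m (agree E' g)) \<longlongrightarrow> limit E + limit E') far"
    by (intro tendsto_add limit E)
  have "((\<lambda>g. m (agree (E \<union> E') g) + m (agree (E \<inter> E') g)) \<longlongrightarrow> limit (E \<union> E') + limit (E \<inter> E')) far"
    by (intro tendsto_add limit ms_Un ms_Int E)
  then show "((\<lambda>g. m (agree E g) + m (agree E' g)) \<longlongrightarrow> limit (E \<union> E') + limit (E \<inter> E')) far"
    by (rule Lim_transform_eventually)
      (rule eventually_mono[OF eventually_far_Sym], rule agree_modular[OF E])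
qed

lemma limit_Lipschitz:
  assumes E: "E \<in> ms" "E' \<in> ms"
  shows "\<bar>limit E - limit E'\<bar> \<le> m (symdiff E E')"
proof (rule tendsto_upperbound[OF _ _ far_not_bot])
  show "((\<lambda>g. \<bar>m (agree E g) - m (agree E' g)\<bar>) \<longlongrightarrow> \<bar>limit E - limit E'\<bar>) far"
    by (intro tendsto_intros limit E)
  show "eventually (\<lambda>g. \<bar>m (agree E g) - m (agree E' g)\<bar> \<le> m (symdiff E E')) far"
    by (rule eventually_mono[OF eventually_far_Sym]) (rule agree_Lipschitz[OF E])
qed

lemma limit_nonneg: "E \<in> ms \<Longrightarrow> 0 \<le> limit E"
  by (rule tendsto_lowerbound[OF limit _ far_not_bot])
    (auto intro: eventually_mono[OF eventually_far_Sym] m_nonneg ms_agree)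

lemma limit_le_1: "E \<in> ms \<Longrightarrow> limit E \<le> 1"
  by (rule tendsto_upperbound[OF limit _ far_not_bot],
      assumption, rule eventually_mono[OF eventually_far_Sym])
    (metis m_Str m_mono ms_Str ms_agree ms_subset)

text \<open>Every translate of \<open>D0\<close> has the measure of \<open>D0\<close>, so the
  measure of disagreement with it bounds the difference of the measures; the bound passes to the
  limit.\<close>

lemma limit_measure_bound:
  assumes E: "E \<in> ms" shows "\<bar>m E - m D0\<bar> \<le> 1 - limit E"
proof (rule tendsto_lowerbound[OF _ _ far_not_bot])
  show "((\<lambda>g. 1 - m (agree E g)) \<longlongrightarrow> 1 - limit E) far" by (intro tendsto_intros limit E)
  show "eventually (\<lambda>g. \<bar>m E - m D0\<bar> \<le> 1 - m (agree E g)) far"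
  proof (rule eventually_mono[OF eventually_far_Sym])
    fix g assume g: "g \<in> Sym V X"
    show "\<bar>m E - m D0\<bar> \<le> 1 - m (agree E g)"
      using m_le_symdiff[OF ms_act[OF g ms_D0] E] m_act_D0[OF g] m_agree[OF E g] by simp
  qed
qed

lemma limit_D0:
  assumes "\<And>g. g \<in> Sym V X \<Longrightarrow> m (symdiff (act L X g ` D0) D0) \<le> \<epsilon>"
  shows "1 - \<epsilon> \<le> limit D0"
proof (rule tendsto_lowerbound[OF limit[OF ms_D0] _ far_not_bot])
  show "eventually (\<lambda>g. 1 - \<epsilon> \<le> m (agree D0 g)) far"
    by (rule eventually_mono[OF eventually_far_Sym]) (use assms m_agree[OF ms_D0] in force)
qed

text \<open>If \<open>g\<close> moves the support far away, so does \<open>h\<close> after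
  \<open>g\<close>. By \<open>agree_move\<close> a value close to the limit for the image of
  \<open>E\<close> then equals a value close to the limit for \<open>E\<close>.\<close>

lemma limit_act:
  assumes E: "E \<in> ms" and h: "h \<in> Sym V X"
  shows "limit (act L X h ` E) = limit E"
proof -
  note hE = ms_act[OF h E]
  have "\<bar>limit (act L X h ` E) - limit E\<bar> \<le> \<epsilon>" if "\<epsilon> > 0" for \<epsilon>
  proof -
    have e: "\<epsilon> / 2 > 0" using that by simp
    obtain F where F: "finite F" "\<And>g. g \<in> Sym V X \<Longrightarrow> app g ` support I0 \<inter> F = {} \<Longrightarrow>
        dist (m (agree E g)) (limit E) < \<epsilon> / 2"
      using tendstoD[OF limit[OF E] e] unfolding eventually_far by blast
    obtain F' where F': "finite F'" "\<And>g. g \<in> Sym V X \<Longrightarrow> app g ` support I0 \<inter> F' = {} \<Longrightarrow>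
        dist (m (agree (act L X h ` E) g)) (limit (act L X h ` E)) < \<epsilon> / 2"
      using tendstoD[OF limit[OF hE] e] unfolding eventually_far by blast
    \<comment> \<open>Avoiding the preimage of \<open>F'\<close> under \<open>h\<close> makes the
      composite avoid \<open>F'\<close>, while avoiding \<open>F\<close> keeps \<open>g\<close>
      itself far enough.\<close>
    have "finite (app h -` F' \<inter> elts X)" by (rule finite_vimage_IntI[OF F'(1) Sym_app_inj[OF h]])
    then obtain g where g: "g \<in> Sym V X" "app g ` support I0 \<inter> (F \<union> (app h -` F' \<inter> elts X)) = {}"
      using far_nonempty[of "F \<union> (app h -` F' \<inter> elts X)"] F(1) by auto
    have gX: "app g x \<in> elts X" if "x \<in> support I0" for x using Sym_app_mem[OF g(1)] that support_I0 by blast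
    have "inj_on (\<lambda>x. app h (app g x)) (support I0)"
    proof (rule inj_onI)
      fix x y assume "x \<in> support I0" "y \<in> support I0" "app h (app g x) = app h (app g y)"
      then show "x = y"
        using Sym_app_inj[OF h] Sym_app_inj[OF g(1)] gX support_I0(2) by (meson inj_onD subsetD)
    qed
    moreover have "(\<lambda>x. app h (app g x)) ` support I0 \<subseteq> elts X" using gX Sym_app_mem[OF h] by blast
    ultimately obtain k where k: "k \<in> Sym V X" "\<And>x. x \<in> support I0 \<Longrightarrow> app k x = app h (app g x)"
      using permutation_extension[OF X_mem support_I0] by metis
    have "app k ` support I0 \<inter> F' = {}" using g(2) gX k(2) by auto
    then have "dist (m (agree (act L X h ` E) k)) (limit (act L X h ` E)) < \<epsilon> / 2" by (rule F'(2)[OF k(1)])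
    moreover have "dist (m (agree E g)) (limit E) < \<epsilon> / 2" using g(2) by (intro F(2)[OF g(1)]) auto
    ultimately show ?thesis
      using agree_move[OF E g(1) h k(1,2)] unfolding dist_real_def by linarith
  qed
  then have "\<bar>limit (act L X h ` E) - limit E\<bar> \<le> 0" by (rule field_le_epsilon) simp
  then show ?thesis by simp
qed

text \<open>A substitute, expressible in \<open>V\<close>, for the comparison of
  \<open>limit E\<close> with a rational: it holds if \<open>r < limit E\<close> and implies
  \<open>r \<le> limit E\<close>. The boundary case stays open, which near maximality has to
  tolerate.\<close>

definition often :: "real \<Rightarrow> 'u set \<Rightarrow> bool" where
  "often r E \<longleftrightarrow> eventually (\<lambda>g. r < m (agree E g)) far"

lemma often_limit: "E \<in> ms \<Longrightarrow> often r E \<Longrightarrow> r \<le> limit E"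
  unfolding often_def
  by (rule tendsto_lowerbound[OF limit _ far_not_bot]) (auto elim: eventually_mono)

lemma limit_often: "E \<in> ms \<Longrightarrow> r < limit E \<Longrightarrow> often r E"
  unfolding often_def using order_tendstoD(1)[OF limit] .

definition often_code :: "'u \<Rightarrow> 'u \<Rightarrow> bool" where
  "often_code q x \<longleftrightarrow> (\<exists>F\<in>V. finite (elts F) \<and> (\<forall>g\<in>V. is_permutation X g \<and>
     (\<forall>x\<in>elts (as_set (support I0)). \<forall>y\<in>elts F. pair x y \<notin> elts g) \<longrightarrow>
     (\<exists>D\<in>V. \<exists>G\<in>V. maps_set V (as_set \<S>) g (as_set D0) D \<and> is_agreement V (as_set \<S>) D x G \<and> below V \<mu> G q)))"

lemma support_coded: "support I0 \<in> elts ` V"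
  using support_I0 elts_subset[OF X_mem] by (intro coded_finite) auto

lemma definable_often [definable_intros]:
  assumes "definable_term V q" "definable_term V x"
  shows "definable V (\<lambda>e. often_code (q e) (x e))"
proof (rule definable_subst2[OF _ assms])
  show "definable V (\<lambda>e. often_code (e 0) (e 1))"
    unfolding often_code_def
    by (intro definable_intros X_mem as_set_mem support_coded S_mem mu as_set_ms ms_D0)
qed

lemma ball_Sym:
  assumes "\<And>g. g \<in> V \<Longrightarrow> A g \<longleftrightarrow> (g \<in> Sym V X \<longrightarrow> B g)"
  shows "(\<forall>g\<in>V. A g) \<longleftrightarrow> (\<forall>g\<in>Sym V X. B g)"
  using assms Sym_V by blast

lemma often_code_iff:
  assumes E: "E \<in> ms" and c: "c > 0"
  shows "often_code (rational a b c) (as_set E) \<longleftrightarrow> often ((real a - real b) / real c) E"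
proof -
  have *: "(\<exists>D\<in>V. \<exists>G\<in>V. maps_set V (as_set \<S>) g (as_set D0) D \<and> is_agreement V (as_set \<S>) D (as_set E) G \<and>
      below V \<mu> G (rational a b c)) \<longleftrightarrow> (real a - real b) / real c < m (agree E g)"
    if g: "g \<in> Sym V X" for g
  proof -
    let ?D = "act L X g ` D0"
    have D: "?D \<in> ms" by (rule ms_act[OF g ms_D0])
    have "(\<exists>D\<in>V. \<exists>G\<in>V. maps_set V (as_set \<S>) g (as_set D0) D \<and> is_agreement V (as_set \<S>) D (as_set E) G \<and>
      below V \<mu> G (rational a b c)) \<longleftrightarrow> (\<exists>G\<in>V. is_agreement V (as_set \<S>) (as_set ?D) (as_set E) G \<and>
      below V \<mu> G (rational a b c))"
      using maps_set_ms_iff[OF g ms_D0] as_set_ms[OF D] by blast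
    also have "\<dots> \<longleftrightarrow> below V \<mu> (as_set (agree E g)) (rational a b c)"
      using is_agreement_iff[OF D E elts_as_set_ms[OF E]] as_set_ms[OF ms_agree[OF E g]]
      unfolding agree_def by blast
    also have "\<dots> \<longleftrightarrow> (real a - real b) / real c < m (agree E g)"
      by (rule below_rational[OF ms_agree[OF E g] c])
    finally show ?thesis .
  qed
  have off: "(\<forall>x\<in>support I0. \<forall>y\<in>elts F. pair x y \<notin> elts g) \<longleftrightarrow> app g ` support I0 \<inter> elts F = {}"
    if "g \<in> Sym V X" for g F
    using Sym_pair[OF that] support_I0(2) by auto
  have "often_code (rational a b c) (as_set E) \<longleftrightarrow> (\<exists>F\<in>V. finite (elts F) \<and> (\<forall>g\<in>Sym V X.
      app g ` support I0 \<inter> elts F = {} \<longrightarrow> (real a - real b) / real c < m (agree E g)))"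
    (is "_ \<longleftrightarrow> ?R")
  proof -
    have "(\<forall>g\<in>V. is_permutation X g \<and> (\<forall>x\<in>support I0. \<forall>y\<in>elts F. pair x y \<notin> elts g) \<longrightarrow>
        (\<exists>D\<in>V. \<exists>G\<in>V. maps_set V (as_set \<S>) g (as_set D0) D \<and> is_agreement V (as_set \<S>) D (as_set E) G \<and>
        below V \<mu> G (rational a b c))) \<longleftrightarrow>
      (\<forall>g\<in>Sym V X. app g ` support I0 \<inter> elts F = {} \<longrightarrow> (real a - real b) / real c < m (agree E g))" for F
    proof -
      have "(is_permutation X g \<and> (\<forall>x\<in>support I0. \<forall>y\<in>elts F. pair x y \<notin> elts g) \<longrightarrow>
        (\<exists>D\<in>V. \<exists>G\<in>V. maps_set V (as_set \<S>) g (as_set D0) D \<and> is_agreement V (as_set \<S>) D (as_set E) G \<and>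
        below V \<mu> G (rational a b c))) \<longleftrightarrow>
        (g \<in> Sym V X \<longrightarrow> app g ` support I0 \<inter> elts F = {} \<longrightarrow> (real a - real b) / real c < m (agree E g))"
        if "g \<in> V" for g
      proof (cases "g \<in> Sym V X")
        case True
        then show ?thesis using Sym_iff[OF X_mem, of g] by (simp only: * off simp_thms)
      next
        case False
        then show ?thesis using Sym_iff[OF X_mem, of g] that by simp
      qed
      then show ?thesis by (rule ball_Sym)
    qed
    then show ?thesis unfolding often_code_def elts_as_set_mem[OF support_coded] by simp
  qed
  also have "?R \<longleftrightarrow> often ((real a - real b) / real c) E"
    unfolding often_def eventually_far
  proof
    assume "\<exists>F. finite F \<and> (\<forall>g\<in>Sym V X. app g ` support I0 \<inter> F = {} \<longrightarrow>
      (real a - real b) / real c < m (agree E g))"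
    then obtain F where F: "finite F" "\<And>g. g \<in> Sym V X \<Longrightarrow> app g ` support I0 \<inter> F = {} \<Longrightarrow>
      (real a - real b) / real c < m (agree E g)" by blast
    \<comment> \<open>The filter uses arbitrary finite HOL sets, the code those in \<open>V\<close>.
      Translated supports stay in \<open>X\<close>, so the part of \<open>F\<close> inside
      \<open>X\<close> is enough, and it is in \<open>V\<close>.\<close>
    have "F \<inter> elts X \<in> elts ` V" using F(1) elts_subset[OF X_mem] by (intro coded_finite) auto
    then obtain f where f: "f \<in> V" "elts f = F \<inter> elts X" by blast
    have "app g ` support I0 \<inter> F = {}" if "g \<in> Sym V X" "app g ` support I0 \<inter> elts f = {}" for g
      using that(2) Sym_app_mem[OF that(1)] support_I0(2) unfolding f(2) by auto
    then show ?R using f F by (intro bexI[OF _ f(1)]) auto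
  qed blast
  finally show ?thesis .
qed

end

section \<open>Ergodicity and nearly invariant clopen sets\<close>

lemma dyadic_floor:
  assumes "0 \<le> (s :: real)"
  obtains j :: nat where "real j / 2 ^ n \<le> s" "s < (real j + 1) / 2 ^ n"
proof
  show "real (nat \<lfloor>s * 2 ^ n\<rfloor>) / 2 ^ n \<le> s"
    using assms by (simp add: divide_le_eq)
  show "s < (real (nat \<lfloor>s * 2 ^ n\<rfloor>) + 1) / 2 ^ n"
    using assms by (simp add: less_divide_eq)
qed

context invariant_clopen
begin

text \<open>The supremum of \<open>limit\<close> is replaced by a dyadic bracket: if
  \<open>j / 2 ^ n\<close> is its dyadic floor, some set exceeds the lower bound strictly and none
  exceeds the upper one. A full step of slack below gives existence; the bracket is two steps wide,
  whence the error \<open>2 / 2 ^ n\<close>.\<close>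

definition near_max :: "nat \<Rightarrow> 'u set \<Rightarrow> bool" where
  "near_max n E \<longleftrightarrow> (\<exists>j::nat. often ((real j - 1) / 2 ^ n) E \<and>
     (\<forall>E'\<in>ms. \<not> often ((real j + 1) / 2 ^ n) E'))"

text \<open>The second stage of a lexicographic maximization, with the same bracket for
  \<open>m\<close> among the near maximizers of level \<open>n\<close>. True maximizers are near
  maximizers of every level, so their measures are covered by the upper bound.\<close>

definition near_max_measure :: "nat \<Rightarrow> 'u set \<Rightarrow> bool" where
  "near_max_measure n E \<longleftrightarrow> near_max n E \<and> (\<exists>j::nat. (real j - 1) / 2 ^ n < m E \<and>
     (\<forall>E'\<in>ms. near_max n E' \<longrightarrow> \<not> (real j + 1) / 2 ^ n < m E'))"

lemma near_max_limit:
  assumes "E \<in> ms" "near_max n E" "E' \<in> ms"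
  shows "limit E' \<le> limit E + 2 / 2 ^ n"
proof -
  obtain j :: nat where j: "often ((real j - 1) / 2 ^ n) E" "\<And>E'. E' \<in> ms \<Longrightarrow> \<not> often ((real j + 1) / 2 ^ n) E'"
    using assms(2) unfolding near_max_def by blast
  have "(real j - 1) / 2 ^ n \<le> limit E" by (rule often_limit[OF assms(1) j(1)])
  moreover have "limit E' \<le> (real j + 1) / 2 ^ n" using limit_often[OF assms(3)] j(2)[OF assms(3)] by force
  ultimately show ?thesis by (simp add: field_simps)
qed

lemma near_max_measure_bound:
  assumes "near_max_measure n E" "E' \<in> ms" "near_max n E'"
  shows "m E' \<le> m E + 2 / 2 ^ n"
proof -
  obtain j :: nat where j: "(real j - 1) / 2 ^ n < m E" "m E' \<le> (real j + 1) / 2 ^ n"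
    using assms unfolding near_max_measure_def by (metis not_less)
  then show ?thesis by (simp add: field_simps)
qed

lemma bdd_limit: "bdd_above (limit ` ms)"
  using limit_le_1 by (intro bdd_aboveI[of _ 1]) auto

lemma near_max_if:
  assumes "E \<in> ms" "real j / 2 ^ n \<le> Sup (limit ` ms)" "Sup (limit ` ms) < (real j + 1) / 2 ^ n"
    and "(real j - 1) / 2 ^ n < limit E"
  shows "near_max n E"
  unfolding near_max_def
proof (intro exI conjI ballI)
  show "often ((real j - 1) / 2 ^ n) E" by (rule limit_often[OF assms(1,4)])
  show "\<not> often ((real j + 1) / 2 ^ n) E'" if "E' \<in> ms" for E'
    using often_limit[OF that] assms(3) cSUP_upper[OF that bdd_limit] by fastforce
qed

lemma Sup_limit_nonneg: "0 \<le> Sup (limit ` ms)"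
  using cSUP_upper[OF ms_Str bdd_limit] limit_nonneg[OF ms_Str] by simp

lemma near_max_maximizer:
  assumes E: "E \<in> ms" and max: "\<And>E'. E' \<in> ms \<Longrightarrow> limit E' \<le> limit E"
  shows "near_max n E"
proof -
  obtain j :: nat where j: "real j / 2 ^ n \<le> Sup (limit ` ms)" "Sup (limit ` ms) < (real j + 1) / 2 ^ n"
    using dyadic_floor[OF Sup_limit_nonneg] by blast
  have "Sup (limit ` ms) \<le> limit E" using max E by (intro cSUP_least) auto
  moreover have "(real j - 1) / 2 ^ n < real j / 2 ^ n" by (simp add: divide_strict_right_mono)
  ultimately show ?thesis using j by (intro near_max_if[OF E j]) linarith
qed

lemma near_max_measure_exists: "\<exists>E\<in>ms. near_max_measure n E"
proof -
  obtain j :: nat where j: "real j / 2 ^ n \<le> Sup (limit ` ms)" "Sup (limit ` ms) < (real j + 1) / 2 ^ n"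
    using dyadic_floor[OF Sup_limit_nonneg] by blast
  have "(real j - 1) / 2 ^ n < real j / 2 ^ n" by (simp add: divide_strict_right_mono)
  then have "(real j - 1) / 2 ^ n < Sup (limit ` ms)" using j by linarith
  then obtain E where "E \<in> ms" "(real j - 1) / 2 ^ n < limit E"
    using less_cSUP_iff[OF _ bdd_limit] ms_Str by blast
  then have E: "E \<in> ms" "near_max n E" using near_max_if[OF _ j] by blast+
  define T where "T = {E \<in> ms. near_max n E}"
  have T: "E \<in> T" "T \<subseteq> ms" using E by (auto simp: T_def)
  have m1: "m E' \<le> 1" if "E' \<in> ms" for E' using m_mono[OF that ms_Str ms_subset[OF that]] m_Str by simp
  have bdd: "bdd_above (m ` T)" using m1 T(2) by (intro bdd_aboveI[of _ 1]) auto
  have "0 \<le> Sup (m ` T)" using cSUP_upper[OF T(1) bdd] m_nonneg[OF E(1)] by simp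
  then obtain i :: nat where i: "real i / 2 ^ n \<le> Sup (m ` T)" "Sup (m ` T) < (real i + 1) / 2 ^ n"
    using dyadic_floor by blast
  have "(real i - 1) / 2 ^ n < real i / 2 ^ n" by (simp add: divide_strict_right_mono)
  then have "(real i - 1) / 2 ^ n < Sup (m ` T)" using i by linarith
  then obtain E' where E': "E' \<in> T" "(real i - 1) / 2 ^ n < m E'"
    using less_cSUP_iff[OF _ bdd] T(1) by blast
  have "near_max_measure n E'"
    unfolding near_max_measure_def
  proof (intro conjI exI ballI impI)
    show "near_max n E'" using E'(1) by (simp add: T_def)
    show "(real i - 1) / 2 ^ n < m E'" by (rule E'(2))
    show "\<not> (real i + 1) / 2 ^ n < m E''" if "E'' \<in> ms" "near_max n E''" for E''
      using cSUP_upper[OF _ bdd, of E''] that i(2) by (auto simp: T_def)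
  qed
  then show ?thesis using E'(1) T(2) by blast
qed

text \<open>With \<open>p\<close> the numeral of \<open>2 ^ n\<close>, the triples code
  \<open>(j - 1) / 2 ^ n\<close> and \<open>(j + 1) / 2 ^ n\<close>. The subtrahend in the code of
  rationals and \<open>succ\<close> do the arithmetic.\<close>

definition near_max_code :: "'u \<Rightarrow> 'u \<Rightarrow> bool" where
  "near_max_code p x \<longleftrightarrow> (\<exists>j\<in>elts omega. often_code (pair j (pair (numeral_set 1) p)) x \<and>
     (\<forall>x'\<in>elts MS. \<not> often_code (pair (succ j) (pair (numeral_set 0) p)) x'))"

definition near_max_measure_code :: "'u \<Rightarrow> 'u \<Rightarrow> bool" where
  "near_max_measure_code p x \<longleftrightarrow> near_max_code p x \<and>
     (\<exists>j\<in>elts omega. below V \<mu> x (pair j (pair (numeral_set 1) p)) \<and>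
       (\<forall>x'\<in>elts MS. near_max_code p x' \<longrightarrow> \<not> below V \<mu> x' (pair (succ j) (pair (numeral_set 0) p))))"

lemma ball_MS: "(\<forall>x\<in>elts MS. P x) \<longleftrightarrow> (\<forall>A\<in>ms. P (as_set A))"
  unfolding elts_MS by blast

lemma bex_omega: "(\<exists>j\<in>elts omega. P j) \<longleftrightarrow> (\<exists>j. P (numeral_set j))"
  unfolding elts_omega by blast

lemma near_max_code_iff:
  assumes "E \<in> ms" shows "near_max_code (numeral_set (2 ^ n)) (as_set E) \<longleftrightarrow> near_max n E"
proof -
  have "often_code (pair (numeral_set j) (pair (numeral_set 1) (numeral_set (2 ^ n)))) (as_set E) \<longleftrightarrow>
      often ((real j - 1) / 2 ^ n) E" for j
    using often_code_iff[OF assms, of "2 ^ n" j 1] by (simp add: rational_def)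
  moreover have "often_code (pair (succ (numeral_set j)) (pair (numeral_set 0) (numeral_set (2 ^ n)))) (as_set E') \<longleftrightarrow>
      often ((real j + 1) / 2 ^ n) E'" if "E' \<in> ms" for E' j
    using often_code_iff[OF that, of "2 ^ n" "Suc j" 0] by (simp add: rational_def numeral_set_Suc add.commute)
  ultimately show ?thesis unfolding near_max_code_def near_max_def ball_MS bex_omega by simp
qed

lemma near_max_measure_code_iff:
  assumes "E \<in> ms" shows "near_max_measure_code (numeral_set (2 ^ n)) (as_set E) \<longleftrightarrow> near_max_measure n E"
proof -
  have "below V \<mu> (as_set E) (pair (numeral_set j) (pair (numeral_set 1) (numeral_set (2 ^ n)))) \<longleftrightarrow>
      (real j - 1) / 2 ^ n < m E" for j
    using below_rational[OF assms, of "2 ^ n" j 1] by (simp add: rational_def)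
  moreover have "below V \<mu> (as_set E') (pair (succ (numeral_set j)) (pair (numeral_set 0) (numeral_set (2 ^ n)))) \<longleftrightarrow>
      (real j + 1) / 2 ^ n < m E'" if "E' \<in> ms" for E' j
    using below_rational[OF that, of "2 ^ n" "Suc j" 0] by (simp add: rational_def numeral_set_Suc add.commute)
  ultimately show ?thesis
    unfolding near_max_measure_code_def near_max_measure_def ball_MS bex_omega near_max_code_iff[OF assms]
    by (simp add: near_max_code_iff)
qed

text \<open>Choice inside \<open>V\<close> demands one definable relation between \<open>n\<close>
  and the chosen set; definability of \<open>2 ^ n\<close> makes the condition uniform in
  \<open>n\<close>.\<close>

lemma near_max_sequence:
  obtains f where "f \<in> V" "function_on f (elts omega)"
    "\<And>n. elts (app f (numeral_set n)) \<in> ms" "\<And>n. near_max_measure n (elts (app f (numeral_set n)))"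
proof -
  obtain R where R: "definable V (\<lambda>e. R (e 0) (e 1))"
    "\<And>n y. y \<in> V \<Longrightarrow> R (numeral_set n) y \<longleftrightarrow> y = numeral_set (2 ^ n)"
    using definable_power_of_2 unfolding definable_nat_fun_def by blast
  let ?R = "\<lambda>x y. \<exists>p\<in>V. R x p \<and> near_max_measure_code p y"
  have iff: "?R (numeral_set n) y \<longleftrightarrow> near_max_measure n (elts y)" if "elts y \<in> ms" for n y
    using near_max_measure_code_iff[OF that, of n] numeral_mem by (auto simp: R(2))
  have "definable V (\<lambda>e. ?R (e 0) (e 1))"
    unfolding near_max_measure_code_def near_max_code_def
    by (intro definable_intros definable_subst2[OF R(1)] omega_mem MS_mem numeral_mem mu)
  moreover have "\<exists>y\<in>elts MS. ?R (numeral_set n) y" for n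
  proof -
    obtain E where E: "E \<in> ms" "near_max_measure n E" using near_max_measure_exists by blast
    then have "as_set E \<in> elts MS" by (simp add: elts_MS)
    then show ?thesis using iff[of "as_set E" n] E elts_as_set_ms[OF E(1)] by auto
  qed
  ultimately obtain f where f: "f \<in> V" "function_on f (elts omega)"
    "\<And>n. app f (numeral_set n) \<in> elts MS" "\<And>n. ?R (numeral_set n) (app f (numeral_set n))"
    using sequence_choice[of ?R, OF _ elts_image[OF MS_mem]] by blast
  have "elts (app f (numeral_set n)) \<in> ms" for n using f(3) mem_MS by blast
  then show ?thesis using that f iff by blast
qed

text \<open>The limes superior of near maximizers, as in the proof of the Hahn decomposition theorem.\<close>

lemma maximizer_exists:
  obtains P where "P \<in> ms" "\<And>E. E \<in> ms \<Longrightarrow> limit E \<le> limit P"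
    "\<And>E. E \<in> ms \<Longrightarrow> limit E = limit P \<Longrightarrow> m E \<le> m P"
proof -
  obtain f where f: "f \<in> V" "function_on f (elts omega)"
    "\<And>n. elts (app f (numeral_set n)) \<in> ms" "\<And>n. near_max_measure n (elts (app f (numeral_set n)))"
    using near_max_sequence by blast
  define E where "E n = elts (app f (numeral_set n))" for n
  have E: "E n \<in> ms" "near_max_measure n (E n)" "near_max n (E n)" for n
    using f(3,4) unfolding E_def near_max_measure_def by auto
  have pair_f: "pair (numeral_set n) a \<in> elts f \<longleftrightarrow> a = as_set (E n)" for n a
    using function_on_iff[OF f(2), of "numeral_set n"] by (simp add: elts_omega E_def)
  define s where "s = Sup (limit ` ms)"
  have s: "limit A \<le> s" if "A \<in> ms" for A unfolding s_def by (rule cSUP_upper[OF that bdd_limit])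
  have sE: "s - 2 / 2 ^ n \<le> limit (E n)" for n
  proof -
    have "s \<le> limit (E n) + 2 / 2 ^ n"
      unfolding s_def using near_max_limit[OF E(1,3)] ms_Str by (intro cSUP_least) auto
    then show ?thesis by simp
  qed
  \<comment> \<open>The tails are padded with empty sets, so that each is a union over all natural
    numbers as \<open>omega_Union\<close> requires.\<close>
  define T where "T n = (\<Union>k. if n \<le> k then E k else {})" for n
  have T_alt: "T n = (\<Union>k\<in>{n..}. E k)" for n unfolding T_def by (auto split: if_splits)
  have T: "T n \<in> ms \<and> (\<forall>\<epsilon>>0. \<exists>N. m (T n) < m (\<Union>k\<le>N. if n \<le> k then E k else {}) + \<epsilon>)" for n
  proof -
    let ?R = "\<lambda>x y. x \<notin> elts (numeral_set n) \<and> pair x y \<in> elts f \<or> x \<in> elts (numeral_set n) \<and> y = as_set {}"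
    have R: "definable V (\<lambda>e. ?R (e 0) (e 1))"
      by (intro definable_intros numeral_mem f as_set_ms ms_empty)
    have ms: "(if n \<le> k then E k else {}) \<in> ms" for k using E(1) ms_empty by simp
    have iff: "?R (numeral_set k) y \<longleftrightarrow> y = as_set (if n \<le> k then E k else {})" for k y
      by (auto simp: pair_f)
    show ?thesis unfolding T_def using omega_Union[OF R ms iff] by blast
  qed
  have Tms: "T n \<in> ms" for n using T by blast
  have T_subset: "T n \<subseteq> \<S>" for n by (rule ms_subset[OF Tms])
  \<comment> \<open>The intersection of the decreasing tails, written as the complement of a union
    so that \<open>omega_Union\<close> applies again.\<close>
  define P where "P = \<S> - (\<Union>n. \<S> - T n)"
  have P: "(\<Union>n. \<S> - T n) \<in> ms \<and> (\<forall>\<epsilon>>0. \<exists>N. m (\<Union>n. \<S> - T n) < m (\<Union>n\<le>N. \<S> - T n) + \<epsilon>)"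
  proof -
    let ?R = "\<lambda>x y. \<forall>N\<in>V. N \<in> elts y \<longleftrightarrow> N \<in> elts (as_set \<S>) \<and>
      (\<forall>k\<in>elts omega. k \<notin> elts x \<longrightarrow> (\<forall>a\<in>V. pair k a \<in> elts f \<longrightarrow> N \<notin> elts a))"
    have R: "definable V (\<lambda>e. ?R (e 0) (e 1))" by (intro definable_intros omega_mem f S_mem)
    have ms: "\<S> - T n \<in> ms" for n by (rule ms_compl[OF Tms])
    have iff: "?R (numeral_set n) y \<longleftrightarrow> y = as_set (\<S> - T n)" if "y \<in> V" for n y
    proof -
      have "(N \<in> elts (as_set \<S>) \<and> (\<forall>k\<in>elts omega. k \<notin> elts (numeral_set n) \<longrightarrow>
          (\<forall>a\<in>V. pair k a \<in> elts f \<longrightarrow> N \<notin> elts a))) \<longleftrightarrow> N \<in> \<S> - T n" for N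
        using as_set_ms[OF E(1)] elts_as_set_ms[OF E(1)]
        by (auto simp: elts_omega pair_f T_alt not_less)
      then show ?thesis using coded_eq_iff[OF ms_coded[OF ms] that] by simp
    qed
    show ?thesis using omega_Union[OF R ms iff] by blast
  qed
  have Pms: "P \<in> ms" unfolding P_def using P by (intro ms_compl) blast
  have P_T: "P \<subseteq> T n" for n using T_subset unfolding P_def by blast
  have T_dec: "T k \<subseteq> T n" if "n \<le> k" for n k using that unfolding T_alt by (intro UN_mono) auto
  have TP: "\<exists>N\<ge>n. m (symdiff (T N) P) < \<epsilon>" if "\<epsilon> > 0" for \<epsilon> n
  proof -
    obtain N where N: "m (\<Union>n. \<S> - T n) < m (\<Union>n\<le>N. \<S> - T n) + \<epsilon>" using P \<open>\<epsilon> > 0\<close> by blast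
    let ?N = "max n N"
    have "m (\<Union>n\<le>N. \<S> - T n) \<le> m (\<S> - T ?N)"
    proof (rule m_mono)
      show "(\<Union>n\<le>N. \<S> - T n) \<in> ms" by (intro ms_finite_Union) (auto simp: ms_compl Tms)
      show "\<S> - T ?N \<in> ms" by (rule ms_compl[OF Tms])
      have "T ?N \<subseteq> T k" if "k \<le> N" for k using that by (intro T_dec) simp
      then show "(\<Union>n\<le>N. \<S> - T n) \<subseteq> \<S> - T ?N" by blast
    qed
    moreover have "m (\<Union>n. \<S> - T n) = 1 - m P"
    proof -
      have "(\<Union>n. \<S> - T n) = \<S> - P" unfolding P_def by blast
      then show ?thesis using m_compl[OF Pms] by simp
    qed
    ultimately have "m (T ?N) - m P < \<epsilon>" using N m_compl[OF Tms, of ?N] by simp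
    moreover have "symdiff (T ?N) P = T ?N - P" using P_T by blast
    ultimately have "m (symdiff (T ?N) P) < \<epsilon>" using m_Diff[OF Tms Pms P_T] by simp
    then show ?thesis by (intro exI[of _ ?N]) simp
  qed
  have U_ms: "(\<Union>k\<in>{n..n + j}. E k) \<in> ms" for n j by (intro ms_finite_Union) (auto simp: E(1))
  \<comment> \<open>By modularity, adding \<open>E k\<close> lowers the value by at most
    \<open>2 / 2 ^ k\<close>, as the limit of the intersection is at most \<open>s\<close>. These
    losses for \<open>k \<ge> n\<close> sum to \<open>4 / 2 ^ n\<close>; the last term is the part
    not yet spent.\<close>
  have U: "s - 4 / 2 ^ n + 4 / 2 ^ (n + j + 1) \<le> limit (\<Union>k\<in>{n..n + j}. E k)" for n j
  proof (induction j)
    case 0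
    show ?case using sE[of n] by simp
  next
    case (Suc j)
    let ?U = "\<Union>k\<in>{n..n + j}. E k"
    have eq: "(\<Union>k\<in>{n..n + Suc j}. E k) = ?U \<union> E (n + Suc j)"
      by (simp add: atLeastAtMostSuc_conv Un_commute)
    have "limit (?U \<union> E (n + Suc j)) + limit (?U \<inter> E (n + Suc j)) = limit ?U + limit (E (n + Suc j))"
      by (rule limit_modular[OF U_ms E(1)])
    moreover have "limit (?U \<inter> E (n + Suc j)) \<le> s" by (intro s ms_Int U_ms E(1))
    moreover have "(4::real) / 2 ^ (n + j + 1) - 2 / 2 ^ (n + Suc j) = 4 / 2 ^ (n + Suc j + 1)" by simp
    ultimately show ?case unfolding eq using Suc sE[of "n + Suc j"] by linarith
  qed
  \<comment> \<open>The passage to infinite unions uses continuity of \<open>limit\<close>: finite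
    unions approximate \<open>T n\<close> in measure, and \<open>limit_Lipschitz\<close> turns this
    into closeness of the limits.\<close>
  have sT: "s - 4 / 2 ^ n \<le> limit (T n)" for n
  proof (rule field_le_epsilon)
    fix \<epsilon> :: real assume "\<epsilon> > 0"
    then obtain N where N: "m (T n) < m (\<Union>k\<le>N. if n \<le> k then E k else {}) + \<epsilon>" using T by blast
    let ?U = "\<Union>k\<in>{n..n + N}. E k"
    have sub: "(\<Union>k\<le>N. if n \<le> k then E k else {}) \<subseteq> ?U" "?U \<subseteq> T n"
      unfolding T_alt by (auto split: if_splits intro!: bexI)
    have "m (\<Union>k\<le>N. if n \<le> k then E k else {}) \<le> m ?U"
      by (rule m_mono[OF _ U_ms sub(1)]) (auto intro!: ms_finite_Union simp: E(1) ms_empty)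
    then have "m (symdiff (T n) ?U) \<le> \<epsilon>" using N m_Diff[OF Tms U_ms sub(2)] sub(2)
      by (simp add: Diff_eq_empty_iff[THEN iffD2])
    then have "\<bar>limit (T n) - limit ?U\<bar> \<le> \<epsilon>" using limit_Lipschitz[OF Tms U_ms, of n n N] by linarith
    moreover have "0 \<le> (4::real) / 2 ^ (n + N + 1)" by simp
    ultimately show "s - 4 / 2 ^ n \<le> limit (T n) + \<epsilon>" using U[of n N] by linarith
  qed
  have small: "\<exists>n. (4::real) / 2 ^ n < \<epsilon>" if \<epsilon>: "\<epsilon> > 0" for \<epsilon>
  proof -
    obtain n where "(1 / 2 :: real) ^ n < \<epsilon> / 4" using real_arch_pow_inv[of "\<epsilon> / 4" "1 / 2"] \<epsilon> by auto
    then show ?thesis by (intro exI[of _ n]) (simp add: power_divide field_simps)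
  qed
  have "s \<le> limit P"
  proof (rule field_le_epsilon)
    fix \<epsilon> :: real assume \<epsilon>: "\<epsilon> > 0"
    obtain n where n: "(4::real) / 2 ^ n < \<epsilon> / 2" using small[of "\<epsilon> / 2"] \<epsilon> by auto
    obtain N where N: "N \<ge> n" "m (symdiff (T N) P) < \<epsilon> / 2" using TP[of "\<epsilon> / 2" n] \<epsilon> by auto
    have "(4::real) / 2 ^ N \<le> 4 / 2 ^ n" using N(1) by (intro divide_left_mono) auto
    then show "s \<le> limit P + \<epsilon>" using sT[of N] n N(2) limit_Lipschitz[OF Tms Pms, of N] by linarith
  qed
  then have lP: "limit P = s" using s[OF Pms] by simp
  show ?thesis
  proof
    show "P \<in> ms" by (rule Pms)
    show "limit A \<le> limit P" if "A \<in> ms" for A using s[OF that] lP by simp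
    fix A assume A: "A \<in> ms" "limit A = limit P"
    \<comment> \<open>A maximizer is a near maximizer of every level, so \<open>m A\<close> exceeds
      the measure of each \<open>E n\<close> by at most \<open>2 / 2 ^ n\<close>. The tails contain
      the \<open>E n\<close> and some of them, arbitrarily far out, are close to
      \<open>P\<close>.\<close>
    have nm: "near_max n A" for n using s lP A by (intro near_max_maximizer) auto
    show "m A \<le> m P"
    proof (rule field_le_epsilon)
      fix \<epsilon> :: real assume \<epsilon>: "\<epsilon> > 0"
      obtain n where n: "(4::real) / 2 ^ n < \<epsilon> / 2" using small[of "\<epsilon> / 2"] \<epsilon> by auto
      obtain N where N: "N \<ge> n" "m (symdiff (T N) P) < \<epsilon> / 2" using TP[of "\<epsilon> / 2" n] \<epsilon> by auto
      have "(4::real) / 2 ^ N \<le> 4 / 2 ^ n" using N(1) by (intro divide_left_mono) auto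
      moreover have "m (E N) \<le> m (T N)" by (intro m_mono E(1) Tms) (auto simp: T_alt)
      moreover have "0 < (2::real) / 2 ^ N" by simp
      ultimately show "m A \<le> m P + \<epsilon>"
        using near_max_measure_bound[OF E(2) A(1) nm, of N] m_le_symdiff[OF Tms Pms, of N] N(2) n by linarith
    qed
  qed
qed

text \<open>The image of \<open>P\<close> is a maximizer too, and modularity forces the union and
  the intersection to be maximizers. The union then has measure at most \<open>m P\<close>, and
  invariance of \<open>m\<close> leaves measure 0 for the symmetric difference.\<close>

lemma almost_invariant_near_D0:
  obtains P where "P \<in> ms" "almost_invariant V L X \<mu> P" "limit D0 \<le> limit P"
proof -
  obtain P where P: "P \<in> ms" "\<And>E. E \<in> ms \<Longrightarrow> limit E \<le> limit P"
    "\<And>E. E \<in> ms \<Longrightarrow> limit E = limit P \<Longrightarrow> m E \<le> m P"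
    using maximizer_exists by blast
  have "m (symdiff (act L X g ` P) P) = 0" if g: "g \<in> Sym V X" for g
  proof -
    let ?P = "act L X g ` P"
    have gP: "?P \<in> ms" by (rule ms_act[OF g P(1)])
    have "limit (P \<union> ?P) + limit (P \<inter> ?P) = limit P + limit P"
      using limit_modular[OF P(1) gP] limit_act[OF P(1) g] by simp
    then have "limit (P \<union> ?P) = limit P"
      using P(2)[OF ms_Un[OF P(1) gP]] P(2)[OF ms_Int[OF P(1) gP]] by linarith
    then have "m (P \<union> ?P) \<le> m P" by (rule P(3)[OF ms_Un[OF P(1) gP]])
    moreover have "m (P \<union> ?P) + m (P \<inter> ?P) = m P + m P"
      using m_modular[OF P(1) gP] invariant[OF g P(1)] by simp
    ultimately have "m (symdiff ?P P) \<le> 0"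
      using m_symdiff[OF gP P(1)] invariant[OF g P(1)] by (simp add: Int_commute)
    then show ?thesis using m_nonneg[OF ms_symdiff[OF gP P(1)]] by simp
  qed
  then have "almost_invariant V L X \<mu> P" unfolding almost_invariant_def by blast
  then show ?thesis using that P(1) P(2)[OF ms_D0] by blast
qed

end

text \<open>Injections of the finite support take the place of the permutations of a model, which makes the
  notion absolute.\<close>

definition nearly_invariant_clopen ::
    "'u::set_universe \<Rightarrow> 'u \<Rightarrow> (('u \<times> 'u list) set \<Rightarrow> (('u \<times> 'u list) set \<Rightarrow> bool) \<Rightarrow> real) \<Rightarrow> bool" where
  "nearly_invariant_clopen L X v \<longleftrightarrow> (\<exists>I Q \<epsilon>. finite I \<and> I \<subseteq> atoms L X \<and> \<epsilon> < v I Q \<and> v I Q < 1 - \<epsilon> \<and>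
     (\<forall>\<sigma>. inj_on \<sigma> (support I) \<longrightarrow> \<sigma> ` support I \<subseteq> elts X \<longrightarrow>
        v (move \<sigma> ` I \<union> I) (\<lambda>S. Q {a \<in> I. move \<sigma> a \<in> S} \<noteq> Q (S \<inter> I)) \<le> \<epsilon>))"

section \<open>Non-ergodicity in a single model\<close>

context invariant_kappa_measure
begin

text \<open>On the right only \<sigma> on the finite support remains, not the permutation; this is
  the set whose measure \<open>nearly_invariant_clopen\<close> bounds.\<close>

lemma symdiff_act_clo:
  assumes g: "g \<in> Sym V X" and I: "I \<subseteq> atoms L X" and \<sigma>: "\<And>x. x \<in> support I \<Longrightarrow> app g x = \<sigma> x"
  shows "symdiff (act L X g ` clo I Q) (clo I Q) =
    clo (move \<sigma> ` I \<union> I) (\<lambda>S. Q {a \<in> I. move \<sigma> a \<in> S} \<noteq> Q (S \<inter> I))"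
proof -
  have mv: "move (app g) a = move \<sigma> a" if "a \<in> I" for a
    by (rule move_cong[OF order_refl \<sigma> that])
  have "{a \<in> I. move (app g) a \<in> S \<inter> move (app g) ` I} = {a \<in> I. move \<sigma> a \<in> S}" for S
    using mv by auto
  moreover have "move (app g) ` I = move \<sigma> ` I" using mv by auto
  ultimately show ?thesis unfolding act_clopen[OF g I] clo_symdiff by simp
qed

lemma not_ergodic_iff:
  "\<not> ergodic V \<kappa> L X \<mu> \<longleftrightarrow> nearly_invariant_clopen L X (\<lambda>I Q. m (clo I Q))"
proof
  assume "\<not> ergodic V \<kappa> L X \<mu>"
  moreover have "invariant_measure V \<kappa> L X \<mu>"
    unfolding invariant_measure_def using measure invariant by blast
  ultimately obtain A where A: "A \<in> ms" "almost_invariant V L X \<mu> A" "m A \<noteq> 0" "m A \<noteq> 1"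
    unfolding ergodic_def by blast
  have A1: "0 < m A" "m A < 1"
    using A(3,4) m_nonneg[OF A(1)] m_mono[OF A(1) ms_Str ms_subset[OF A(1)]] m_Str by simp_all
  \<comment> \<open>The clopen \<open>C\<close> is within \<delta> of \<open>A\<close>, so its
    translates are within 2 \<delta> of \<open>C\<close>, and \<open>m C\<close> keeps a distance of
    more than 3 \<delta> from 0 and 1. Hence 2 \<delta> can play the part of \<epsilon>.\<close>
  define \<delta> where "\<delta> = min (m A) (1 - m A) / 4"
  have \<delta>: "\<delta> > 0" "4 * \<delta> \<le> m A" "4 * \<delta> \<le> 1 - m A" using A1 unfolding \<delta>_def by auto
  obtain I Q where I: "finite I" "I \<subseteq> atoms L X" "m (symdiff A (clo I Q)) < \<delta>"
    using clopen_approximation[OF A(1) \<delta>(1)] by blast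
  let ?C = "clo I Q"
  have C: "?C \<in> ms" by (rule ms_clo[OF I(1,2)])
  have mC: "\<bar>m A - m ?C\<bar> < \<delta>" using m_le_symdiff[OF A(1) C] I(3) by simp
  have small: "m (symdiff (act L X g ` ?C) ?C) \<le> 2 * \<delta>" if g: "g \<in> Sym V X" for g
  proof -
    have gA: "act L X g ` A \<in> ms" "act L X g ` ?C \<in> ms" using ms_act[OF g] A(1) C by blast+
    have "symdiff (act L X g ` ?C) (act L X g ` A) = act L X g ` (symdiff A ?C)"
      unfolding image_Un act_Diff[OF g ms_subset[OF A(1)] ms_subset[OF C]]
        act_Diff[OF g ms_subset[OF C] ms_subset[OF A(1)]] by (rule Un_commute)
    then have "m (symdiff (act L X g ` ?C) (act L X g ` A)) < \<delta>"
      using invariant[OF g ms_symdiff[OF A(1) C]] I(3) by simp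
    moreover have "m (symdiff (act L X g ` A) A) = 0" using A(2) g unfolding almost_invariant_def by blast
    ultimately show ?thesis
      using m_symdiff_triangle[OF gA(2,1) C] m_symdiff_triangle[OF gA(1) A(1) C] I(3) by linarith
  qed
  show "nearly_invariant_clopen L X (\<lambda>I Q. m (clo I Q))"
    unfolding nearly_invariant_clopen_def
  proof (intro exI conjI allI impI)
    show "finite I" "I \<subseteq> atoms L X" by (rule I)+
    show "2 * \<delta> < m ?C" "m ?C < 1 - 2 * \<delta>" using mC \<delta> by linarith+
    fix \<sigma> assume "inj_on \<sigma> (support I)" "\<sigma> ` support I \<subseteq> elts X"
    then obtain g where g: "g \<in> Sym V X" "\<And>x. x \<in> support I \<Longrightarrow> app g x = \<sigma> x"
      using permutation_extension[OF X_mem finite_support[OF I(1)] support_atoms[OF I(2)]] by blast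
    show "m (clo (move \<sigma> ` I \<union> I) (\<lambda>S. Q {a \<in> I. move \<sigma> a \<in> S} \<noteq> Q (S \<inter> I))) \<le> 2 * \<delta>"
    proof -
      have "symdiff (act L X g ` ?C) ?C = clo (move \<sigma> ` I \<union> I) (\<lambda>S. Q {a \<in> I. move \<sigma> a \<in> S} \<noteq> Q (S \<inter> I))"
        by (rule symdiff_act_clo[OF g(1) I(2)]) (rule g(2))
      then show ?thesis using small[OF g(1)] by (simp only:)
    qed
  qed
next
  assume "nearly_invariant_clopen L X (\<lambda>I Q. m (clo I Q))"
  then obtain I Q \<epsilon> where I: "finite I" "I \<subseteq> atoms L X" and \<epsilon>: "\<epsilon> < m (clo I Q)" "m (clo I Q) < 1 - \<epsilon>"
    and small: "\<And>\<sigma>. inj_on \<sigma> (support I) \<Longrightarrow> \<sigma> ` support I \<subseteq> elts X \<Longrightarrow>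
      m (clo (move \<sigma> ` I \<union> I) (\<lambda>S. Q {a \<in> I. move \<sigma> a \<in> S} \<noteq> Q (S \<inter> I))) \<le> \<epsilon>"
    unfolding nearly_invariant_clopen_def by blast
  interpret C: invariant_clopen V \<kappa> L X \<mu> I Q
    by unfold_locales (rule I)+
  have inj: "inj_on (app g) (support I)" "app g ` support I \<subseteq> elts X" if "g \<in> Sym V X" for g
    using inj_on_subset[OF Sym_app_inj[OF that]] Sym_app_mem[OF that] C.support_I0(2) by blast+
  have "1 - \<epsilon> \<le> C.limit C.D0"
  proof (rule C.limit_D0)
    fix g assume g: "g \<in> Sym V X"
    show "m (symdiff (act L X g ` C.D0) C.D0) \<le> \<epsilon>"
      unfolding C.D0_def symdiff_act_clo[OF g I(2) refl] by (rule small[OF inj[OF g]])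
  qed
  moreover obtain P where P: "P \<in> ms" "almost_invariant V L X \<mu> P" "C.limit C.D0 \<le> C.limit P"
    using C.almost_invariant_near_D0 by blast
  ultimately have "\<bar>m P - m C.D0\<bar> \<le> \<epsilon>" using C.limit_measure_bound[OF P(1)] by linarith
  then have "m P \<noteq> 0" "m P \<noteq> 1" using \<epsilon> unfolding C.D0_def by linarith+
  then show "\<not> ergodic V \<kappa> L X \<mu>" using P(1,2) unfolding ergodic_def by blast
qed

end

lemma invariant_kappa_measureI:
  assumes "kappa_measure V \<kappa> L X \<mu>" "invariant_measure V \<kappa> L X \<mu>"
  shows "invariant_kappa_measure V \<kappa> L X \<mu>"
  using assms unfolding invariant_kappa_measure_def invariant_kappa_measure_axioms_def invariant_measure_def
  by blast

section \<open>Comparison of two models on clopen sets\<close>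

locale relativization = M0: kappa_measure V0 \<kappa> L X \<mu> + M1: kappa_measure V1 \<kappa> L X \<mu>1
  for V0 V1 :: "'u::set_universe set" and \<kappa> L X \<mu> \<mu>1 +
  assumes relativization: "is_relativization V0 V1 \<kappa> L X \<mu> \<mu>1"
begin

text \<open>Literals refer to a tuple by position, atoms carry their entries. In use
  \<open>zs\<close> lists all entries that occur, and each entry is replaced by some position of it
  in \<open>zs\<close>.\<close>

definition literal :: "'u list \<Rightarrow> ('u \<times> 'u list) \<times> bool \<Rightarrow> 'u literal" where
  "literal zs l = (let p = Rel (fst (fst l)) (map (\<lambda>x. SOME i. i < length zs \<and> zs ! i = x) (snd (fst l)))
     in if snd l then p else Neg p)"

definition signed_cylinder :: "'u set \<Rightarrow> (('u \<times> 'u list) \<times> bool) list \<Rightarrow> 'u set" where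
  "signed_cylinder V ls = {M \<in> Str V L X. \<forall>l\<in>set ls. sat M (fst l) = snd l}"

lemma signed_cylinder_measure:
  assumes "fst ` set ls \<subseteq> atoms L X"
  shows "val \<mu>1 (signed_cylinder V1 ls) = val \<mu> (signed_cylinder V0 ls)"
proof -
  define zs where "zs = concat (map (snd \<circ> fst) ls)"
  define ix where "ix x = (SOME i. i < length zs \<and> zs ! i = x)" for x
  have ix: "ix x < length zs \<and> zs ! ix x = x" if "l \<in> set ls" "x \<in> set (snd (fst l))" for x l
  proof -
    have "x \<in> set zs" using that by (auto simp: zs_def)
    then have "\<exists>i. i < length zs \<and> zs ! i = x" by (simp add: in_set_conv_nth)
    then show ?thesis unfolding ix_def by (rule someI_ex)
  qed
  have zsX: "set zs \<subseteq> elts X" using assms by (fastforce simp: zs_def atoms_def)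
  have lit: "is_literal L (length zs) (literal zs l)" if "l \<in> set ls" for l
  proof -
    have "fst l \<in> atoms L X" using assms that by blast
    then show ?thesis using ix[OF that] unfolding literal_def ix_def[symmetric] atoms_def
      by (auto simp: Let_def)
  qed
  have sat: "lit_sat M zs (literal zs l) \<longleftrightarrow> sat M (fst l) = snd l" if "l \<in> set ls" for M l
  proof -
    have "map (nth zs) (map ix (snd (fst l))) = snd (fst l)" using ix[OF that] by (intro nth_equalityI) auto
    then show ?thesis unfolding literal_def ix_def[symmetric] by (simp add: Let_def sat_def)
  qed
  have "cylinder V L X (map (literal zs) ls) zs = signed_cylinder V ls" for V
    unfolding cylinder_def signed_cylinder_def using sat by auto
  moreover have "val \<mu>1 (cylinder V1 L X (map (literal zs) ls) zs) = val \<mu> (cylinder V0 L X (map (literal zs) ls) zs)"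
    using relativization zsX lit unfolding is_relativization_def by auto
  ultimately show ?thesis by simp
qed

lemma signed_cylinder_ms:
  assumes "fst ` set ls \<subseteq> atoms L X"
  shows "signed_cylinder V0 ls \<in> M0.ms" and "signed_cylinder V1 ls \<in> M1.ms"
proof -
  have eq: "signed_cylinder V ls = clopen_set V L X (fst ` set ls) (\<lambda>S. \<forall>l\<in>set ls. (fst l \<in> S) = snd l)" for V
    unfolding signed_cylinder_def clopen_set_def by auto
  show "signed_cylinder V0 ls \<in> M0.ms" "signed_cylinder V1 ls \<in> M1.ms"
    unfolding eq using assms by (auto intro!: M0.ms_clo M1.ms_clo)
qed

text \<open>Relativization speaks of conjunctions of literals only. Removing an atom from
  \<open>I\<close> splits the set according to its truth value, which is recorded in
  \<open>ls\<close>; when \<open>I\<close> is exhausted a signed cylinder or the empty set remains.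
  The list makes the induction hypothesis strong enough.\<close>

lemma clo_measure_signed:
  assumes "finite I" "I \<subseteq> atoms L X" "fst ` set ls \<subseteq> atoms L X"
  shows "val \<mu>1 (signed_cylinder V1 ls \<inter> clopen_set V1 L X I Q) =
    val \<mu> (signed_cylinder V0 ls \<inter> clopen_set V0 L X I Q)"
  using assms
proof (induction I arbitrary: ls Q)
  case empty
  have "signed_cylinder V ls \<inter> clopen_set V L X {} Q = (if Q {} then signed_cylinder V ls else {})" for V
    unfolding clopen_set_def signed_cylinder_def by auto
  then show ?case using signed_cylinder_measure[OF empty(2)] M0.m_empty M1.m_empty by simp
next
  case (insert a I)
  let ?Q = "\<lambda>S. Q (insert a S)"
  have split: "signed_cylinder V ls \<inter> clopen_set V L X (insert a I) Q =
      (signed_cylinder V (((a, True)) # ls) \<inter> clopen_set V L X I ?Q) \<union>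
      (signed_cylinder V (((a, False)) # ls) \<inter> clopen_set V L X I Q)" for V
  proof -
    have "{b \<in> insert a I. sat M b} = (if sat M a then insert a {b \<in> I. sat M b} else {b \<in> I. sat M b})" for M
      by auto
    then show ?thesis unfolding clopen_set_def signed_cylinder_def by auto
  qed
  have disj: "(signed_cylinder V (((a, True)) # ls) \<inter> clopen_set V L X I ?Q) \<inter>
      (signed_cylinder V (((a, False)) # ls) \<inter> clopen_set V L X I Q) = {}" for V
    unfolding signed_cylinder_def by auto
  have I: "finite I" "I \<subseteq> atoms L X" and l: "fst ` set ((a, b) # ls) \<subseteq> atoms L X" for b
    using insert.hyps insert.prems by auto
  note mem0 = M0.ms_Int[OF signed_cylinder_ms(1)[OF l] M0.ms_clo[OF I]]
  note mem1 = M1.ms_Int[OF signed_cylinder_ms(2)[OF l] M1.ms_clo[OF I]]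
  show ?case
    unfolding split M0.m_disjoint[OF mem0 mem0 disj] M1.m_disjoint[OF mem1 mem1 disj]
    using insert.IH[OF I(2) l] by simp
qed

lemma clo_measure:
  assumes "finite I" "I \<subseteq> atoms L X"
  shows "val \<mu>1 (clopen_set V1 L X I Q) = val \<mu> (clopen_set V0 L X I Q)"
proof -
  have "signed_cylinder V [] \<inter> clopen_set V L X I Q = clopen_set V L X I Q" for V
    unfolding signed_cylinder_def clopen_set_def by auto
  then show ?thesis using clo_measure_signed[OF assms, of "[]" Q] by simp
qed

text \<open>A permutation in \<open>V1\<close> need not belong to \<open>V0\<close>, but on the
  support of a clopen set some permutation in \<open>V0\<close> coincides with it. So invariance on
  clopen sets is inherited, and it suffices by \<open>invariant_measureI\<close>.\<close>

lemma invariant_relativization: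
  assumes inv: "invariant_measure V0 \<kappa> L X \<mu>"
  shows "invariant_measure V1 \<kappa> L X \<mu>1"
proof (rule M1.invariant_measureI)
  fix g I Q assume g: "g \<in> Sym V1 X" and I: "finite I" "I \<subseteq> atoms L X"
  have "inj_on (app g) (support I)" "app g ` support I \<subseteq> elts X"
    using inj_on_subset[OF M1.Sym_app_inj[OF g] support_atoms[OF I(2)]] M1.Sym_app_mem[OF g] support_atoms[OF I(2)]
    by blast+
  then obtain h where h: "h \<in> Sym V0 X" "\<And>x. x \<in> support I \<Longrightarrow> app h x = app g x"
    using M0.permutation_extension[OF M0.X_mem finite_support[OF I(1)] support_atoms[OF I(2)]] by blast
  have mv: "move (app h) a = move (app g) a" if "a \<in> I" for a
    by (rule move_cong[OF order_refl h(2) that])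
  then have im: "move (app h) ` I = move (app g) ` I" "\<And>S. {a \<in> I. move (app h) a \<in> S} = {a \<in> I. move (app g) a \<in> S}"
    by auto
  have "val \<mu>1 (act L X g ` clopen_set V1 L X I Q) = val \<mu> (act L X h ` clopen_set V0 L X I Q)"
    unfolding M1.act_clopen[OF g I(2)] M0.act_clopen[OF h(1) I(2)] im
    using I M1.move_subset_atoms[OF g] by (intro clo_measure) auto
  also have "\<dots> = val \<mu> (clopen_set V0 L X I Q)"
    using inv h(1) M0.ms_clo[OF I] unfolding invariant_measure_def by blast
  finally show "val \<mu>1 (act L X g ` clopen_set V1 L X I Q) = val \<mu>1 (clopen_set V1 L X I Q)"
    using clo_measure[OF I] by simp
qed

text \<open>The maps \<sigma> are HOL injections, the same on both sides, and translates of finite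
  sets of atoms are finite sets of atoms. So every measure that occurs is covered by
  \<open>clo_measure\<close>.\<close>

lemma nearly_invariant_clopen_absolute:
  "nearly_invariant_clopen L X (\<lambda>I Q. val \<mu> (clopen_set V0 L X I Q)) \<longleftrightarrow>
   nearly_invariant_clopen L X (\<lambda>I Q. val \<mu>1 (clopen_set V1 L X I Q))"
proof -
  have moved: "finite (move \<sigma> ` I \<union> I) \<and> move \<sigma> ` I \<union> I \<subseteq> atoms L X"
    if "finite I" "I \<subseteq> atoms L X" "\<sigma> ` support I \<subseteq> elts X" for I \<sigma>
    using that by (fastforce simp: move_def atoms_def support_def)
  show ?thesis
    unfolding nearly_invariant_clopen_def
    by (intro ex_cong1 conj_cong refl all_cong1 imp_cong) (simp_all only: clo_measure moved)
qed

end

theorem proposition5p22: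
  fixes V0 V1 :: "'u::set_universe set" and \<kappa> X L \<mu> \<mu>1 :: 'u
  assumes "model_of_set_theory V0" and "model_of_set_theory V1" and "V0 \<subseteq> V1"
    and "\<kappa> \<in> V0" and "ordinal \<kappa>" and "infinite (elts \<kappa>)"
    and "X \<in> V0" and "infinite (elts X)"
    and "L \<in> V0" and "relational_language L"
    and "invariant_measure V0 \<kappa> L X \<mu>"
    and "is_relativization V0 V1 \<kappa> L X \<mu> \<mu>1"
  shows "ergodic V0 \<kappa> L X \<mu> \<longleftrightarrow> ergodic V1 \<kappa> L X \<mu>1"
proof -
  have m0: "kappa_measure V0 \<kappa> L X \<mu>"
    using assms unfolding invariant_measure_def by unfold_locales blast+
  have m1: "kappa_measure V1 \<kappa> L X \<mu>1"
    using assms unfolding is_relativization_def by unfold_locales blast+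
  interpret relativization V0 V1 \<kappa> L X \<mu> \<mu>1
    using m0 m1 assms(12) by (intro relativization.intro relativization_axioms.intro)
  interpret I0: invariant_kappa_measure V0 \<kappa> L X \<mu>
    by (rule invariant_kappa_measureI[OF m0 assms(11)])
  interpret I1: invariant_kappa_measure V1 \<kappa> L X \<mu>1
    by (rule invariant_kappa_measureI[OF m1 invariant_relativization[OF assms(11)]])
  show ?thesis
    using I0.not_ergodic_iff I1.not_ergodic_iff nearly_invariant_clopen_absolute by blast
qed

end
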